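(* Let $G:[0,1]\to\mathbb{R}$ be a continuous convex function such that $G(0)=0$. Let $\alpha>0$, $p>0$. Then the supremum of the functional $$\int_{\mathbb{C}}G\left(|f(z)e^{-\alpha|z|^2/2}|^p\right)dA(z)$$ subject to the condition that $f\in\mathcal{H}(\mathbb{C})$ and $$\frac{p\alpha}{2\pi}\int_{\mathbb{C}}|f(z)e^{-\alpha|z|^2/2}|^p\,dA(z)=1$$ is attained at $f(z)=e^{\alpha\bar a z-\alpha|a|^2/2}$ for any $a\in\mathbb{C}$. If $G$ is not linear on $[0,1]$, and this supremum is finite (i.e. $>-\infty$), then these are the only maximizers, up to a unimodular factor.
   Context: $\mathcal{H}(\mathbb{C})$ is the space of entire functions of one complex variable and $dA(z)=dx\,dy$, $z=x+iy$, is Lebesgue measure on $\mathbb{C}$. The functional takes values in $[-\infty,+\infty)$ and its supremum can be finite or $-\infty$, depending on $G$. Under the normalization constraint one has $|f(z)e^{-\alpha|z|^2/2}|\le1$ for all $z\in\mathbb{C}$, so the integrand is well defined. *)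

theory Defs
  imports "HOL-Complex_Analysis.Complex_Analysis"
begin

definition fock_weighted :: "real \<Rightarrow> real \<Rightarrow> (complex \<Rightarrow> complex) \<Rightarrow> complex \<Rightarrow> real" where
  "fock_weighted \<alpha> p f z =
     norm (f z * complex_of_real (exp (- \<alpha> * (norm z)\<^sup>2 / 2))) powr p"

text \<open>The normalization value 1 is nonzero, so it forces the weighted power to be integrable
  (a non-integrable function has Bochner integral 0). It also forces
  \<open>fock_weighted \<alpha> p f z \<le> 1\<close>, so a function \<open>G\<close> given on \<open>[0,1]\<close> is only evaluated there.\<close>

definition fock_admissible :: "real \<Rightarrow> real \<Rightarrow> (complex \<Rightarrow> complex) set" where
  "fock_admissible \<alpha> p =
     {f. f holomorphic_on UNIV \<and>
         p * \<alpha> / (2 * pi) * (LINT z|lborel. fock_weighted \<alpha> p f z) = 1}"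

text \<open>The extended-real integral \<open>\<integral> G(u) = \<integral> G(u)\<^sup>+ - \<integral> G(u)\<^sup>-\<close>. For convex \<open>G\<close> with \<open>G 0 = 0\<close> and
  admissible \<open>f\<close>, \<open>G t \<le> t * G 1\<close> makes the first integral finite, so
  \<open>\<infinity> - \<infinity>\<close> does not occur and the value lies in \<open>[-\<infinity>, \<infinity>)\<close>.\<close>

definition fock_functional ::
  "(real \<Rightarrow> real) \<Rightarrow> real \<Rightarrow> real \<Rightarrow> (complex \<Rightarrow> complex) \<Rightarrow> ereal" where
  "fock_functional G \<alpha> p f =
     enn2ereal (\<integral>\<^sup>+ z. ennreal (max 0 (G (fock_weighted \<alpha> p f z))) \<partial>lborel)
   - enn2ereal (\<integral>\<^sup>+ z. ennreal (max 0 (- G (fock_weighted \<alpha> p f z))) \<partial>lborel)"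

definition fock_kernel :: "real \<Rightarrow> complex \<Rightarrow> complex \<Rightarrow> complex" where
  "fock_kernel \<alpha> a z =
     exp (complex_of_real \<alpha> * cnj a * z - complex_of_real (\<alpha> * (norm a)\<^sup>2 / 2))"

end

theory Submission
  imports Defs
begin

text \<open>
  Put \<open>u = |f|\<^sup>p exp(- p \<alpha> |z|\<^sup>2 / 2)\<close>, let \<open>\<mu>(t)\<close> be the area of \<open>{u > t}\<close> and
  \<open>c = 2 \<pi> / (p \<alpha>)\<close>.  The proof rests on one fact (\<open>level_measure_decay\<close>): the function
  \<open>\<mu>(t) + c ln t\<close> is nonincreasing below the maximum of \<open>u\<close>.  For the Gaussian, the weight of
  \<open>f = 1\<close>, the area is exactly \<open>- c ln t\<close>, so areas of superlevel sets of \<open>u\<close> always shrink at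
  least as fast as those of the Gaussian.

  The fact itself is an isoperimetric statement.  Away from the zeros of \<open>f\<close> the function
  \<open>v = ln u\<close> has constant Laplacian \<open>- 2 p \<alpha>\<close>.  For a cutoff \<open>\<phi>\<close> rising from 0 to 1 between the
  heights \<open>ln s\<close> and \<open>ln t\<close>, partial integration gives
  \<open>\<integral> \<phi>'(v) |\<nabla>v|\<^sup>2 = 2 p \<alpha> \<integral> \<phi>(v) \<le> 2 p \<alpha> \<mu>(s)\<close>.  Together with the Cauchy-Schwarz inequality
  and the sharp planar inequality \<open>4 \<pi> \<integral> w\<^sup>2 \<le> (\<integral> |\<nabla>w|)\<^sup>2\<close> (\<open>planar_sobolev\<close>, proved by
  transporting \<open>w\<^sup>2\<close> to the unit disc) for \<open>w = \<phi>(v)\<close> this bounds \<open>\<mu>(s) - \<mu>(t)\<close> from below; cutting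
  the interval of heights into many short pieces makes the bound sharp.

  Comparing integrals by layers, the decay of \<open>\<mu>\<close> and the normalization force \<open>u \<le> 1\<close>
  (\<open>u_le_1\<close>).  If the value 1 is attained, then every superlevel set of \<open>u\<close> is at least as large as
  that of the Gaussian although the integrals agree; testing with a convex function of the height that
  vanishes away from 1, near a peak where \<open>|f|\<^sup>p\<close> is the squared modulus of a holomorphic function, shows that \<open>f\<close> is a
  unimodular multiple of a kernel (\<open>normalized_peak_imp_kernel\<close>).  If the maximum is smaller than 1,
  then \<open>\<mu>(t) + c ln t\<close> is positive below some height \<open>\<tau>\<close> and not positive above it
  (\<open>level_crossing\<close>).  Subtract from \<open>G\<close> a tangent line at \<open>\<tau>\<close>; this changes the functional by the same
  amount for all admissible functions.  What remains decreases on \<open>[0, \<tau>]\<close> and increases on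
  \<open>[\<tau>, 1]\<close>, so both of its monotone parts favour the Gaussian, strictly unless \<open>G\<close> is linear
  (\<open>functional_le_gauss\<close>).
\<close>

section \<open>The planar Sobolev inequality by transport\<close>

text \<open>The quantile function of the first coordinate of a uniformly distributed point of the unit disc,
  expressed by the angle \<open>\<theta>\<close> with \<open>x = sin \<theta>\<close>: the inverse of the distribution function
  \<open>1/2 + (\<theta> + sin \<theta> cos \<theta>) / \<pi>\<close>.  The angle is used because the distribution function is then smooth
  up to the ends of the interval.\<close>

lemma semicircle_quantile:
  obtains \<theta> :: "real \<Rightarrow> real" where "continuous_on {0..1} \<theta>"
    "\<And>t. t \<in> {0<..<1} \<Longrightarrow> 0 < cos (\<theta> t)"
    "\<And>t. t \<in> {0<..<1} \<Longrightarrow> (\<theta> has_real_derivative pi / (2 * (cos (\<theta> t))\<^sup>2)) (at t)"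
proof -
  define S :: "real \<Rightarrow> real" where "S = (\<lambda>\<tau>. 1/2 + (\<tau> + sin \<tau> * cos \<tau>) / pi)"
  define I where "I = {-(pi/2)..pi/2}"
  have dS: "(S has_real_derivative 2 * (cos \<tau>)\<^sup>2 / pi) (at \<tau>)" for \<tau>
  proof -
    have "(S has_real_derivative (1 + (cos \<tau> * cos \<tau> - sin \<tau> * sin \<tau>)) / pi) (at \<tau>)"
      unfolding S_def by (auto intro!: derivative_eq_intros simp: field_simps)
    moreover have "1 + (cos \<tau> * cos \<tau> - sin \<tau> * sin \<tau>) = 2 * (cos \<tau>)\<^sup>2"
      using sin_cos_squared_add[of \<tau>] by (simp add: power2_eq_square)
    ultimately show ?thesis by simp
  qed
  have contS: "continuous_on A S" for A
    using dS by (meson DERIV_isCont continuous_at_imp_continuous_on)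
  have S_less: "S \<sigma> < S \<tau>" if "\<sigma> \<in> I" "\<tau> \<in> I" "\<sigma> < \<tau>" for \<sigma> \<tau>
  proof (rule DERIV_pos_imp_increasing_open[OF \<open>\<sigma> < \<tau>\<close>])
    fix x assume "\<sigma> < x" "x < \<tau>"
    then have "0 < cos x" using that unfolding I_def by (intro cos_gt_zero_pi) auto
    then show "\<exists>y. DERIV S x :> y \<and> y > 0" using dS[of x] by (intro exI[of _ "2 * (cos x)\<^sup>2 / pi"]) auto
  qed (rule contS)
  have S_le: "S \<sigma> \<le> S \<tau>" if "\<sigma> \<in> I" "\<tau> \<in> I" "\<sigma> \<le> \<tau>" for \<sigma> \<tau>
    using S_less[OF that(1,2)] that(3) by (cases "\<sigma> = \<tau>") auto
  have inj: "inj_on S I"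
    by (rule inj_onI) (metis S_less linorder_neqE order_less_irrefl)
  define \<theta> where "\<theta> = the_inv_into I S"
  have S_ends: "S (-(pi/2)) = 0" "S (pi/2) = 1" by (auto simp: S_def)
  have img: "S ` I = {0..1}"
  proof
    show "S ` I \<subseteq> {0..1}"
    proof clarify
      fix \<tau> assume "\<tau> \<in> I"
      then have "S (-(pi/2)) \<le> S \<tau>" "S \<tau> \<le> S (pi/2)"
        by (intro S_le; simp add: I_def)+
      then show "S \<tau> \<in> {0..1}" using S_ends by auto
    qed
    show "{0..1} \<subseteq> S ` I"
    proof
      fix t :: real assume t: "t \<in> {0..1}"
      have "\<exists>x\<ge>-(pi/2). x \<le> pi/2 \<and> S x = t"
        by (rule IVT') (use t S_ends contS in auto)
      then show "t \<in> S ` I" unfolding I_def by auto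
    qed
  qed
  have S_\<theta>: "S (\<theta> t) = t" "\<theta> t \<in> I" if "t \<in> {0..1}" for t
    using f_the_inv_into_f[OF inj] the_inv_into_into[OF inj] that img unfolding \<theta>_def by auto
  have cont: "continuous_on {0..1} \<theta>"
    using continuous_on_inv_into[of I S] contS inj
    by (simp add: \<theta>_def img[symmetric] I_def)
  have pos: "0 < cos (\<theta> t)" if t: "t \<in> {0<..<1}" for t
  proof (rule cos_gt_zero_pi)
    have "\<theta> t \<in> I" "\<theta> t \<noteq> -(pi/2)" "\<theta> t \<noteq> pi/2"
      using S_\<theta>[of t] t S_ends by force+
    then show "- (pi / 2) < \<theta> t" "\<theta> t < pi / 2" unfolding I_def by auto
  qed
  have der: "(\<theta> has_real_derivative pi / (2 * (cos (\<theta> t))\<^sup>2)) (at t)" if t: "t \<in> {0<..<1}" for t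
  proof -
    have "isCont \<theta> t" using cont t
      by (meson continuous_on_interior greaterThanLessThan_subseteq_atLeastAtMost_iff interior_maximal open_greaterThanLessThan order_refl subsetD)
    then have "DERIV \<theta> t :> inverse (2 * (cos (\<theta> t))\<^sup>2 / pi)"
      using t pos[OF t] S_\<theta> by (intro DERIV_inverse_function[where a=0 and b=1, OF dS]) auto
    then show ?thesis by (simp add: field_simps)
  qed
  show ?thesis using that[OF cont pos der] by blast
qed

text \<open>The triangular transport of \<open>w\<^sup>2\<close> to the unit disc, seen on one vertical line: \<open>v\<close> is the
  restriction of \<open>w\<close>, \<open>X\<close> that of its horizontal derivative, \<open>\<mu>\<close> the mass of \<open>v\<^sup>2\<close>, \<open>M\<close> the total mass,
  \<open>s\<close> the horizontal image coordinate and \<open>c\<close> the half length of the chord of the disc at \<open>s\<close>.  The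
  factor \<open>\<pi> \<mu> / (2 M c)\<close> is the derivative of the horizontal component; the vertical component \<open>T\<close>
  spreads the mass of the line uniformly over the chord.  The product of the two diagonal derivatives is
  \<open>\<pi> v\<^sup>2 / M\<close>, so their sum is at least \<open>2 sqrt(\<pi> / M) v\<close>, and since the image point \<open>(s, T)\<close> lies in
  the unit disc, its product with the gradient is at most the length of the gradient.\<close>

lemma knothe_fibre:
  fixes v v' X :: "real \<Rightarrow> real"
  assumes R: "0 < R" and dv: "\<And>y. (v has_real_derivative v' y) (at y)"
    and cv': "continuous_on UNIV v'" and cX: "continuous_on UNIV X"
    and v0: "v R = 0" "v (-R) = 0" and nn: "\<And>y. 0 \<le> v y"
    and \<mu>: "\<mu> = integral {-R..R} (\<lambda>y. (v y)\<^sup>2)" "0 < \<mu>" and M: "0 < M"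
    and c: "0 < c" and sc: "s\<^sup>2 + c\<^sup>2 = 1"
  shows "2 * sqrt (pi / M) * \<mu> \<le> pi * \<mu> / (2 * M * c) * integral {-R..R} v + s * integral {-R..R} X
           + integral {-R..R} (\<lambda>y. sqrt ((X y)\<^sup>2 + (v' y)\<^sup>2))"
proof -
  have cv: "continuous_on A v" for A using dv by (meson DERIV_isCont continuous_at_imp_continuous_on)
  have cv'': "continuous_on A v'" for A using cv' continuous_on_subset by blast
  have cX': "continuous_on A X" for A using cX continuous_on_subset by blast
  note [continuous_intros] = cv cv'' cX'
  define T where "T = (\<lambda>y. c * (2 * (integral {-R..y} (\<lambda>y. (v y)\<^sup>2) / \<mu>) - 1))"
  have dT: "(T has_real_derivative 2 * c * (v y)\<^sup>2 / \<mu>) (at y within {-R..R})" if "y \<in> {-R..R}" for y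
  proof -
    have "((\<lambda>y. integral {-R..y} (\<lambda>y. (v y)\<^sup>2)) has_real_derivative (v y)\<^sup>2) (at y within {-R..R})"
      by (rule integral_has_real_derivative) (use that in \<open>auto intro!: continuous_intros\<close>)
    then show ?thesis unfolding T_def using \<mu>
      by (auto intro!: derivative_eq_intros simp: field_simps)
  qed
  have T1: "(T y)\<^sup>2 \<le> c\<^sup>2" if "y \<in> {-R..R}" for y
  proof -
    have "0 \<le> integral {-R..y} (\<lambda>y. (v y)\<^sup>2)" "integral {-R..y} (\<lambda>y. (v y)\<^sup>2) \<le> \<mu>"
      using that unfolding \<mu> by (auto intro!: integral_nonneg integral_subset_le integrable_continuous_interval continuous_intros)
    then have "\<bar>2 * (integral {-R..y} (\<lambda>y. (v y)\<^sup>2) / \<mu>) - 1\<bar> \<le> 1"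
      using \<open>0 < \<mu>\<close> by (auto simp: abs_le_iff field_simps)
    then show ?thesis unfolding T_def power_mult_distrib
      using abs_square_le_1 by (metis mult_left_le zero_le_power2)
  qed
  have ibp: "((\<lambda>y. v' y * T y + v y * (2 * c * (v y)\<^sup>2 / \<mu>)) has_integral (v R * T R - v (-R) * T (-R))) {-R..R}"
  proof (rule fundamental_theorem_of_calculus)
    show "- R \<le> R" using R by simp
    fix y assume "y \<in> {-R..R}"
    then have "((\<lambda>y. v y * T y) has_real_derivative v' y * T y + v y * (2 * c * (v y)\<^sup>2 / \<mu>)) (at y within {-R..R})"
      by (intro DERIV_cong[OF DERIV_mult[OF DERIV_subset[OF dv] dT]]) auto
    then show "((\<lambda>y. v y * T y) has_vector_derivative v' y * T y + v y * (2 * c * (v y)\<^sup>2 / \<mu>)) (at y within {-R..R})"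
      by (simp add: has_real_derivative_iff_has_vector_derivative)
  qed
  have pt: "2 * sqrt (pi / M) * (v y)\<^sup>2 \<le> pi * \<mu> / (2 * M * c) * v y + s * X y + sqrt ((X y)\<^sup>2 + (v' y)\<^sup>2)
       + (v' y * T y + v y * (2 * c * (v y)\<^sup>2 / \<mu>))" if y: "y \<in> {-R..R}" for y
  proof -
    \<comment> \<open>arithmetic-geometric mean: the divergence dominates the square root of the Jacobian\<close>
    define A where "A = pi * \<mu> / (2 * M * c)"
    define B where "B = 2 * c * (v y)\<^sup>2 / \<mu>"
    have AB: "0 \<le> A" "0 \<le> B" "A * B = pi / M * (v y)\<^sup>2"
      unfolding A_def B_def using \<mu> M c by (auto simp: field_simps)
    have "2 * sqrt (A * B) \<le> A + B" using arith_geo_mean_sqrt[of A B] AB by simp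
    then have "2 * (sqrt (pi / M) * v y) \<le> A + B" unfolding AB real_sqrt_mult using nn[of y] by simp
    then have 1: "2 * sqrt (pi / M) * (v y)\<^sup>2 \<le> v y * (A + B)"
      using mult_left_mono[OF _ nn[of y], of "2 * (sqrt (pi / M) * v y)" "A + B"] by (simp add: power2_eq_square algebra_simps)
    have "(s * X y + v' y * T y)\<^sup>2 \<le> (s\<^sup>2 + (T y)\<^sup>2) * ((X y)\<^sup>2 + (v' y)\<^sup>2)"
    proof -
      have "(s\<^sup>2 + (T y)\<^sup>2) * ((X y)\<^sup>2 + (v' y)\<^sup>2) - (s * X y + v' y * T y)\<^sup>2 = (s * v' y - T y * X y)\<^sup>2"
        by (simp add: power2_eq_square algebra_simps)
      then show ?thesis by (smt (verit) zero_le_power2)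
    qed
    also have "\<dots> \<le> 1 * ((X y)\<^sup>2 + (v' y)\<^sup>2)"
      using T1[OF y] sc by (intro mult_right_mono) auto
    finally have "\<bar>s * X y + v' y * T y\<bar> \<le> sqrt ((X y)\<^sup>2 + (v' y)\<^sup>2)"
      by (metis mult_1 real_sqrt_abs real_sqrt_le_mono)
    then show ?thesis using 1 unfolding A_def B_def by (simp add: algebra_simps)
  qed
  have "2 * sqrt (pi / M) * \<mu> = integral {-R..R} (\<lambda>y. 2 * sqrt (pi / M) * (v y)\<^sup>2)"
    unfolding \<mu> by simp
  also have "\<dots> \<le> pi * \<mu> / (2 * M * c) * integral {-R..R} v + s * integral {-R..R} X
           + integral {-R..R} (\<lambda>y. sqrt ((X y)\<^sup>2 + (v' y)\<^sup>2)) + (v R * T R - v (-R) * T (-R))"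
    by (rule has_integral_le[OF integrable_integral has_integral_add[OF has_integral_add[OF has_integral_add[OF has_integral_mult_right has_integral_mult_right]] ibp]])
      (use pt in \<open>auto intro!: integrable_integral integrable_continuous_interval continuous_intros\<close>)
  finally show ?thesis using v0 by simp
qed

text \<open>Integrating the estimate on vertical lines over \<open>x\<close>, the first two terms of its right-hand side
  add up to the derivative of \<open>sin \<theta>(x) W(x)\<close>, where \<open>W(x)\<close> is the integral of \<open>w\<close> over the line.  This
  product vanishes at the ends of the interval that carries the mass, so only the length of the gradient
  remains.  Each component of the transport is differentiated only in its own direction, so partial
  integration along single lines suffices.\<close>

theorem planar_sobolev_box:
  fixes w wx wy :: "real \<Rightarrow> real \<Rightarrow> real"
  assumes R: "0 < R"
    and cw: "continuous_on UNIV (\<lambda>(x,y). w x y)"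
    and cx: "continuous_on UNIV (\<lambda>(x,y). wx x y)" and cy: "continuous_on UNIV (\<lambda>(x,y). wy x y)"
    and dx: "\<And>x y. ((\<lambda>t. w t y) has_real_derivative wx x y) (at x)"
    and dy: "\<And>x y. ((\<lambda>t. w x t) has_real_derivative wy x y) (at y)"
    and nn: "\<And>x y. 0 \<le> w x y"
    and supp: "\<And>x y. R \<le> \<bar>x\<bar> \<or> R \<le> \<bar>y\<bar> \<Longrightarrow> w x y = 0"
  shows "4 * pi * integral {-R..R} (\<lambda>x. integral {-R..R} (\<lambda>y. (w x y)\<^sup>2))
    \<le> (integral {-R..R} (\<lambda>x. integral {-R..R} (\<lambda>y. sqrt ((wx x y)\<^sup>2 + (wy x y)\<^sup>2))))\<^sup>2"
proof -
  have cw2: "continuous_on A (\<lambda>z. w (f z) (g z))"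
    if "continuous_on A f" "continuous_on A g" for A :: "'z::topological_space set" and f g
    using continuous_on_compose2[OF cw, of A "\<lambda>z. (f z, g z)"] that by (simp add: continuous_on_Pair)
  have cx2: "continuous_on A (\<lambda>z. wx (f z) (g z))"
    if "continuous_on A f" "continuous_on A g" for A :: "'z::topological_space set" and f g
    using continuous_on_compose2[OF cx, of A "\<lambda>z. (f z, g z)"] that by (simp add: continuous_on_Pair)
  have cy2: "continuous_on A (\<lambda>z. wy (f z) (g z))"
    if "continuous_on A f" "continuous_on A g" for A :: "'z::topological_space set" and f g
    using continuous_on_compose2[OF cy, of A "\<lambda>z. (f z, g z)"] that by (simp add: continuous_on_Pair)
  note [continuous_intros] = cw2 cx2 cy2
  define m where "m = (\<lambda>x. integral {-R..R} (\<lambda>y. (w x y)\<^sup>2))"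
  define W where "W = (\<lambda>x. integral {-R..R} (\<lambda>y. w x y))"
  define Wx where "Wx = (\<lambda>x. integral {-R..R} (\<lambda>y. wx x y))"
  define L where "L = (\<lambda>x. integral {-R..R} (\<lambda>y. sqrt ((wx x y)\<^sup>2 + (wy x y)\<^sup>2)))"
  have cm: "continuous_on A m" for A
    unfolding m_def cbox_interval[symmetric]
    by (rule integral_continuous_on_param) (auto simp: split_beta intro!: continuous_intros)
  have cWx: "continuous_on A Wx" for A
    unfolding Wx_def cbox_interval[symmetric]
    by (rule integral_continuous_on_param) (auto simp: split_beta intro!: continuous_intros)
  have cL: "continuous_on A L" for A
    unfolding L_def cbox_interval[symmetric]
    by (rule integral_continuous_on_param) (auto simp: split_beta intro!: continuous_intros)
  have dW: "(W has_real_derivative Wx x) (at x)" for x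
    unfolding W_def Wx_def cbox_interval[symmetric]
    by (rule leibniz_rule_field_derivative[where U=UNIV])
      (auto simp: split_beta intro!: continuous_intros integrable_continuous_interval dx)
  have cW: "continuous_on A W" for A using dW by (meson DERIV_isCont continuous_at_imp_continuous_on)
  have m_nn: "0 \<le> m x" for x unfolding m_def by (auto intro!: integral_nonneg integrable_continuous_interval continuous_intros)
  have L_nn: "0 \<le> L x" for x unfolding L_def by (auto intro!: integral_nonneg integrable_continuous_interval continuous_intros)
  have m0: "w x y = 0" if "m x = 0" for x y
  proof (cases "\<bar>y\<bar> \<ge> R")
    case False
    have "\<forall>y\<in>{-R..R}. (w x y)\<^sup>2 = 0"
      using that unfolding m_def by (subst (asm) integral_eq_0_iff) (use R in \<open>auto intro!: continuous_intros\<close>)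
    moreover have "y \<in> {-R..R}" using False by auto
    ultimately have "(w x y)\<^sup>2 = 0" by (rule bspec)
    then show ?thesis by simp
  qed (use supp in auto)
  have Wx_L: "\<bar>Wx x\<bar> \<le> L x" for x
    unfolding Wx_def L_def real_norm_def[symmetric]
    by (rule integral_norm_bound_integral) (auto intro!: integrable_continuous_interval continuous_intros)
  define F where "F = (\<lambda>x. integral {-R..x} m)"
  define M where "M = F R"
  have dF: "(F has_real_derivative m x) (at x within {-R..R})" if "x \<in> {-R..R}" for x
    unfolding F_def using that by (intro integral_has_real_derivative cm)
  have cF: "continuous_on {-R..R} F" using dF by (meson DERIV_continuous_on)
  have F_mono: "F x \<le> F y" if "x \<le> y" "-R \<le> x" for x y
    unfolding F_def using that m_nn by (intro integral_subset_le) (auto intro!: integrable_continuous_interval cm)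
  have F0: "F (-R) = 0" by (simp add: F_def)
  have F_nn: "0 \<le> F x" if "-R \<le> x" for x using F_mono[of "-R" x] F0 that by simp
  have mF0: "m x = 0" if "F x = 0" "x \<in> {-R..R}" for x
  proof (cases "x = -R")
    case True then show ?thesis using supp R unfolding m_def by simp
  next
    case False
    have "\<forall>z\<in>{-R..x}. m z = 0"
      using that m_nn False unfolding F_def by (subst (asm) integral_eq_0_iff) (auto intro!: cm)
    then show ?thesis using that by auto
  qed
  have mFM: "m x = 0" if "F x = M" "x \<in> {-R..R}" for x
  proof (cases "x = R")
    case True then show ?thesis using supp R unfolding m_def by simp
  next
    case False
    have "integral {-R..x} m + integral {x..R} m = integral {-R..R} m"
      by (rule Henstock_Kurzweil_Integration.integral_combine) (use that in \<open>auto intro!: integrable_continuous_interval cm\<close>)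
    then have "integral {x..R} m = 0" using that unfolding F_def M_def by simp
    then have "\<forall>z\<in>{x..R}. m z = 0"
      using that m_nn False by (subst (asm) integral_eq_0_iff) (auto intro!: cm)
    then show ?thesis using that by auto
  qed
  show ?thesis
  proof (cases "M = 0")
    case True
    then show ?thesis unfolding M_def F_def m_def by simp
  next
    case False
    then have Mpos: "0 < M" using F_nn[of R] R unfolding M_def by simp
    obtain \<theta> :: "real \<Rightarrow> real" where \<theta>: "continuous_on {0..1} \<theta>"
      "\<And>t. t \<in> {0<..<1} \<Longrightarrow> 0 < cos (\<theta> t)"
      "\<And>t. t \<in> {0<..<1} \<Longrightarrow> (\<theta> has_real_derivative pi / (2 * (cos (\<theta> t))\<^sup>2)) (at t)"
      by (rule semicircle_quantile) (rule that)
    \<comment> \<open>the open interval in which the horizontal coordinate of the transport is differentiable; \<open>w\<close> vanishes on its end lines\<close>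
    define a where "a = Sup {x\<in>{-R..R}. F x = 0}"
    define b where "b = Inf {x\<in>{-R..R}. F x = M}"
    have closed: "closed {x\<in>{-R..R}. F x = k}" for k
      using continuous_closed_preimage_constant[OF cF] by auto
    have "a \<in> {x\<in>{-R..R}. F x = 0}"
      unfolding a_def
    proof (rule closed_contains_Sup[OF _ _ closed])
      have "-R \<in> {x\<in>{-R..R}. F x = 0}" using R F0 by simp
      then show "{x\<in>{-R..R}. F x = 0} \<noteq> {}" by blast
    qed (auto intro!: bdd_aboveI[of _ R])
    then have a: "a \<in> {-R..R}" "F a = 0" by auto
    have "b \<in> {x\<in>{-R..R}. F x = M}"
      unfolding b_def
    proof (rule closed_contains_Inf[OF _ _ closed])
      have "R \<in> {x\<in>{-R..R}. F x = M}" using R by (simp add: M_def)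
      then show "{x\<in>{-R..R}. F x = M} \<noteq> {}" by blast
    qed (auto intro!: bdd_belowI[of _ "-R"])
    then have b: "b \<in> {-R..R}" "F b = M" by auto
    have ab: "a < b" using F_mono[of b a] a b Mpos by force
    have Fin: "0 < F x" "F x < M" if "x \<in> {a<..<b}" for x
    proof -
      have x: "x \<in> {-R..R}" using that a b by auto
      have "F x \<noteq> 0"
      proof
        assume "F x = 0"
        then have "x \<le> a" unfolding a_def using x by (intro cSup_upper) (auto intro!: bdd_aboveI[of _ R])
        then show False using that by simp
      qed
      then show "0 < F x" using F_nn x by force
      have "F x \<noteq> M"
      proof
        assume "F x = M"
        then have "b \<le> x" unfolding b_def using x by (intro cInf_lower) (auto intro!: bdd_belowI[of _ "-R"])
        then show False using that by simp
      qed
      then show "F x < M" using F_mono[of x R] x unfolding M_def by force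
    qed
    define t where "t = (\<lambda>x. \<theta> (F x / M))"
    have Fab: "F x \<in> {0..M}" if "x \<in> {a..b}" for x
      using F_nn[of x] F_mono[of x b] a b that by auto
    have ct: "continuous_on {a..b} t"
      unfolding t_def
    proof (rule continuous_on_compose2[OF \<theta>(1)])
      show "continuous_on {a..b} (\<lambda>x. F x / M)"
        using a b Mpos by (auto intro!: continuous_intros continuous_on_subset[OF cF])
      show "(\<lambda>x. F x / M) ` {a..b} \<subseteq> {0..1}" using Fab Mpos by auto
    qed
    have t_pos: "0 < cos (t x)" if "x \<in> {a<..<b}" for x
      unfolding t_def using Fin[OF that] Mpos by (intro \<theta>) auto
    have dt: "(t has_real_derivative pi / (2 * (cos (t x))\<^sup>2) * (m x / M)) (at x)" if "x \<in> {a<..<b}" for x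
      unfolding t_def
    proof (rule DERIV_chain2[OF \<theta>(3)])
      show "F x / M \<in> {0<..<1}" using Fin[OF that] Mpos by auto
      have "x \<in> interior {-R..R}" using that a b by (auto simp: interior_atLeastAtMost_real)
      then have "(F has_real_derivative m x) (at x)"
        using dF[of x] interior_subset at_within_interior by fastforce
      then show "((\<lambda>x. F x / M) has_real_derivative m x / M) (at x)"
        by (rule DERIV_cdivide)
    qed
    have ibp: "((\<lambda>x. pi * m x / (2 * M * cos (t x)) * W x + sin (t x) * Wx x) has_integral
         (W b * sin (t b) - W a * sin (t a))) {a..b}"
    proof (rule fundamental_theorem_of_calculus_interior)
      show "a \<le> b" using ab by simp
      show "continuous_on {a..b} (\<lambda>x. W x * sin (t x))" by (intro continuous_intros cW ct)
      fix x assume x: "x \<in> {a<..<b}"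
      have "((\<lambda>x. W x * sin (t x)) has_real_derivative
          Wx x * sin (t x) + W x * (cos (t x) * (pi / (2 * (cos (t x))\<^sup>2) * (m x / M)))) (at x)"
        by (rule derivative_eq_intros dW dt[OF x] refl)+ (simp add: algebra_simps)
      moreover have "Wx x * sin (t x) + W x * (cos (t x) * (pi / (2 * (cos (t x))\<^sup>2) * (m x / M)))
          = pi * m x / (2 * M * cos (t x)) * W x + sin (t x) * Wx x"
        using t_pos[OF x] Mpos by (simp add: field_simps power2_eq_square)
      ultimately show "((\<lambda>x. W x * sin (t x)) has_vector_derivative
          pi * m x / (2 * M * cos (t x)) * W x + sin (t x) * Wx x) (at x)"
        unfolding has_real_derivative_iff_has_vector_derivative by metis
    qed
    have "w a = (\<lambda>y. 0)" "w b = (\<lambda>y. 0)"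
      using m0[OF mF0[OF a(2,1)]] m0[OF mFM[OF b(2,1)]] by auto
    then have W0: "W a = 0" "W b = 0" unfolding W_def by simp_all
    have pt: "2 * sqrt (pi / M) * m x \<le> pi * m x / (2 * M * cos (t x)) * W x + sin (t x) * Wx x + L x"
      if x: "x \<in> {a<..<b}" for x
    proof (cases "m x = 0")
      case True
      \<comment> \<open>a line without mass: the terms with \<open>m x\<close> vanish\<close>
      have "\<bar>sin (t x) * Wx x\<bar> \<le> 1 * L x" unfolding abs_mult using Wx_L by (intro mult_mono) auto
      then show ?thesis using True by simp
    next
      case False
      then have "0 < m x" using m_nn[of x] by simp
      moreover have "continuous_on UNIV (wy x)" "continuous_on UNIV (wx x)"
        by (auto intro!: continuous_intros)
      ultimately show ?thesis
        unfolding W_def Wx_def L_def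
        by (intro knothe_fibre[OF R dy _ _ _ _ nn]) (use R supp Mpos t_pos[OF x] in \<open>auto simp: m_def\<close>)
    qed
    have int_ab: "integral {a..b} m = M"
    proof -
      have "integral {-R..a} m + integral {a..b} m = integral {-R..b} m"
        by (rule Henstock_Kurzweil_Integration.integral_combine)
          (use a ab in \<open>auto intro!: integrable_continuous_interval cm\<close>)
      then show ?thesis using a(2) b(2) unfolding F_def by simp
    qed
    have "2 * sqrt (pi / M) * M = integral {a..b} (\<lambda>x. 2 * sqrt (pi / M) * m x)"
      using int_ab by simp
    also have "\<dots> \<le> (W b * sin (t b) - W a * sin (t a)) + integral {a..b} L"
    proof (rule has_integral_le)
      have "((\<lambda>x. 2 * sqrt (pi / M) * m x) has_integral integral {a..b} (\<lambda>x. 2 * sqrt (pi / M) * m x)) {a..b}"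
        by (intro integrable_integral integrable_continuous_interval continuous_intros cm)
      then show "((\<lambda>x. 2 * sqrt (pi / M) * m x) has_integral integral {a..b} (\<lambda>x. 2 * sqrt (pi / M) * m x)) {a<..<b}"
        by (simp only: box_real[symmetric] has_integral_open_interval)
      have "((\<lambda>x. pi * m x / (2 * M * cos (t x)) * W x + sin (t x) * Wx x + L x) has_integral
           (W b * sin (t b) - W a * sin (t a)) + integral {a..b} L) {a..b}"
        by (rule has_integral_add[OF ibp]) (auto intro!: integrable_integral integrable_continuous_interval cL)
      then show "((\<lambda>x. pi * m x / (2 * M * cos (t x)) * W x + sin (t x) * Wx x + L x) has_integral
           (W b * sin (t b) - W a * sin (t a)) + integral {a..b} L) {a<..<b}"
        by (simp only: box_real[symmetric] has_integral_open_interval)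
    qed (use pt in auto)
    also have "\<dots> = integral {a..b} L" using W0 by simp
    also have "\<dots> \<le> integral {-R..R} L"
      using a b L_nn by (intro integral_subset_le) (auto intro!: integrable_continuous_interval cL)
    finally have *: "2 * sqrt (pi / M) * M \<le> integral {-R..R} L" .
    have "4 * pi * M = (2 * sqrt (pi / M) * M)\<^sup>2"
      using Mpos by (simp add: power_mult_distrib) (simp add: power2_eq_square)
    also have "\<dots> \<le> (integral {-R..R} L)\<^sup>2"
      using * Mpos by (intro power_mono) auto
    finally show ?thesis unfolding M_def F_def m_def L_def .
  qed
qed

section \<open>Integrals over the complex plane\<close>

text \<open>Links plane measure to iterated integrals, so that the inequality on a box and the fundamental theorem
  of calculus on lines can be used for functions on the complex plane.\<close>

lemma lborel_complex:
  "(lborel :: complex measure) = distr (lborel \<Otimes>\<^sub>M lborel) borel (\<lambda>(x,y). Complex x y)"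
proof (rule lborel_eqI)
  have meas: "(\<lambda>(x,y). Complex x y) \<in> borel_measurable (lborel \<Otimes>\<^sub>M lborel)"
    unfolding lborel_prod measurable_lborel2
    by (intro borel_measurable_continuous_onI) (auto simp: split_beta Complex_eq intro!: continuous_intros)
  fix l u :: complex assume le: "\<And>b. b \<in> Basis \<Longrightarrow> l \<bullet> b \<le> u \<bullet> b"
  then have le': "Re l \<le> Re u" "Im l \<le> Im u"
    using le[of 1] le[of \<i>] by (auto simp: Basis_complex_def)
  have "(\<lambda>(x,y). Complex x y) -` box l u \<inter> space (lborel \<Otimes>\<^sub>M lborel) = {Re l<..<Re u} \<times> {Im l<..<Im u}"
    by (auto simp: box_def Basis_complex_def space_pair_measure)
  then have "emeasure (distr (lborel \<Otimes>\<^sub>M lborel) borel (\<lambda>(x,y). Complex x y)) (box l u)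
      = emeasure lborel {Re l<..<Re u} * emeasure lborel {Im l<..<Im u}"
    by (simp add: emeasure_distr[OF meas] lborel.emeasure_pair_measure_Times)
  also have "\<dots> = (\<Prod>b\<in>Basis. (u - l) \<bullet> b)"
    using le' by (simp add: Basis_complex_def ennreal_mult')
  finally show "emeasure (distr (lborel \<Otimes>\<^sub>M lborel) borel (\<lambda>(x,y). Complex x y)) (box l u)
      = (\<Prod>b\<in>Basis. (u - l) \<bullet> b)" .
qed simp

lemma plane_integral_eq_iterated:
  fixes g :: "complex \<Rightarrow> real"
  assumes cg: "continuous_on UNIV g" and R: "0 < R" and supp: "\<And>z. R \<le> norm z \<Longrightarrow> g z = 0"
  shows "integrable lborel g"
    and "(LINT z|lborel. g z) = integral {-R..R} (\<lambda>x. integral {-R..R} (\<lambda>y. g (Complex x y)))"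
proof -
  have "integrable lborel (\<lambda>z. indicator (cball 0 R) z *\<^sub>R g z)"
    by (rule borel_integrable_compact) (auto intro: continuous_on_subset[OF cg])
  moreover have "(\<lambda>z. indicator (cball 0 R) z *\<^sub>R g z) = g"
    using supp by (fastforce simp: indicator_def)
  ultimately show int: "integrable lborel g" by simp
  have meas: "(\<lambda>(x,y). Complex x y) \<in> borel_measurable (lborel \<Otimes>\<^sub>M lborel)"
    unfolding lborel_prod measurable_lborel2
    by (intro borel_measurable_continuous_onI) (auto simp: split_beta Complex_eq intro!: continuous_intros)
  have gm: "g \<in> borel_measurable borel" using cg by (rule borel_measurable_continuous_onI)
  define h where "h = (\<lambda>(x,y). g (Complex x y))"
  have h: "h = (\<lambda>z. g ((\<lambda>(x,y). Complex x y) z))" by (auto simp: h_def fun_eq_iff)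
  have ch: "continuous_on A h" for A
    unfolding h by (rule continuous_on_compose2[OF cg]) (auto simp: split_beta Complex_eq intro!: continuous_intros)
  have inth: "integrable lborel h"
    using int unfolding lborel_complex h by (subst (asm) integrable_distr_eq) (use meas gm in \<open>auto simp: lborel_prod\<close>)
  have out: "h z = 0" if "z \<notin> cbox (-R,-R) (R,R)" for z
  proof -
    obtain x y where z: "z = (x,y)" by (cases z)
    with that have "R \<le> \<bar>x\<bar> \<or> R \<le> \<bar>y\<bar>" by (auto simp: cbox_Pair_eq)
    then have "R \<le> norm (Complex x y)" using abs_Re_le_cmod[of "Complex x y"] abs_Im_le_cmod[of "Complex x y"] by auto
    then show ?thesis unfolding h_def z using supp by simp
  qed
  have "(LINT z|lborel. g z) = (LINT z|lborel. h z)"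
    unfolding h by (subst lborel_complex, subst integral_distr) (use meas gm in \<open>auto simp: lborel_prod\<close>)
  also have "\<dots> = integral UNIV h" using integral_lborel[OF inth] by simp
  also have "\<dots> = integral (cbox (-R,-R) (R,R)) h"
  proof -
    have "h = (\<lambda>z. if z \<in> cbox (-R,-R) (R,R) then h z else 0)" by (rule ext) (simp add: out)
    then show ?thesis by (metis integral_restrict_UNIV)
  qed
  also have "\<dots> = integral (cbox (-R) R) (\<lambda>x. integral (cbox (-R) R) (\<lambda>y. h (x,y)))"
    by (rule integral_prod_continuous[OF ch])
  finally show "(LINT z|lborel. g z) = integral {-R..R} (\<lambda>x. integral {-R..R} (\<lambda>y. g (Complex x y)))"
    by (simp add: h_def)
qed

lemma deriv_vanishes_beyond_support:
  fixes F :: "complex \<Rightarrow> real" and \<gamma> :: "real \<Rightarrow> complex"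
  assumes d: "((\<lambda>t. F (\<gamma> t)) has_real_derivative D) (at x)" and c: "continuous_on UNIV \<gamma>"
    and supp: "\<And>z. R \<le> norm z \<Longrightarrow> F z = 0" and z: "R < norm (\<gamma> x)"
  shows "D = 0"
proof -
  have "open {t. R < norm (\<gamma> t)}" using c by (intro open_Collect_less continuous_intros) auto
  then have "((\<lambda>t. 0) has_real_derivative D) (at x)"
    using z supp by (intro has_field_derivative_transform_within_open[OF d]) auto
  then show ?thesis using DERIV_const DERIV_unique by blast
qed

lemma continuous_on_Complex [continuous_intros]:
  "continuous_on A f \<Longrightarrow> continuous_on A g \<Longrightarrow> continuous_on A (\<lambda>x. Complex (f x) (g x))"
  by (simp add: Complex_eq continuous_intros)

lemma integral_x_derivative_eq_0:
  fixes F Fx :: "complex \<Rightarrow> real"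
  assumes c: "continuous_on UNIV Fx" and R: "0 < R" and supp: "\<And>z. R \<le> norm z \<Longrightarrow> F z = 0"
    and d: "\<And>x y. ((\<lambda>t. F (Complex t y)) has_real_derivative Fx (Complex x y)) (at x)"
  shows "integrable lborel Fx" "(LINT z|lborel. Fx z) = 0"
proof -
  have supp': "Fx z = 0" if "R + 1 \<le> norm z" for z
    by (rule deriv_vanishes_beyond_support[where F=F and \<gamma>="\<lambda>t. Complex t (Im z)" and x="Re z" and R=R])
      (use d[of "Im z" "Re z"] supp that in \<open>auto intro!: continuous_intros\<close>)
  have cc: "continuous_on A (\<lambda>p. Fx (Complex (f p) (g p)))" if "continuous_on A f" "continuous_on A g"
    for A :: "'z::topological_space set" and f g
    using that by (intro continuous_on_compose2[OF c]) (auto intro!: continuous_intros)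
  show "integrable lborel Fx" by (rule plane_integral_eq_iterated[OF c _ supp']) (use R in auto)
  have "(LINT z|lborel. Fx z) = integral {-(R+1)..R+1} (\<lambda>x. integral {-(R+1)..R+1} (\<lambda>y. Fx (Complex x y)))"
    by (rule plane_integral_eq_iterated[OF c _ supp']) (use R in auto)
  also have "\<dots> = integral {-(R+1)..R+1} (\<lambda>y. integral {-(R+1)..R+1} (\<lambda>x. Fx (Complex x y)))"
    unfolding cbox_interval[symmetric]
    by (rule integral_swap_continuous) (auto simp: split_beta intro!: cc continuous_intros)
  also have "(\<lambda>y. integral {-(R+1)..R+1} (\<lambda>x. Fx (Complex x y))) = (\<lambda>y. 0)"
  proof
    fix y
    have "((\<lambda>x. Fx (Complex x y)) has_integral F (Complex (R+1) y) - F (Complex (-(R+1)) y)) {-(R+1)..R+1}"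
      using R d by (intro fundamental_theorem_of_calculus)
       (auto simp flip: has_real_derivative_iff_has_vector_derivative intro: DERIV_subset)
    moreover have "F (Complex (R+1) y) = 0" "F (Complex (-(R+1)) y) = 0"
      using abs_Re_le_cmod[of "Complex (R+1) y"] abs_Re_le_cmod[of "Complex (-(R+1)) y"] R by (auto intro!: supp)
    ultimately show "integral {-(R+1)..R+1} (\<lambda>x. Fx (Complex x y)) = 0" by (simp add: integral_unique)
  qed
  finally show "(LINT z|lborel. Fx z) = 0" by simp
qed

lemma integral_y_derivative_eq_0:
  fixes F Fy :: "complex \<Rightarrow> real"
  assumes c: "continuous_on UNIV Fy" and R: "0 < R" and supp: "\<And>z. R \<le> norm z \<Longrightarrow> F z = 0"
    and d: "\<And>x y. ((\<lambda>t. F (Complex x t)) has_real_derivative Fy (Complex x y)) (at y)"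
  shows "integrable lborel Fy" "(LINT z|lborel. Fy z) = 0"
proof -
  have supp': "Fy z = 0" if "R + 1 \<le> norm z" for z
    by (rule deriv_vanishes_beyond_support[where F=F and \<gamma>="\<lambda>t. Complex (Re z) t" and x="Im z" and R=R])
      (use d[of "Re z" "Im z"] supp that in \<open>auto intro!: continuous_intros\<close>)
  show "integrable lborel Fy" by (rule plane_integral_eq_iterated[OF c _ supp']) (use R in auto)
  have "(LINT z|lborel. Fy z) = integral {-(R+1)..R+1} (\<lambda>x. integral {-(R+1)..R+1} (\<lambda>y. Fy (Complex x y)))"
    by (rule plane_integral_eq_iterated[OF c _ supp']) (use R in auto)
  also have "(\<lambda>x. integral {-(R+1)..R+1} (\<lambda>y. Fy (Complex x y))) = (\<lambda>x. 0)"
  proof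
    fix x
    have "((\<lambda>y. Fy (Complex x y)) has_integral F (Complex x (R+1)) - F (Complex x (-(R+1)))) {-(R+1)..R+1}"
      using R d by (intro fundamental_theorem_of_calculus)
       (auto simp flip: has_real_derivative_iff_has_vector_derivative intro: DERIV_subset)
    moreover have "F (Complex x (R+1)) = 0" "F (Complex x (-(R+1))) = 0"
      using abs_Im_le_cmod[of "Complex x (R+1)"] abs_Im_le_cmod[of "Complex x (-(R+1))"] R by (auto intro!: supp)
    ultimately show "integral {-(R+1)..R+1} (\<lambda>y. Fy (Complex x y)) = 0" by (simp add: integral_unique)
  qed
  finally show "(LINT z|lborel. Fy z) = 0" by simp
qed

theorem planar_sobolev:
  fixes w wx wy :: "complex \<Rightarrow> real"
  assumes cw: "continuous_on UNIV w" and cx: "continuous_on UNIV wx" and cy: "continuous_on UNIV wy"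
    and dx: "\<And>x y. ((\<lambda>t. w (Complex t y)) has_real_derivative wx (Complex x y)) (at x)"
    and dy: "\<And>x y. ((\<lambda>t. w (Complex x t)) has_real_derivative wy (Complex x y)) (at y)"
    and nn: "\<And>z. 0 \<le> w z" and R: "0 < R" and supp: "\<And>z. R \<le> norm z \<Longrightarrow> w z = 0"
  shows "integrable lborel (\<lambda>z. (w z)\<^sup>2)" "integrable lborel (\<lambda>z. sqrt ((wx z)\<^sup>2 + (wy z)\<^sup>2))"
    "4 * pi * (LINT z|lborel. (w z)\<^sup>2) \<le> (LINT z|lborel. sqrt ((wx z)\<^sup>2 + (wy z)\<^sup>2))\<^sup>2"
proof -
  have wx0: "wx z = 0" if "R + 1 \<le> norm z" for z
    by (rule deriv_vanishes_beyond_support[where F=w and \<gamma>="\<lambda>t. Complex t (Im z)" and x="Re z" and R=R])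
      (use dx[of "Im z" "Re z"] supp that in \<open>auto intro!: continuous_intros\<close>)
  have wy0: "wy z = 0" if "R + 1 \<le> norm z" for z
    by (rule deriv_vanishes_beyond_support[where F=w and \<gamma>="\<lambda>t. Complex (Re z) t" and x="Im z" and R=R])
      (use dy[of "Re z" "Im z"] supp that in \<open>auto intro!: continuous_intros\<close>)
  have cc: "continuous_on UNIV (\<lambda>(x,y). F (Complex x y))" if "continuous_on UNIV F" for F :: "complex \<Rightarrow> real"
    unfolding split_beta using that by (rule continuous_on_compose2) (auto intro!: continuous_intros)
  have R1: "0 < R + 1" using R by simp
  have I1: "continuous_on UNIV (\<lambda>z. (w z)\<^sup>2)" "\<And>z. R + 1 \<le> norm z \<Longrightarrow> (w z)\<^sup>2 = 0"
    using cw supp by (auto intro!: continuous_intros)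
  have I2: "continuous_on UNIV (\<lambda>z. sqrt ((wx z)\<^sup>2 + (wy z)\<^sup>2))" "\<And>z. R + 1 \<le> norm z \<Longrightarrow> sqrt ((wx z)\<^sup>2 + (wy z)\<^sup>2) = 0"
    using cx cy wx0 wy0 by (auto intro!: continuous_intros)
  show "integrable lborel (\<lambda>z. (w z)\<^sup>2)" by (rule plane_integral_eq_iterated[OF I1(1) R1 I1(2)])
  show "integrable lborel (\<lambda>z. sqrt ((wx z)\<^sup>2 + (wy z)\<^sup>2))" by (rule plane_integral_eq_iterated[OF I2(1) R1 I2(2)])
  have "w (Complex x y) = 0" if "R + 1 \<le> \<bar>x\<bar> \<or> R + 1 \<le> \<bar>y\<bar>" for x y
    using that abs_Re_le_cmod[of "Complex x y"] abs_Im_le_cmod[of "Complex x y"] by (intro supp) auto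
  then have "4 * pi * integral {-(R+1)..R+1} (\<lambda>x. integral {-(R+1)..R+1} (\<lambda>y. (w (Complex x y))\<^sup>2))
    \<le> (integral {-(R+1)..R+1} (\<lambda>x. integral {-(R+1)..R+1} (\<lambda>y. sqrt ((wx (Complex x y))\<^sup>2 + (wy (Complex x y))\<^sup>2))))\<^sup>2"
    by (intro planar_sobolev_box[where w="\<lambda>x y. w (Complex x y)" and wx="\<lambda>x y. wx (Complex x y)"
          and wy="\<lambda>x y. wy (Complex x y)", OF R1 cc[OF cw] cc[OF cx] cc[OF cy] dx dy nn]) blast
  then show "4 * pi * (LINT z|lborel. (w z)\<^sup>2) \<le> (LINT z|lborel. sqrt ((wx z)\<^sup>2 + (wy z)\<^sup>2))\<^sup>2"
    by (simp only: plane_integral_eq_iterated(2)[OF I1(1) R1 I1(2)] plane_integral_eq_iterated(2)[OF I2(1) R1 I2(2)])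
qed

text \<open>Needed for functions such as \<open>\<phi>(ln |f|)\<close> that make sense only off the zeros of \<open>f\<close> and vanish near
  them.  Regularity on an open set \<open>U\<close> passes to the whole plane when the function vanishes on the
  overlap of \<open>U\<close> with an open set \<open>V\<close> that covers the rest.\<close>

definition zero_ext :: "complex set \<Rightarrow> (complex \<Rightarrow> real) \<Rightarrow> complex \<Rightarrow> real" where
  "zero_ext U g z = (if z \<in> U then g z else 0)"

lemma continuous_on_zero_ext:
  assumes U: "open U" and V: "open V" and UV: "U \<union> V = UNIV"
    and c: "continuous_on U g" and z: "\<And>z. z \<in> U \<Longrightarrow> z \<in> V \<Longrightarrow> g z = 0"
  shows "continuous_on UNIV (zero_ext U g)"
proof -
  have "continuous_on V (zero_ext U g)"
    by (rule continuous_on_cong[THEN iffD1, OF refl _ continuous_on_const[of _ 0]]) (auto simp: zero_ext_def z)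
  moreover have "continuous_on U (zero_ext U g)"
    by (rule continuous_on_cong[THEN iffD1, OF refl _ c]) (auto simp: zero_ext_def)
  ultimately show ?thesis using continuous_on_open_Un[OF U V] UV by metis
qed

lemma has_real_derivative_zero_ext:
  assumes U: "open U" and V: "open V" and UV: "U \<union> V = UNIV"
    and d: "\<gamma> x \<in> U \<Longrightarrow> ((\<lambda>t. g (\<gamma> t)) has_real_derivative g' (\<gamma> x)) (at x)"
    and \<gamma>: "continuous_on UNIV \<gamma>"
    and z: "\<And>z. z \<in> U \<Longrightarrow> z \<in> V \<Longrightarrow> g z = 0"
  shows "((\<lambda>t. zero_ext U g (\<gamma> t)) has_real_derivative zero_ext U g' (\<gamma> x)) (at x)"
proof (cases "\<gamma> x \<in> U")
  case True
  have "open (\<gamma> -` U)" using U \<gamma> by (rule open_vimage)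
  moreover have "((\<lambda>t. g (\<gamma> t)) has_real_derivative zero_ext U g' (\<gamma> x)) (at x)"
    using True d by (simp add: zero_ext_def)
  ultimately show ?thesis using True
    by (elim has_field_derivative_transform_within_open) (auto simp: zero_ext_def)
next
  case False
  have "open (\<gamma> -` V)" using V \<gamma> by (rule open_vimage)
  moreover have "((\<lambda>t. 0) has_real_derivative zero_ext U g' (\<gamma> x)) (at x)" using False by (simp add: zero_ext_def)
  moreover have "\<gamma> x \<in> V" using False UV by auto
  ultimately show ?thesis
    by (elim has_field_derivative_transform_within_open) (auto simp: zero_ext_def z)
qed

section \<open>The weighted modulus and the energy identity\<close>

lemma has_real_derivative_Re_Im_lines:
  assumes "(g has_field_derivative g') (at (Complex x y))"
  shows "((\<lambda>t. Re (g (Complex t y))) has_real_derivative Re g') (at x)"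
    "((\<lambda>t. Im (g (Complex t y))) has_real_derivative Im g') (at x)"
    "((\<lambda>t. Re (g (Complex x t))) has_real_derivative - Im g') (at y)"
    "((\<lambda>t. Im (g (Complex x t))) has_real_derivative Re g') (at y)"
proof -
  have "((\<lambda>t. Complex t y) has_vector_derivative 1) (at x)"
    unfolding Complex_eq by (auto intro!: derivative_eq_intros)
  from field_vector_diff_chain_at[OF this assms]
  have h: "((\<lambda>t. g (Complex t y)) has_vector_derivative g') (at x)" by (simp add: o_def)
  have "((\<lambda>t. Complex x t) has_vector_derivative \<i>) (at y)"
    unfolding Complex_eq by (auto intro!: derivative_eq_intros)
  from field_vector_diff_chain_at[OF this assms]
  have v: "((\<lambda>t. g (Complex x t)) has_vector_derivative \<i> * g') (at y)" by (simp add: o_def)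
  show "((\<lambda>t. Re (g (Complex t y))) has_real_derivative Re g') (at x)"
    "((\<lambda>t. Im (g (Complex t y))) has_real_derivative Im g') (at x)"
    "((\<lambda>t. Re (g (Complex x t))) has_real_derivative - Im g') (at y)"
    "((\<lambda>t. Im (g (Complex x t))) has_real_derivative Re g') (at y)"
    using bounded_linear.has_vector_derivative[OF bounded_linear_Re h]
      bounded_linear.has_vector_derivative[OF bounded_linear_Im h]
      bounded_linear.has_vector_derivative[OF bounded_linear_Re v]
      bounded_linear.has_vector_derivative[OF bounded_linear_Im v]
    by (simp_all add: has_real_derivative_iff_has_vector_derivative)
qed

lemma has_real_derivative_ln_norm_line:
  assumes g: "(g has_field_derivative g') (at (Complex x y))" and nz: "g (Complex x y) \<noteq> 0"
  shows "((\<lambda>t. ln (norm (g (Complex t y)))) has_real_derivative Re (g' / g (Complex x y))) (at x)"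
    "((\<lambda>t. ln (norm (g (Complex x t)))) has_real_derivative - Im (g' / g (Complex x y))) (at y)"
proof -
  have ln_eq: "ln (norm w) = ln ((Re w)\<^sup>2 + (Im w)\<^sup>2) / 2" for w :: complex
    by (cases "w = 0") (auto simp: norm_complex_def sum_power2_gt_zero_iff complex_eq_iff ln_sqrt)
  have pos: "0 < (Re (g (Complex x y)))\<^sup>2 + (Im (g (Complex x y)))\<^sup>2"
    using nz by (simp add: sum_power2_gt_zero_iff complex_eq_iff)
  note d = has_real_derivative_Re_Im_lines[OF g]
  have cancel: "1 / S * (2 * a * b + 2 * c * e) / 2 = (b * a + e * c) / S" for S a b c e :: real
    by (simp add: algebra_simps add_divide_distrib)
  have "((\<lambda>t. (Re (g (Complex t y)))\<^sup>2 + (Im (g (Complex t y)))\<^sup>2) has_real_derivative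
     2 * Re (g (Complex x y)) * Re g' + 2 * Im (g (Complex x y)) * Im g') (at x)"
    by (rule d derivative_eq_intros refl | simp)+
  from DERIV_cdivide[OF DERIV_chain2[OF DERIV_ln_divide[OF pos] this], of 2]
  show "((\<lambda>t. ln (norm (g (Complex t y)))) has_real_derivative Re (g' / g (Complex x y))) (at x)"
    unfolding ln_eq by (rule DERIV_cong) (simp only: cancel Re_divide)
  have "((\<lambda>t. (Re (g (Complex x t)))\<^sup>2 + (Im (g (Complex x t)))\<^sup>2) has_real_derivative
     2 * Re (g (Complex x y)) * (- Im g') + 2 * Im (g (Complex x y)) * Re g') (at y)"
    by (rule d derivative_eq_intros refl | simp)+
  from DERIV_cdivide[OF DERIV_chain2[OF DERIV_ln_divide[OF pos] this], of 2]
  show "((\<lambda>t. ln (norm (g (Complex x t)))) has_real_derivative - Im (g' / g (Complex x y))) (at y)"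
    unfolding ln_eq by (rule DERIV_cong) (simp only: cancel Im_divide, simp add: algebra_simps minus_divide_left)
qed

lemma has_real_derivative_pos_part_square:
  fixes x :: real
  shows "((\<lambda>x. (max 0 x)\<^sup>2) has_real_derivative 2 * max 0 x) (at x)"
proof -
  consider "x < 0" | "x > 0" | "x = 0" by linarith
  then show ?thesis
  proof cases
    case 1
    have "((\<lambda>x. 0) has_real_derivative 2 * max 0 x) (at x)" using 1 by simp
    then show ?thesis
      by (rule has_field_derivative_transform_within_open[where S="{..<0}"]) (use 1 in auto)
  next
    case 2
    have "((\<lambda>x. x\<^sup>2) has_real_derivative 2 * max 0 x) (at x)" using 2 by (auto intro!: derivative_eq_intros)
    then show ?thesis
      by (rule has_field_derivative_transform_within_open[where S="{0<..}"]) (use 2 in auto)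
  next
    case 3
    have "((\<lambda>h::real. (max 0 h)\<^sup>2 / h) \<longlongrightarrow> 0) (at 0)"
    proof (rule Lim_null_comparison)
      show "\<forall>\<^sub>F h::real in at 0. norm ((max 0 h)\<^sup>2 / h) \<le> \<bar>h\<bar>"
        by (auto simp: max_def power2_eq_square eventually_at_filter)
      show "((\<lambda>h::real. \<bar>h\<bar>) \<longlongrightarrow> 0) (at 0)" by (rule tendsto_eq_intros | simp)+
    qed
    then show ?thesis using 3 by (simp add: has_field_derivative_iff)
  qed
qed

text \<open>The derivative is a trapezoid over \<open>[a, b]\<close> of height \<open>K\<close> with flanks of width \<open>e\<close>, chosen such that
  its area \<open>K (b - a - e)\<close> is 1.  The height can thus be taken as close to \<open>1 / (b - a)\<close> as desired,
  which is what makes the final decay estimate sharp.\<close>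

lemma smooth_cutoff:
  fixes a b K :: real
  assumes "a < b" "1 / (b - a) < K"
  obtains \<phi> \<phi>' :: "real \<Rightarrow> real" where
    "\<And>x. (\<phi> has_real_derivative \<phi>' x) (at x)" "continuous_on UNIV \<phi>'"
    "\<And>x. 0 \<le> \<phi> x \<and> \<phi> x \<le> 1" "\<And>x. 0 \<le> \<phi>' x \<and> \<phi>' x \<le> K"
    "\<And>x. x \<le> a \<Longrightarrow> \<phi> x = 0 \<and> \<phi>' x = 0" "\<And>x. b \<le> x \<Longrightarrow> \<phi> x = 1 \<and> \<phi>' x = 0"
proof -
  \<comment> \<open>the flank width for which the trapezoid has area 1\<close>
  define e where "e = (b - a) - 1 / K"
  have K: "0 < K" using assms by (smt (verit) divide_pos_pos)
  have e: "0 < e" "e < b - a" "K * (b - a - e) = 1" unfolding e_def using assms K by (auto simp: field_simps)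
  define r :: "real \<Rightarrow> real" where "r = (\<lambda>x. (max 0 x)\<^sup>2 / 2)"
  have dr: "(r has_real_derivative max 0 x) (at x)" for x
    unfolding r_def using DERIV_cdivide[OF has_real_derivative_pos_part_square, of 2 x] by simp
  define \<phi> where "\<phi> = (\<lambda>x. K / e * (r (x - a) - r (x - a - e) - r (x - b + e) + r (x - b)))"
  define \<phi>' where "\<phi>' = (\<lambda>x. K / e * (max 0 (x - a) - max 0 (x - a - e) - max 0 (x - b + e) + max 0 (x - b)))"
  have d: "(\<phi> has_real_derivative \<phi>' x) (at x)" for x
    unfolding \<phi>_def \<phi>'_def by (rule derivative_eq_intros DERIV_chain2[OF dr] refl | simp)+
  have c: "continuous_on UNIV \<phi>'" unfolding \<phi>'_def by (intro continuous_intros)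
  define g where "g = (\<lambda>x. max 0 (x - a) - max 0 (x - a - e) - max 0 (x - b + e) + max 0 (x - b))"
  have g: "0 \<le> g x" "g x \<le> e" for x unfolding g_def using e by (auto simp: max_def)
  have \<phi>'g: "\<phi>' x = K / e * g x" for x by (simp add: \<phi>'_def g_def)
  have b1: "0 \<le> \<phi>' x" "\<phi>' x \<le> K" for x
    unfolding \<phi>'g using g[of x] e K by (auto simp: field_simps)
  have lo: "\<phi> x = 0" "\<phi>' x = 0" if "x \<le> a" for x
    unfolding \<phi>_def \<phi>'_def r_def using that e by auto
  have hi: "\<phi> x = 1" "\<phi>' x = 0" if "b \<le> x" for x
  proof -
    have "(x - a)\<^sup>2 / 2 - (x - a - e)\<^sup>2 / 2 - (x - b + e)\<^sup>2 / 2 + (x - b)\<^sup>2 / 2 = e * (b - a - e)"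
      by (simp add: power2_eq_square field_simps)
    moreover have "r (x - a) = (x - a)\<^sup>2 / 2" "r (x - a - e) = (x - a - e)\<^sup>2 / 2" "r (x - b + e) = (x - b + e)\<^sup>2 / 2" "r (x - b) = (x - b)\<^sup>2 / 2"
      unfolding r_def using that e by auto
    ultimately have "\<phi> x = K / e * (e * (b - a - e))" unfolding \<phi>_def by (simp only:)
    then show "\<phi> x = 1" using e by simp
    show "\<phi>' x = 0" unfolding \<phi>'_def using that e by (auto simp: max_def)
  qed
  have mono: "\<phi> x \<le> \<phi> y" if "x \<le> y" for x y
    by (rule DERIV_nonneg_imp_nondecreasing[OF that]) (use d b1 in blast)
  have "0 \<le> \<phi> x \<and> \<phi> x \<le> 1" for x
    using lo[of "min x a"] hi[of "max x b"] mono[of "min x a" x] mono[of x "max x b"] by auto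
  then show ?thesis by (intro that[OF d c]) (simp_all add: b1 lo hi)
qed

text \<open>The weighted modulus \<open>u\<close> of an entire function is studied through \<open>v = ln u\<close>.  With \<open>q = f' / f\<close> the
  gradient of \<open>v\<close> is \<open>(vx, vy)\<close>, and the second derivatives in the two directions add up to
  \<open>- 2 p \<alpha>\<close> because the contributions of \<open>q'\<close> cancel.\<close>

locale entire_weight =
  fixes f :: "complex \<Rightarrow> complex" and \<alpha> p :: real
  assumes holo: "f holomorphic_on UNIV" and \<alpha>: "0 < \<alpha>" and p: "0 < p"
begin

abbreviation u where "u \<equiv> fock_weighted \<alpha> p f"

lemma u_eq: "u z = norm (f z) powr p * exp (- (p * \<alpha> / 2) * (norm z)\<^sup>2)"
proof -
  have "u z = (norm (f z) * exp (- \<alpha> * (norm z)\<^sup>2 / 2)) powr p"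
    by (simp add: fock_weighted_def norm_mult)
  also have "\<dots> = norm (f z) powr p * exp (- (p * \<alpha> / 2) * (norm z)\<^sup>2)"
    by (simp add: powr_mult exp_powr_real algebra_simps)
  finally show ?thesis .
qed

lemma f_cont: "continuous_on A f"
  using holo holomorphic_on_imp_continuous_on continuous_on_subset by blast

lemma u_cont: "continuous_on A u"
proof -
  have "continuous_on A (\<lambda>z. norm (f z) powr p * exp (- (p * \<alpha> / 2) * (norm z)\<^sup>2))"
    using p by (intro continuous_intros continuous_on_powr' f_cont) auto
  then show ?thesis by (simp add: u_eq[abs_def])
qed

lemma u_nonneg: "0 \<le> u z" by (simp add: fock_weighted_def)

lemma u_measurable [measurable]: "u \<in> borel_measurable borel"
  by (intro borel_measurable_continuous_onI u_cont)

definition v where "v z = p * ln (norm (f z)) - p * \<alpha> / 2 * ((Re z)\<^sup>2 + (Im z)\<^sup>2)"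
definition q where "q z = deriv f z / f z"
definition vx where "vx z = p * Re (q z) - p * \<alpha> * Re z"
definition vy where "vy z = - p * Im (q z) - p * \<alpha> * Im z"

lemma u_exp_v: "f z \<noteq> 0 \<Longrightarrow> u z = exp (v z)"
  unfolding u_eq v_def by (simp add: powr_def cmod_power2 exp_add[symmetric])

lemma v_eq_ln_u: "f z \<noteq> 0 \<Longrightarrow> v z = ln (u z)"
  by (simp add: u_exp_v)

lemma u_pos_iff: "0 < u z \<longleftrightarrow> f z \<noteq> 0"
  by (simp add: u_eq zero_less_mult_iff)

lemma open_nz: "open {z. f z \<noteq> 0}"
  by (intro open_Collect_neq f_cont continuous_intros)

lemma f_deriv: "(f has_field_derivative deriv f z) (at z)"
  using holo holomorphic_derivI[of f UNIV] by auto

lemma q_holo: "q holomorphic_on {z. f z \<noteq> 0}"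
  unfolding q_def by (intro holomorphic_intros holomorphic_deriv holomorphic_on_subset[OF holo] open_nz) auto

lemma q_deriv: "f z \<noteq> 0 \<Longrightarrow> (q has_field_derivative deriv q z) (at z)"
  using holomorphic_derivI[OF q_holo open_nz] by auto

lemma v_derivs:
  assumes "f (Complex x y) \<noteq> 0"
  shows "((\<lambda>t. v (Complex t y)) has_real_derivative vx (Complex x y)) (at x)"
    "((\<lambda>t. v (Complex x t)) has_real_derivative vy (Complex x y)) (at y)"
    "((\<lambda>t. vx (Complex t y)) has_real_derivative p * Re (deriv q (Complex x y)) - p * \<alpha>) (at x)"
    "((\<lambda>t. vy (Complex x t)) has_real_derivative - p * Re (deriv q (Complex x y)) - p * \<alpha>) (at y)"
proof -
  note L = has_real_derivative_ln_norm_line[OF f_deriv assms]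
  note Q = has_real_derivative_Re_Im_lines[OF q_deriv[OF assms]]
  show "((\<lambda>t. v (Complex t y)) has_real_derivative vx (Complex x y)) (at x)"
    unfolding v_def vx_def q_def complex.sel
    by (rule L derivative_eq_intros refl | simp)+
  show "((\<lambda>t. v (Complex x t)) has_real_derivative vy (Complex x y)) (at y)"
    unfolding v_def vy_def q_def complex.sel
    by (rule L derivative_eq_intros refl | simp)+
  show "((\<lambda>t. vx (Complex t y)) has_real_derivative p * Re (deriv q (Complex x y)) - p * \<alpha>) (at x)"
    unfolding vx_def complex.sel by (rule Q derivative_eq_intros refl | simp)+
  show "((\<lambda>t. vy (Complex x t)) has_real_derivative - p * Re (deriv q (Complex x y)) - p * \<alpha>) (at y)"
    unfolding vy_def complex.sel by (rule Q derivative_eq_intros refl | simp)+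
qed

lemma v_conts:
  "continuous_on {z. f z \<noteq> 0} v" "continuous_on {z. f z \<noteq> 0} vx" "continuous_on {z. f z \<noteq> 0} vy"
  "continuous_on {z. f z \<noteq> 0} (\<lambda>z. Re (deriv q z))"
proof -
  have "continuous_on {z. f z \<noteq> 0} q" "continuous_on {z. f z \<noteq> 0} (deriv q)"
    using q_holo holomorphic_deriv[OF q_holo open_nz] holomorphic_on_imp_continuous_on by auto
  then show "continuous_on {z. f z \<noteq> 0} v" "continuous_on {z. f z \<noteq> 0} vx" "continuous_on {z. f z \<noteq> 0} vy"
    "continuous_on {z. f z \<noteq> 0} (\<lambda>z. Re (deriv q z))"
    unfolding v_def[abs_def] vx_def[abs_def] vy_def[abs_def] by (auto intro!: continuous_intros f_cont)
qed

abbreviation ext :: "(complex \<Rightarrow> real) \<Rightarrow> complex \<Rightarrow> real" where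
  "ext \<equiv> zero_ext {z. f z \<noteq> 0}"

lemma level_cover:
  assumes "0 < s"
  shows "open {z. u z < s}" "{z. f z \<noteq> 0} \<union> {z. u z < s} = UNIV"
proof -
  show "open {z. u z < s}" by (intro open_Collect_less u_cont continuous_intros)
  show "{z. f z \<noteq> 0} \<union> {z. u z < s} = UNIV" using assms by (auto simp: u_eq)
qed

lemma ext_cont:
  assumes "continuous_on {z. f z \<noteq> 0} g" "0 < s" "\<And>z. f z \<noteq> 0 \<Longrightarrow> u z \<le> s \<Longrightarrow> g z = 0"
  shows "continuous_on UNIV (ext g)"
  using assms by (intro continuous_on_zero_ext[OF open_nz level_cover[OF assms(2)]]) auto

lemma ext_deriv:
  assumes "f (\<gamma> x) \<noteq> 0 \<Longrightarrow> ((\<lambda>t. g (\<gamma> t)) has_real_derivative g' (\<gamma> x)) (at x)"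
    and "continuous_on UNIV \<gamma>" "0 < s"
    and "\<And>z. f z \<noteq> 0 \<Longrightarrow> u z \<le> s \<Longrightarrow> g z = 0"
  shows "((\<lambda>t. ext g (\<gamma> t)) has_real_derivative ext g' (\<gamma> x)) (at x)"
  using assms by (intro has_real_derivative_zero_ext[OF open_nz level_cover[OF assms(3)]]) auto

definition \<mu> where "\<mu> t = measure lborel {z. t < u z}"

lemma level_fmeasurable:
  assumes "\<And>z. R \<le> norm z \<Longrightarrow> u z \<le> s" "s \<le> t"
  shows "{z. t < u z} \<in> fmeasurable lborel"
proof (rule fmeasurableI2)
  show "cball (0::complex) R \<in> fmeasurable lborel" by (simp add: fmeasurable_compact)
  show "{z. t < u z} \<subseteq> cball 0 R"
  proof
    fix z assume "z \<in> {z. t < u z}"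
    then have "\<not> R \<le> norm z" using assms by force
    then show "z \<in> cball 0 R" by simp
  qed
qed simp

text \<open>With \<open>w = \<phi>(v)\<close> the chain of estimates is
  \<open>4 \<pi> \<mu>(t) \<le> 4 \<pi> \<integral> w\<^sup>2 \<le> (\<integral> \<phi>'(v) |\<nabla>v|)\<^sup>2 \<le> \<integral> \<phi>'(v) \<cdot> \<integral> \<phi>'(v) |\<nabla>v|\<^sup>2\<close>.
  The first factor is at most \<open>K (\<mu>(s) - \<mu>(t))\<close> since \<open>\<phi>'\<close> lives between the two heights.  The second
  equals \<open>2 p \<alpha> \<integral> \<phi>(v)\<close>, because the divergence of \<open>\<phi>(v) \<nabla>v\<close> integrates to 0.\<close>

lemma level_inequality_cutoff:
  assumes R: "0 < R" and bdd: "\<And>z. R \<le> norm z \<Longrightarrow> u z \<le> s" and s: "0 < s" "s < t"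
    and K: "1 / (ln t - ln s) < K"
  shows "4 * pi * \<mu> t \<le> K * (\<mu> s - \<mu> t) * (2 * p * \<alpha> * \<mu> s)"
proof -
  have "ln s < ln t" using s by simp
  from smooth_cutoff[OF this K] obtain \<phi> \<phi>' :: "real \<Rightarrow> real" where \<phi>:
    "\<And>x. (\<phi> has_real_derivative \<phi>' x) (at x)" "continuous_on UNIV \<phi>'"
    "\<And>x. 0 \<le> \<phi> x \<and> \<phi> x \<le> 1" "\<And>x. 0 \<le> \<phi>' x \<and> \<phi>' x \<le> K"
    "\<And>x. x \<le> ln s \<Longrightarrow> \<phi> x = 0 \<and> \<phi>' x = 0" "\<And>x. ln t \<le> x \<Longrightarrow> \<phi> x = 1 \<and> \<phi>' x = 0"
    by metis
  have c\<phi>: "continuous_on UNIV \<phi>" using \<phi>(1) by (meson DERIV_isCont continuous_at_imp_continuous_on)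
  have lo: "\<phi> (v z) = 0" "\<phi>' (v z) = 0" if "f z \<noteq> 0" "u z \<le> s" for z
    using \<phi>(5)[of "v z"] that s v_eq_ln_u[of z] u_pos_iff[of z] by auto
  have hi: "\<phi> (v z) = 1" "\<phi>' (v z) = 0" if "f z \<noteq> 0" "t \<le> u z" for z
    using \<phi>(6)[of "v z"] that s v_eq_ln_u[of z] u_pos_iff[of z] by auto
  have c1: "continuous_on {z. f z \<noteq> 0} (\<lambda>z. \<phi> (v z))" "continuous_on {z. f z \<noteq> 0} (\<lambda>z. \<phi>' (v z))"
    using continuous_on_compose2[OF c\<phi> v_conts(1)] continuous_on_compose2[OF \<phi>(2) v_conts(1)] by auto
  note ci = continuous_on_mult continuous_on_add continuous_on_const continuous_on_power continuous_on_diff continuous_on_minus c1 v_conts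
  define w where "w = ext (\<lambda>z. \<phi> (v z))"
  define wx where "wx = ext (\<lambda>z. \<phi>' (v z) * vx z)"
  define wy where "wy = ext (\<lambda>z. \<phi>' (v z) * vy z)"
  define E where "E = ext (\<lambda>z. \<phi>' (v z) * ((vx z)\<^sup>2 + (vy z)\<^sup>2))"
  define P where "P = ext (\<lambda>z. \<phi>' (v z))"
  define Gx where "Gx = ext (\<lambda>z. \<phi>' (v z) * (vx z)\<^sup>2 + \<phi> (v z) * (p * Re (deriv q z) - p * \<alpha>))"
  define Gy where "Gy = ext (\<lambda>z. \<phi>' (v z) * (vy z)\<^sup>2 + \<phi> (v z) * (- p * Re (deriv q z) - p * \<alpha>))"
  have conts: "continuous_on UNIV w" "continuous_on UNIV wx" "continuous_on UNIV wy" "continuous_on UNIV E"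
    "continuous_on UNIV P" "continuous_on UNIV Gx" "continuous_on UNIV Gy"
    unfolding w_def wx_def wy_def E_def P_def Gx_def Gy_def
    by (rule ext_cont[OF _ s(1)]; (intro ci | simp add: lo))+
  have supp: "w z = 0" "E z = 0" "P z = 0" if "R \<le> norm z" for z
    unfolding w_def E_def P_def zero_ext_def using bdd[OF that] lo by auto
  have lines: "continuous_on UNIV (\<lambda>t. Complex t y)" "continuous_on UNIV (\<lambda>t. Complex y t)" for y
    by (auto intro!: continuous_intros)
  have dw: "((\<lambda>t. w (Complex t y)) has_real_derivative wx (Complex x y)) (at x)"
    "((\<lambda>t. w (Complex x t)) has_real_derivative wy (Complex x y)) (at y)" for x y
    unfolding w_def wx_def wy_def
    using ext_deriv[OF _ lines(1) s(1), of x y "\<lambda>z. \<phi> (v z)" "\<lambda>z. \<phi>' (v z) * vx z"]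
      ext_deriv[OF _ lines(2) s(1), of x y "\<lambda>z. \<phi> (v z)" "\<lambda>z. \<phi>' (v z) * vy z"]
      DERIV_chain2[OF \<phi>(1) v_derivs(1)] DERIV_chain2[OF \<phi>(1) v_derivs(2)] lo by auto
  have Ix: "integrable lborel Gx" "(LINT z|lborel. Gx z) = 0"
  proof -
    have d: "((\<lambda>t. ext (\<lambda>z. \<phi> (v z) * vx z) (Complex t y)) has_real_derivative Gx (Complex x y)) (at x)" for x y
      unfolding Gx_def
      by (rule ext_deriv[OF _ lines(1) s(1)],
        rule DERIV_cong[OF DERIV_mult[OF DERIV_chain2[OF \<phi>(1) v_derivs(1)] v_derivs(3)]])
        (auto simp: lo power2_eq_square algebra_simps)
    have "ext (\<lambda>z. \<phi> (v z) * vx z) z = 0" if "R \<le> norm z" for z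
      using supp(1)[OF that] by (auto simp: w_def zero_ext_def)
    from integral_x_derivative_eq_0[OF conts(6) R this d]
    show "integrable lborel Gx" "(LINT z|lborel. Gx z) = 0" by auto
  qed
  have Iy: "integrable lborel Gy" "(LINT z|lborel. Gy z) = 0"
  proof -
    have d: "((\<lambda>t. ext (\<lambda>z. \<phi> (v z) * vy z) (Complex x t)) has_real_derivative Gy (Complex x y)) (at y)" for x y
      unfolding Gy_def
      by (rule ext_deriv[OF _ lines(2) s(1)],
        rule DERIV_cong[OF DERIV_mult[OF DERIV_chain2[OF \<phi>(1) v_derivs(2)] v_derivs(4)]])
        (auto simp: lo power2_eq_square algebra_simps)
    have "ext (\<lambda>z. \<phi> (v z) * vy z) z = 0" if "R \<le> norm z" for z
      using supp(1)[OF that] by (auto simp: w_def zero_ext_def)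
    from integral_y_derivative_eq_0[OF conts(7) R this d]
    show "integrable lborel Gy" "(LINT z|lborel. Gy z) = 0" by auto
  qed
  have w01: "0 \<le> w z" "w z \<le> 1" for z unfolding w_def zero_ext_def using \<phi>(3) by auto
  have ints: "integrable lborel w" "integrable lborel E" "integrable lborel P"
    using plane_integral_eq_iterated(1)[OF conts(1) R supp(1)] plane_integral_eq_iterated(1)[OF conts(4) R supp(2)]
     plane_integral_eq_iterated(1)[OF conts(5) R supp(3)] by auto
  have EP: "0 \<le> E z" "0 \<le> P z" for z unfolding E_def P_def zero_ext_def using \<phi>(4) by auto
  have fm: "{z. s < u z} \<in> fmeasurable lborel" "{z. t < u z} \<in> fmeasurable lborel"
    using level_fmeasurable[OF bdd] s by auto
  have iind: "integrable lborel (indicat_real {z. s < u z})" "integrable lborel (indicat_real {z. t < u z})"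
    using fm by (auto simp: integrable_indicator_iff fmeasurable_def)
  note sob = planar_sobolev[OF conts(1-3) dw w01(1) R supp(1)]
  define I where "I = (LINT z|lborel. sqrt ((wx z)\<^sup>2 + (wy z)\<^sup>2))"
  have grad: "sqrt ((wx z)\<^sup>2 + (wy z)\<^sup>2) = sqrt (P z) * sqrt (E z)" for z
    unfolding real_sqrt_mult[symmetric] wx_def wy_def P_def E_def zero_ext_def
    by (simp add: power2_eq_square algebra_simps)
  have "\<mu> t \<le> (LINT z|lborel. (w z)\<^sup>2)"
  proof -
    have "\<mu> t = (LINT z|lborel. indicat_real {z. t < u z} z)" unfolding \<mu>_def by simp
    also have "\<dots> \<le> (LINT z|lborel. (w z)\<^sup>2)"
    proof (rule integral_mono[OF iind(2) sob(1)])
      fix z show "indicat_real {z. t < u z} z \<le> (w z)\<^sup>2"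
        using hi(1)[of z] u_pos_iff[of z] s by (auto simp: indicator_def w_def zero_ext_def)
    qed
    finally show ?thesis .
  qed
  then have 1: "4 * pi * \<mu> t \<le> I\<^sup>2"
    using sob(3) unfolding I_def by (smt (verit) mult_left_mono pi_gt_zero)
  have 2: "I\<^sup>2 \<le> (LINT z|lborel. P z) * (LINT z|lborel. E z)"
  proof -
    have [measurable]: "P \<in> borel_measurable borel" "E \<in> borel_measurable borel"
      using conts by (auto intro: borel_measurable_continuous_onI)
    have n: "(\<integral>\<^sup>+z. ennreal (sqrt (P z)) * ennreal (sqrt (E z)) \<partial>lborel) = ennreal I"
      unfolding I_def ennreal_mult''[OF real_sqrt_ge_zero[OF EP(1)], symmetric] grad[symmetric]
      using sob(2) by (intro nn_integral_eq_integral) auto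
    have "(\<integral>\<^sup>+z. (ennreal (sqrt (P z)))\<^sup>2 \<partial>lborel) = ennreal (LINT z|lborel. P z)"
      "(\<integral>\<^sup>+z. (ennreal (sqrt (E z)))\<^sup>2 \<partial>lborel) = ennreal (LINT z|lborel. E z)"
      using ints EP by (auto simp: ennreal_power nn_integral_eq_integral)
    moreover have "(\<integral>\<^sup>+z. ennreal (sqrt (P z)) * ennreal (sqrt (E z)) \<partial>lborel)\<^sup>2
      \<le> (\<integral>\<^sup>+z. (ennreal (sqrt (P z)))\<^sup>2 \<partial>lborel) * (\<integral>\<^sup>+z. (ennreal (sqrt (E z)))\<^sup>2 \<partial>lborel)"
      by (rule Cauchy_Schwarz_nn_integral) measurable
    ultimately have "ennreal (I\<^sup>2) \<le> ennreal ((LINT z|lborel. P z) * (LINT z|lborel. E z))"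
      unfolding n by (simp add: ennreal_power ennreal_mult' I_def EP)
    then show ?thesis by (subst (asm) ennreal_le_iff) (auto intro!: mult_nonneg_nonneg Bochner_Integration.integral_nonneg EP)
  qed
  have 3: "(LINT z|lborel. E z) \<le> 2 * p * \<alpha> * \<mu> s"
  proof -
    \<comment> \<open>the divergence of \<open>\<phi>(v) \<nabla>v\<close>; the second derivatives of \<open>ln |f|\<close> cancel\<close>
    have "Gx z + Gy z = E z - 2 * p * \<alpha> * w z" for z
      unfolding Gx_def Gy_def E_def w_def zero_ext_def by (simp add: algebra_simps)
    then have "(LINT z|lborel. E z - 2 * p * \<alpha> * w z) = 0"
      using Ix Iy by (simp flip: \<open>\<And>z. Gx z + Gy z = _ z\<close>)
    then have "(LINT z|lborel. E z) = 2 * p * \<alpha> * (LINT z|lborel. w z)"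
      using ints by simp
    also have "(LINT z|lborel. w z) \<le> (LINT z|lborel. indicat_real {z. s < u z} z)"
    proof (rule integral_mono[OF ints(1) iind(1)])
      fix z show "w z \<le> indicat_real {z. s < u z} z"
        using w01[of z] lo(1)[of z] by (auto simp: indicator_def w_def zero_ext_def)
    qed
    finally show ?thesis using p \<alpha> unfolding \<mu>_def by (simp add: mult_left_mono)
  qed
  have 4: "(LINT z|lborel. P z) \<le> K * (\<mu> s - \<mu> t)"
  proof -
    have "(LINT z|lborel. P z) \<le> (LINT z|lborel. K * (indicat_real {z. s < u z} z - indicat_real {z. t < u z} z))"
    proof (rule integral_mono[OF ints(3)])
      show "integrable lborel (\<lambda>z. K * (indicat_real {z. s < u z} z - indicat_real {z. t < u z} z))"
        using iind by simp
      fix z show "P z \<le> K * (indicat_real {z. s < u z} z - indicat_real {z. t < u z} z)"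
        using \<phi>(4)[of "v z"] lo(2)[of z] hi(2)[of z] s u_pos_iff[of z]
        by (auto simp: indicator_def P_def zero_ext_def not_less)
    qed
    also have "\<dots> = K * (\<mu> s - \<mu> t)" using iind unfolding \<mu>_def by simp
    finally show ?thesis .
  qed
  have "I\<^sup>2 \<le> K * (\<mu> s - \<mu> t) * (2 * p * \<alpha> * \<mu> s)"
    by (rule order_trans[OF 2 mult_mono[OF 4 3]])
      (use 4 EP in \<open>auto intro!: Bochner_Integration.integral_nonneg intro: order_trans[OF _ 4]\<close>)
  then show ?thesis using 1 by linarith
qed

lemma level_inequality:
  assumes R: "0 < R" and bdd: "\<And>z. R \<le> norm z \<Longrightarrow> u z \<le> s" and s: "0 < s" "s < t"
  shows "2 * pi / (p * \<alpha>) * (ln t - ln s) * \<mu> t \<le> \<mu> s * (\<mu> s - \<mu> t)"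
proof -
  define h where "h = ln t - ln s"
  have h: "0 < h" using s by (simp add: h_def)
  define B where "B = (\<mu> s - \<mu> t) * (2 * p * \<alpha> * \<mu> s)"
  have "4 * pi * \<mu> t \<le> 1 / h * B"
  proof (rule tendsto_lowerbound)
    show "((\<lambda>K. K * B) \<longlongrightarrow> 1 / h * B) (at_right (1 / h))" by (intro tendsto_intros)
    show "\<forall>\<^sub>F K in at_right (1 / h). 4 * pi * \<mu> t \<le> K * B"
      unfolding eventually_at_right_field
      by (rule exI[of _ "1 / h + 1"]) (use level_inequality_cutoff[OF R bdd s] in \<open>auto simp: B_def h_def mult.assoc\<close>)
  qed simp
  then show ?thesis using h p \<alpha> unfolding B_def h_def[symmetric] by (simp add: field_simps)
qed

end

section \<open>Decay of the level measure\<close>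

text \<open>The step inequality loses the factor \<open>m y / m x\<close>.  Over \<open>n\<close> equal steps these factors multiply to
  \<open>m \<tau> / m \<sigma>\<close>, a fixed number; by \<open>r \<ge> 1 + ln r\<close> their sum is at least \<open>n\<close> plus a
  constant, so the total loss is of order \<open>1 / n\<close>.\<close>

lemma decay_from_infinitesimal_steps:
  fixes m :: "real \<Rightarrow> real"
  assumes \<sigma>\<tau>: "\<sigma> \<le> \<tau>" and c: "0 \<le> c" and pos: "0 < m \<tau>"
    and anti: "\<And>x y. \<sigma> \<le> x \<Longrightarrow> x \<le> y \<Longrightarrow> y \<le> \<tau> \<Longrightarrow> m y \<le> m x"
    and step: "\<And>x y. \<sigma> \<le> x \<Longrightarrow> x < y \<Longrightarrow> y \<le> \<tau> \<Longrightarrow> c * (y - x) * m y \<le> m x * (m x - m y)"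
  shows "c * (\<tau> - \<sigma>) \<le> m \<sigma> - m \<tau>"
proof (cases "\<sigma> = \<tau>")
  case False
  define H where "H = \<tau> - \<sigma>"
  have H: "0 < H" using False \<sigma>\<tau> by (simp add: H_def)
  have bound: "c * H - c * H * (ln (m \<sigma>) - ln (m \<tau>)) / real (Suc n) \<le> m \<sigma> - m \<tau>" for n
  proof -
    define N where "N = real (Suc n)"
    define x where "x = (\<lambda>i. \<sigma> + real i * (H / N))"
    have N: "0 < N" by (simp add: N_def)
    have x0: "x 0 = \<sigma>" and xN: "x (Suc n) = \<tau>"
      using N by (simp_all add: x_def H_def N_def del: of_nat_Suc)
    have x_step: "x (Suc i) - x i = H / N" for i by (simp add: x_def algebra_simps add_divide_distrib)
    have x_mono: "x i \<le> x j" if "i \<le> j" for i j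
      unfolding x_def using that H N by (intro add_left_mono mult_right_mono) auto
    have x_range: "\<sigma> \<le> x i" "x i \<le> \<tau>" if "i \<le> Suc n" for i
      using x_mono[of 0 i] x_mono[OF that] x0 xN by auto
    have mpos: "0 < m (x i)" if "i \<le> Suc n" for i
      using anti[OF x_range[OF that] order_refl] pos by linarith
    have "c * (H / N) * (1 + (ln (m (x (Suc i))) - ln (m (x i)))) \<le> m (x i) - m (x (Suc i))" if i: "i \<in> {..<Suc n}" for i
    proof -
      have r: "0 < m (x i)" "0 < m (x (Suc i))" using mpos[of i] mpos[of "Suc i"] i by auto
      \<comment> \<open>the loss factor of one step is bounded below by a telescoping quantity\<close>
      have "ln (m (x (Suc i)) / m (x i)) \<le> m (x (Suc i)) / m (x i) - 1"
        using r by (intro ln_le_minus_one) auto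
      then have "1 + (ln (m (x (Suc i))) - ln (m (x i))) \<le> m (x (Suc i)) / m (x i)"
        using r by (simp add: ln_div)
      then have "c * (H / N) * (1 + (ln (m (x (Suc i))) - ln (m (x i)))) \<le> c * (H / N) * (m (x (Suc i)) / m (x i))"
        using c H N by (intro mult_left_mono) auto
      also have "\<dots> \<le> m (x i) - m (x (Suc i))"
      proof -
        have "c * (x (Suc i) - x i) * m (x (Suc i)) \<le> m (x i) * (m (x i) - m (x (Suc i)))"
        proof (rule step)
          show "x i < x (Suc i)" using x_step[of i] H N by (smt (verit) divide_pos_pos)
        qed (use x_range[of i] x_range[of "Suc i"] i in auto)
        then have "c * (H / N) * m (x (Suc i)) / m (x i) \<le> m (x i) * (m (x i) - m (x (Suc i))) / m (x i)"
          unfolding x_step using r by (intro divide_right_mono) auto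
        then show ?thesis using r by simp
      qed
      finally show ?thesis .
    qed
    then have "c * (H / N) * (\<Sum>i<Suc n. 1 + (ln (m (x (Suc i))) - ln (m (x i)))) \<le> (\<Sum>i<Suc n. m (x i) - m (x (Suc i)))"
      unfolding sum_distrib_left by (rule sum_mono)
    moreover have "(\<Sum>i<Suc n. 1 + (ln (m (x (Suc i))) - ln (m (x i)))) = N + (ln (m \<tau>) - ln (m \<sigma>))"
      unfolding sum.distrib using sum_lessThan_telescope[of "\<lambda>i. ln (m (x i))" "Suc n"]
      by (simp add: N_def x0 xN del: sum.lessThan_Suc)
    moreover have "(\<Sum>i<Suc n. m (x i) - m (x (Suc i))) = m \<sigma> - m \<tau>"
      using sum_lessThan_telescope'[of "\<lambda>i. m (x i)" "Suc n"] by (simp add: x0 xN del: sum.lessThan_Suc)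
    ultimately have "c * (H / N) * (N + (ln (m \<tau>) - ln (m \<sigma>))) \<le> m \<sigma> - m \<tau>" by simp
    moreover have "c * (H / N) * (N + (ln (m \<tau>) - ln (m \<sigma>))) = c * H - c * H * (ln (m \<sigma>) - ln (m \<tau>)) / N"
      using N by (simp add: field_simps)
    ultimately show ?thesis by (simp add: N_def)
  qed
  have "(\<lambda>n. c * H - c * H * (ln (m \<sigma>) - ln (m \<tau>)) / real (Suc n)) \<longlonglongrightarrow> c * H - 0"
    by (intro tendsto_intros) (rule LIMSEQ_Suc[OF lim_const_over_n])
  from LIMSEQ_le_const2[OF this] bound show ?thesis unfolding H_def by auto
qed simp

lemma powr_le_iff_base: "0 < p \<Longrightarrow> 0 \<le> x \<Longrightarrow> 0 \<le> y \<Longrightarrow> x powr p \<le> y powr p \<longleftrightarrow> x \<le> y" for p x y :: real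
  by (meson linorder_not_less powr_less_mono2 powr_mono2 less_imp_le)

lemma measure_ball_complex: "0 \<le> r \<Longrightarrow> measure lborel (ball (a::complex) r) = pi * r\<^sup>2"
  by (simp add: content_ball eval_unit_ball_vol)

text \<open>An argument that treats all exponents \<open>p > 0\<close> and functions with zeros alike: let \<open>z0\<close> maximize
  \<open>(1 - |z|)\<^sup>2 |g z|\<^sup>p\<close> on the unit disc.  On a disc around \<open>z0\<close> of radius proportional to \<open>1 - |z0|\<close> the
  modulus of \<open>g\<close> is at most a fixed multiple \<open>K\<close> of \<open>|g z0|\<close>, so Cauchy's estimate controls \<open>g'\<close>, and
  \<open>|g|\<close> stays above \<open>|g z0| / 2\<close> on a smaller disc of comparable radius.  The area of that disc
  compensates the weight \<open>(1 - |z0|)\<^sup>2\<close>.\<close>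

lemma holomorphic_powr_norm_bound:
  assumes g: "g holomorphic_on UNIV" and p: "0 < p"
  shows "norm (g 0) powr p \<le> 64 * 2 powr p * 4 powr (2 / p) / pi *
    (LINT z|lborel. indicator (ball 0 1) z * norm (g z) powr p)"
proof (cases "g 0 = 0")
  case True
  then show ?thesis by (auto intro!: mult_nonneg_nonneg Bochner_Integration.integral_nonneg)
next
  case False
  have cg: "continuous_on A g" for A using g holomorphic_on_imp_continuous_on continuous_on_subset by blast
  define h where "h = (\<lambda>z. (1 - norm z)\<^sup>2 * norm (g z) powr p)"
  have ch: "continuous_on A h" for A
    unfolding h_def using p by (intro continuous_intros continuous_on_powr' cg) auto
  obtain z0 where z0: "z0 \<in> cball 0 1" "\<And>z. z \<in> cball 0 1 \<Longrightarrow> h z \<le> h z0"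
    using continuous_attains_sup[OF compact_cball _ ch] by (metis cball_eq_empty not_one_less_zero)
  have h0: "norm (g 0) powr p \<le> h z0" using z0(2)[of 0] by (simp add: h_def)
  then have hpos: "0 < h z0" using False by (smt (verit) powr_gt_zero zero_less_norm_iff)
  define \<rho> where "\<rho> = (1 - norm z0) / 2"
  have g0: "g z0 \<noteq> 0" and "norm z0 \<noteq> 1" using hpos by (auto simp: h_def)
  then have \<rho>: "0 < \<rho>" using z0(1) by (simp add: \<rho>_def)
  have hz0: "h z0 = 4 * \<rho>\<^sup>2 * norm (g z0) powr p" by (simp add: h_def \<rho>_def power2_eq_square)
  define K where "K = 4 powr (1 / p)"
  have K: "1 \<le> K" "K powr p = 4" "K\<^sup>2 = 4 powr (2 / p)" "0 < K"
    using p ge_one_powr_ge_zero[of 4 "1/p"] by (auto simp: K_def powr_powr power2_eq_square powr_add[symmetric])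
  \<comment> \<open>on this disc \<open>1 - |z|\<close> is at least half of \<open>1 - |z0|\<close>, so \<open>|g|\<^sup>p\<close> grows by a factor of at most 4\<close>
  have gK: "norm (g z) \<le> K * norm (g z0)" if "dist z0 z \<le> \<rho>" for z
  proof -
    have nz: "norm z \<le> norm z0 + \<rho>" using that by (smt (verit) dist_commute dist_norm norm_triangle_sub)
    have le: "\<rho> \<le> 1 - norm z" using nz by (simp add: \<rho>_def field_simps)
    have "\<rho>\<^sup>2 * norm (g z) powr p \<le> h z"
      unfolding h_def using le \<rho> by (intro mult_right_mono power_mono) auto
    also have "\<dots> \<le> h z0" using le \<rho> by (intro z0(2)) auto
    finally have "norm (g z) powr p \<le> 4 * norm (g z0) powr p"
      unfolding hz0 using \<rho> by (simp add: power2_eq_square)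
    also have "\<dots> = (K * norm (g z0)) powr p" using K by (simp add: powr_mult)
    finally show ?thesis using powr_le_iff_base[OF p] K by auto
  qed
  define B where "B = K * norm (g z0) / (\<rho> / 2)"
  have der: "norm (deriv g w) \<le> B" if "dist z0 w \<le> \<rho> / 2" for w
  proof -
    have "norm ((deriv ^^ 1) g w) \<le> fact 1 * (K * norm (g z0)) / (\<rho> / 2) ^ 1"
    proof (rule Cauchy_inequality)
      fix z assume "norm (w - z) = \<rho> / 2"
      then show "norm (g z) \<le> K * norm (g z0)"
        using that dist_triangle[of z0 z w] by (intro gK) (simp add: dist_norm norm_minus_commute)
    qed (use \<rho> cg holomorphic_on_subset[OF g] in auto)
    then show ?thesis by (simp add: B_def)
  qed
  define r where "r = \<rho> / (4 * K)"
  have r: "0 < r" "r \<le> \<rho> / 2" "B * r = norm (g z0) / 2"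
    using \<rho> K unfolding r_def B_def by (auto simp: field_simps)
  have low: "norm (g z0) / 2 \<le> norm (g z)" if z: "z \<in> ball z0 r" for z
  proof -
    have "norm (g z - g z0) \<le> B * norm (z - z0)"
    proof (rule field_differentiable_bound)
      fix w assume "w \<in> ball z0 r"
      then show "norm (deriv g w) \<le> B" using r by (intro der) auto
      show "(g has_field_derivative deriv g w) (at w within ball z0 r)"
        using holomorphic_derivI[OF g open_UNIV] by (auto intro: has_field_derivative_at_within)
    qed (use z r in auto)
    also have "\<dots> \<le> B * r"
      using z K \<rho> by (intro mult_left_mono) (auto simp: B_def dist_norm norm_minus_commute)
    finally have "norm (g z - g z0) \<le> norm (g z0) / 2" using r by simp
    then show ?thesis using norm_triangle_ineq2[of "g z0" "g z"] by (simp add: norm_minus_commute)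
  qed
  have sub: "ball z0 r \<subseteq> ball 0 1"
  proof
    fix z assume "z \<in> ball z0 r"
    then have "norm z < norm z0 + \<rho>"
      using r \<rho> norm_triangle_sub[of z z0] by (simp add: dist_norm norm_minus_commute)
    then show "z \<in> ball 0 1" using \<rho> by (simp add: \<rho>_def field_simps)
  qed
  have cp: "continuous_on A (\<lambda>z. norm (g z) powr p)" for A
    using p by (intro continuous_intros continuous_on_powr' cg) auto
  have int: "integrable lborel (\<lambda>z. indicator (ball 0 1) z * norm (g z) powr p)"
  proof (rule Bochner_Integration.integrable_bound)
    show "integrable lborel (\<lambda>z. indicator (cball 0 1) z *\<^sub>R (norm (g z) powr p))"
      by (rule borel_integrable_compact[OF compact_cball cp])
    show "(\<lambda>z. indicator (ball 0 1) z * norm (g z) powr p) \<in> borel_measurable lborel"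
      using borel_measurable_continuous_onI[OF cp]
      by (intro borel_measurable_times borel_measurable_indicator) auto
  qed (auto simp: indicator_def)
  have "(norm (g z0) / 2) powr p * (pi * r\<^sup>2) = (LINT z|lborel. (norm (g z0) / 2) powr p * indicat_real (ball z0 r) z)"
    using r by (simp add: measure_ball_complex)
  also have "\<dots> \<le> (LINT z|lborel. indicator (ball 0 1) z * norm (g z) powr p)"
  proof (rule integral_mono[OF _ int])
    show "integrable lborel (\<lambda>z. (norm (g z0) / 2) powr p * indicat_real (ball z0 r) z)"
      using emeasure_lborel_ball_finite by (intro integrable_mult_right integrable_real_indicator) auto
    fix z show "(norm (g z0) / 2) powr p * indicat_real (ball z0 r) z \<le> indicator (ball 0 1) z * norm (g z) powr p"
    proof (cases "z \<in> ball z0 r")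
      case True
      then have "z \<in> ball 0 1" using sub by blast
      then show ?thesis using True low[OF True] p by (simp add: powr_mono2)
    qed (simp add: indicator_def)
  qed
  finally have I: "(norm (g z0) / 2) powr p * (pi * r\<^sup>2) \<le> (LINT z|lborel. indicator (ball 0 1) z * norm (g z) powr p)" .
  have "h z0 = 64 * 2 powr p * K\<^sup>2 / pi * ((norm (g z0) / 2) powr p * (pi * r\<^sup>2))"
    unfolding hz0 r_def using K by (simp add: powr_divide power_divide power_mult_distrib field_simps)
  also have "\<dots> \<le> 64 * 2 powr p * K\<^sup>2 / pi * (LINT z|lborel. indicator (ball 0 1) z * norm (g z) powr p)"
    by (intro mult_left_mono I) auto
  finally show ?thesis using h0 unfolding K(3) by simp
qed

text \<open>The Weyl translation, which moves the weighted modulus rigidly by \<open>a\<close>; the kernel at \<open>a\<close> is the function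
  that it maps to the constant 1.\<close>

definition fock_translate :: "real \<Rightarrow> complex \<Rightarrow> (complex \<Rightarrow> complex) \<Rightarrow> complex \<Rightarrow> complex" where
  "fock_translate \<alpha> a f z = f (a + z) * exp (- complex_of_real \<alpha> * cnj a * z - complex_of_real (\<alpha> * (norm a)\<^sup>2 / 2))"

lemma fock_translate_holomorphic:
  "f holomorphic_on UNIV \<Longrightarrow> fock_translate \<alpha> a f holomorphic_on UNIV"
  unfolding fock_translate_def
  by (intro holomorphic_intros holomorphic_on_compose_gen[of "\<lambda>z. a + z" _ f, unfolded o_def]) auto

lemma fock_translate_weighted: "fock_weighted \<alpha> p (fock_translate \<alpha> a f) z = fock_weighted \<alpha> p f (a + z)"
proof -
  have "(norm (a + z))\<^sup>2 = (norm a)\<^sup>2 + 2 * Re (cnj a * z) + (norm z)\<^sup>2"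
    unfolding cmod_power2 by (simp add: power2_eq_square algebra_simps)
  then have "norm (fock_translate \<alpha> a f z * complex_of_real (exp (- \<alpha> * (norm z)\<^sup>2 / 2)))
     = norm (f (a + z) * complex_of_real (exp (- \<alpha> * (norm (a + z))\<^sup>2 / 2)))"
    by (simp add: fock_translate_def norm_mult exp_add[symmetric] algebra_simps mult_exp_exp add_divide_distrib)
  then show ?thesis unfolding fock_weighted_def by simp
qed

context entire_weight begin

lemma u_le_local_integral:
  "u a \<le> 64 * 2 powr p * 4 powr (2 / p) / pi * exp (p * \<alpha> / 2) * (LINT z|lborel. indicator (ball a 1) z * u z)"
proof -
  define C where "C = 64 * 2 powr p * 4 powr (2 / p) / pi"
  define g where "g = fock_translate \<alpha> a f"
  have g: "g holomorphic_on UNIV" unfolding g_def by (rule fock_translate_holomorphic[OF holo])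
  interpret G: entire_weight g \<alpha> p by unfold_locales (use g \<alpha> p in auto)
  have w: "fock_weighted \<alpha> p g z = u (a + z)" for z unfolding g_def by (rule fock_translate_weighted)
  have int: "integrable lborel (\<lambda>z. indicator (ball 0 1) z * G.u z)"
  proof (rule Bochner_Integration.integrable_bound)
    show "integrable lborel (\<lambda>z. indicator (cball 0 1) z *\<^sub>R G.u z)"
      by (rule borel_integrable_compact[OF compact_cball G.u_cont])
    show "(\<lambda>z. indicator (ball 0 1) z * G.u z) \<in> borel_measurable lborel"
      by (intro borel_measurable_times borel_measurable_indicator) auto
  qed (auto simp: indicator_def)
  have "u a = norm (g 0) powr p" using w[of 0] by (simp add: fock_weighted_def)
  also have "\<dots> \<le> C * (LINT z|lborel. indicator (ball 0 1) z * norm (g z) powr p)"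
    unfolding C_def by (rule holomorphic_powr_norm_bound[OF g p])
  also have "\<dots> \<le> C * (LINT z|lborel. exp (p * \<alpha> / 2) * (indicator (ball 0 1) z * G.u z))"
  proof (intro mult_left_mono Bochner_Integration.integral_mono')
    show "integrable lborel (\<lambda>z. exp (p * \<alpha> / 2) * (indicator (ball 0 1) z * G.u z))" using int by simp
    show "0 \<le> C" by (simp add: C_def)
    fix z :: complex
    show "indicator (ball 0 1) z * norm (g z) powr p \<le> exp (p * \<alpha> / 2) * (indicator (ball 0 1) z * G.u z)"
    proof (cases "z \<in> ball 0 1")
      case True
      then have "(norm z)\<^sup>2 \<le> 1" by (simp add: abs_square_le_1)
      then have "1 \<le> exp (p * \<alpha> / 2) * exp (- (p * \<alpha> / 2) * (norm z)\<^sup>2)"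
        unfolding exp_add[symmetric] using p \<alpha> mult_left_mono[of "(norm z)\<^sup>2" 1 "p * \<alpha> / 2"] by simp
      from mult_left_mono[OF this, of "norm (g z) powr p"] show ?thesis
        unfolding G.u_eq using True by (simp add: mult_ac)
    qed simp
    show "0 \<le> exp (p * \<alpha> / 2) * (indicator (ball 0 1) z * G.u z)" using G.u_nonneg by simp
  qed
  also have "(LINT z|lborel. exp (p * \<alpha> / 2) * (indicator (ball 0 1) z * G.u z))
      = exp (p * \<alpha> / 2) * (LINT z|lborel. indicator (ball 0 1) z * G.u z)" by simp
  also have "(LINT z|lborel. indicator (ball 0 1) z * G.u z) = (LINT z|lborel. indicator (ball a 1) (a + z) * u (a + z))"
    unfolding w by (intro Bochner_Integration.integral_cong) (auto simp: indicator_def dist_norm)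
  also have "\<dots> = (LINT z|distr lborel borel ((+) a). indicator (ball a 1) z * u z)"
    by (subst integral_distr) (auto intro!: borel_measurable_times borel_measurable_indicator)
  also have "\<dots> = (LINT z|lborel. indicator (ball a 1) z * u z)" unfolding lborel_distr_plus ..
  finally show ?thesis by (simp add: C_def mult_ac)
qed

text \<open>The value at a point is controlled by the integral over the unit disc around it, and these integrals
  are tails of a convergent integral.  Hence superlevel sets are bounded and the maximum is attained.\<close>

lemma u_small_at_infinity:
  assumes int: "integrable lborel u" and s: "0 < s"
  obtains R where "0 < R" "\<And>z. R \<le> norm z \<Longrightarrow> u z \<le> s"
proof -
  define C where "C = 64 * 2 powr p * 4 powr (2 / p) / pi * exp (p * \<alpha> / 2)"
  have C: "0 < C" by (simp add: C_def)
  have "(\<lambda>n. LINT z|lborel. indicator (- ball 0 (real n)) z * u z) \<longlonglongrightarrow> (LINT (z::complex)|lborel. (0::real))"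
  proof (rule Bochner_Integration.integral_dominated_convergence[where w=u and f="\<lambda>z. 0"
        and s="\<lambda>n z. indicator (- ball 0 (real n)) z * u z"])
    show "AE z in lborel. (\<lambda>n. indicator (- ball 0 (real n)) z * u z) \<longlonglongrightarrow> 0"
    proof (rule AE_I2)
      fix z :: complex
      obtain N where N: "norm z < real N" using reals_Archimedean2 by blast
      have "eventually (\<lambda>n. indicator (- ball 0 (real n)) z * u z = 0) sequentially"
        using eventually_ge_at_top[of N] by eventually_elim (use N in auto)
      then show "(\<lambda>n. indicator (- ball 0 (real n)) z * u z) \<longlonglongrightarrow> 0" by (rule tendsto_eventually)
    qed
  qed (use int u_nonneg in \<open>auto simp: indicator_def\<close>)
  then have "eventually (\<lambda>n. (LINT z|lborel. indicator (- ball 0 (real n)) z * u z) < s / C) sequentially"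
    using s C by (intro order_tendstoD(2)) auto
  then obtain n where n: "(LINT z|lborel. indicator (- ball 0 (real n)) z * u z) < s / C"
    by (auto simp: eventually_sequentially)
  show ?thesis
  proof
    show "0 < real n + 1" by simp
    fix a :: complex assume a: "real n + 1 \<le> norm a"
    have sub: "ball a 1 \<subseteq> - ball 0 (real n)"
    proof
      fix z assume "z \<in> ball a 1"
      then show "z \<in> - ball 0 (real n)" using a norm_triangle_sub[of a z] by (simp add: dist_norm)
    qed
    have "u a \<le> C * (LINT z|lborel. indicator (ball a 1) z * u z)"
      unfolding C_def by (rule u_le_local_integral)
    also have "\<dots> \<le> C * (LINT z|lborel. indicator (- ball 0 (real n)) z * u z)"
    proof (intro mult_left_mono integral_mono')
      show "integrable lborel (\<lambda>z. indicator (- ball 0 (real n)) z * u z)"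
        using int integrable_real_mult_indicator[of "- ball 0 (real n)" lborel u] by (simp add: mult.commute)
      fix z show "indicator (ball a 1) z * u z \<le> indicator (- ball 0 (real n)) z * u z"
        using sub u_nonneg[of z] by (auto simp: indicator_def)
      show "0 \<le> indicator (- ball 0 (real n)) z * u z" using u_nonneg[of z] by (auto simp: indicator_def)
    qed (use C in auto)
    also have "\<dots> \<le> s" using n C by (simp add: field_simps)
    finally show "u a \<le> s" .
  qed
qed

lemma u_attains_max:
  assumes int: "integrable lborel u"
  obtains a where "\<And>z. u z \<le> u a"
proof (cases "\<exists>b. 0 < u b")
  case True
  then obtain b where b: "0 < u b" ..
  then obtain R where R: "0 < R" "\<And>z. R \<le> norm z \<Longrightarrow> u z \<le> u b / 2"
    using u_small_at_infinity[OF int, of "u b / 2"] by auto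
  have "cball (0::complex) R \<noteq> {}" using R by simp
  from continuous_attains_sup[OF compact_cball this u_cont]
  obtain a where a: "\<And>z. z \<in> cball 0 R \<Longrightarrow> u z \<le> u a" by blast
  have "u b \<le> u a" using a[of b] R(2)[of b] b by force
  then have "u z \<le> u a" for z using a[of z] R(2)[of z] b by (cases "norm z \<le> R") auto
  then show ?thesis by (rule that)
next
  case False
  then show ?thesis using that[of 0] u_nonneg by (metis linorder_not_less order_trans)
qed

lemma level_fmeasurable_integrable:
  assumes int: "integrable lborel u" and t: "0 < t"
  shows "{z. t < u z} \<in> fmeasurable lborel"
proof -
  obtain R where "0 < R" "\<And>z. R \<le> norm z \<Longrightarrow> u z \<le> t" by (rule u_small_at_infinity[OF int t]) (rule that)
  then show ?thesis using level_fmeasurable by blast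
qed

lemma \<mu>_pos:
  assumes int: "integrable lborel u" and t: "0 < t" "t < u a"
  shows "0 < \<mu> t"
proof -
  have "open {z. t < u z}" by (intro open_Collect_less u_cont continuous_intros)
  then obtain r where r: "0 < r" "ball a r \<subseteq> {z. t < u z}"
    using t by (auto simp: open_contains_ball)
  have "0 < measure lborel (ball a r)" using r by (simp add: measure_ball_complex)
  also have "\<dots> \<le> \<mu> t"
    unfolding \<mu>_def using r level_fmeasurable_integrable[OF int t(1)]
    by (intro measure_mono_fmeasurable) auto
  finally show ?thesis .
qed

lemma \<mu>_antimono:
  assumes "integrable lborel u" "0 < s" "s \<le> t"
  shows "\<mu> t \<le> \<mu> s"
  unfolding \<mu>_def using assms level_fmeasurable_integrable[of s]
  by (intro measure_mono_fmeasurable) auto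

text \<open>The isoperimetric inequality for superlevel sets in integrated form; the Gaussian gives equality.
  In the logarithmic height the local inequality has the form required for infinitesimal steps.\<close>

theorem level_measure_decay:
  assumes int: "integrable lborel u" and s: "0 < s" "s \<le> t" and t: "t < u a"
  shows "2 * pi / (p * \<alpha>) * (ln t - ln s) \<le> \<mu> s - \<mu> t"
proof -
  have "2 * pi / (p * \<alpha>) * (ln t - ln s) \<le> \<mu> (exp (ln s)) - \<mu> (exp (ln t))"
  proof (rule decay_from_infinitesimal_steps[where m="\<lambda>x. \<mu> (exp x)"])
    show "0 < \<mu> (exp (ln t))" using \<mu>_pos[OF int _ t] s by simp
    fix x y :: real assume "x < y"
    obtain R where R: "0 < R" "\<And>z. R \<le> norm z \<Longrightarrow> u z \<le> exp x" by (rule u_small_at_infinity[OF int exp_gt_zero, of x]) (rule that)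
    show "2 * pi / (p * \<alpha>) * (y - x) * \<mu> (exp y) \<le> \<mu> (exp x) * (\<mu> (exp x) - \<mu> (exp y))"
      using level_inequality[OF R, of "exp y"] \<open>x < y\<close> by simp
  qed (use s \<alpha> p \<mu>_antimono[OF int] in auto)
  then show ?thesis using s by simp
qed

end

section \<open>Comparing integrals through superlevel sets\<close>

lemma layer_cake:
  fixes g :: "complex \<Rightarrow> real"
  assumes [measurable]: "g \<in> borel_measurable borel"
  shows "(\<integral>\<^sup>+z. ennreal (g z) \<partial>lborel) = (\<integral>\<^sup>+y. indicator {0<..} y * emeasure lborel {z. y < g z} \<partial>lborel)"
proof -
  have "(\<integral>\<^sup>+z. ennreal (g z) \<partial>lborel) = (\<integral>\<^sup>+z. \<integral>\<^sup>+y. indicator {0<..} y * indicator {z. y < g z} z \<partial>lborel \<partial>lborel)"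
  proof (rule nn_integral_cong)
    fix z
    have "(\<integral>\<^sup>+y. indicator {0<..} y * indicator {z. y < g z} z \<partial>lborel) = (\<integral>\<^sup>+y. indicator {0<..<g z} y \<partial>lborel)"
      by (rule nn_integral_cong) (auto simp: indicator_def)
    also have "\<dots> = ennreal (g z)" by (cases "0 \<le> g z") (auto simp: ennreal_neg)
    finally show "ennreal (g z) = (\<integral>\<^sup>+y. indicator {0<..} y * indicator {z. y < g z} z \<partial>lborel)" by simp
  qed
  also have "\<dots> = (\<integral>\<^sup>+y. \<integral>\<^sup>+z. indicator {0<..} y * indicator {z. y < g z} z \<partial>lborel \<partial>lborel)"
    by (rule lborel_pair.Fubini') measurable
  also have "\<dots> = (\<integral>\<^sup>+y. indicator {0<..} y * emeasure lborel {z. y < g z} \<partial>lborel)"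
    by (rule nn_integral_cong) (subst nn_integral_cmult, auto)
  finally show ?thesis .
qed

lemma superlevel_measurable_fun:
  fixes g :: "complex \<Rightarrow> real"
  assumes [measurable]: "g \<in> borel_measurable borel"
  shows "(\<lambda>y::real. indicator {0<..} y * emeasure lborel {z. y < g z}) \<in> borel_measurable lborel"
  by measurable

lemma nn_integral_le_of_superlevels:
  fixes g h :: "complex \<Rightarrow> real"
  assumes m: "g \<in> borel_measurable borel" "h \<in> borel_measurable borel"
    and le: "\<And>y. 0 < y \<Longrightarrow> emeasure lborel {z. y < g z} \<le> emeasure lborel {z. y < h z}"
  shows "(\<integral>\<^sup>+z. ennreal (g z) \<partial>lborel) \<le> (\<integral>\<^sup>+z. ennreal (h z) \<partial>lborel)"
  unfolding layer_cake[OF m(1)] layer_cake[OF m(2)]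
  using le by (intro nn_integral_mono) (auto simp: indicator_def)

text \<open>A strict inequality on a single height would be lost in the integral over heights; an interval of
  heights has positive length and preserves it.\<close>

lemma nn_integral_less_of_superlevels:
  fixes g h :: "complex \<Rightarrow> real"
  assumes m: "g \<in> borel_measurable borel" "h \<in> borel_measurable borel"
    and le: "\<And>y. 0 < y \<Longrightarrow> emeasure lborel {z. y < g z} \<le> emeasure lborel {z. y < h z}"
    and y: "0 \<le> y1" "y1 < y2"
    and less: "\<And>y. y1 < y \<Longrightarrow> y < y2 \<Longrightarrow> emeasure lborel {z. y < g z} < emeasure lborel {z. y < h z}"
    and fin: "(\<integral>\<^sup>+z. ennreal (g z) \<partial>lborel) \<noteq> \<infinity>"
  shows "(\<integral>\<^sup>+z. ennreal (g z) \<partial>lborel) < (\<integral>\<^sup>+z. ennreal (h z) \<partial>lborel)"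
proof -
  let ?l = "\<lambda>g y::real. indicator {0<..} y * emeasure lborel {z::complex. y < g z}"
  have "(\<integral>\<^sup>+y. ?l g y \<partial>lborel) < (\<integral>\<^sup>+y. ?l h y \<partial>lborel)"
  proof (rule nn_integral_less[OF superlevel_measurable_fun[OF m(1)] superlevel_measurable_fun[OF m(2)]])
    show "(\<integral>\<^sup>+y. ?l g y \<partial>lborel) \<noteq> \<infinity>" using fin unfolding layer_cake[OF m(1)] .
    show "AE y in lborel. ?l g y \<le> ?l h y" using le by (auto simp: indicator_def)
    show "\<not> (AE y in lborel. ?l h y \<le> ?l g y)"
    proof
      assume "AE y in lborel. ?l h y \<le> ?l g y"
      then have "AE y in lborel. y \<notin> {y1<..<y2}"
      proof eventually_elim
        fix y assume "?l h y \<le> ?l g y"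
        then have "emeasure lborel {z. y < h z} \<le> emeasure lborel {z. y < g z}" if "0 < y"
          using that by simp
        then show "y \<notin> {y1<..<y2}" using less[of y] y by (auto simp: not_le[symmetric])
      qed
      then have "emeasure lborel {y1<..<y2} = 0"
        by (subst (asm) AE_iff_null_sets[symmetric]) (auto simp: null_sets_def)
      then show False using y by simp
    qed
  qed
  then show ?thesis unfolding layer_cake[OF m(1)] layer_cake[OF m(2)] .
qed

text \<open>Superlevel sets of \<open>\<phi> \<circ> g\<close> are superlevel sets of \<open>g\<close> for the largest height \<open>\<tau>\<close> at which \<open>\<phi>\<close> does
  not exceed \<open>y\<close>.\<close>

lemma superlevel_threshold:
  fixes \<phi> :: "real \<Rightarrow> real"
  assumes mono: "mono \<phi>" and c: "continuous_on UNIV \<phi>" and y: "\<phi> 0 \<le> y" "y < \<phi> 1"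
  obtains \<tau> where "0 \<le> \<tau>" "\<tau> < 1" "\<phi> \<tau> = y" "\<And>t. y < \<phi> t \<longleftrightarrow> \<tau> < t"
proof -
  define S where "S = {t \<in> {0..1}. \<phi> t \<le> y}"
  define \<tau> where "\<tau> = Sup S"
  have c': "continuous_on A \<phi>" for A using c continuous_on_subset by blast
  have "closed S"
  proof -
    have "closed ({0..1} \<inter> \<phi> -` {..y})" by (intro continuous_closed_preimage c') auto
    then show ?thesis unfolding S_def by (simp add: vimage_def Int_def)
  qed
  moreover have "0 \<in> S" using y by (simp add: S_def)
  moreover have bdd: "bdd_above S" by (auto simp: S_def intro!: bdd_aboveI[of _ 1])
  ultimately have "\<tau> \<in> S" unfolding \<tau>_def by (intro closed_contains_Sup) auto
  then have \<tau>: "0 \<le> \<tau>" "\<tau> \<le> 1" "\<phi> \<tau> \<le> y" by (auto simp: S_def)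
  have up: "t \<le> \<tau>" if "t \<in> S" for t unfolding \<tau>_def by (rule cSup_upper[OF that bdd])
  have "\<exists>x\<ge>0. x \<le> 1 \<and> \<phi> x = y" by (rule IVT') (use y c' in auto)
  then obtain x where "x \<in> S" "\<phi> x = y" by (auto simp: S_def)
  then have eq: "\<phi> \<tau> = y" using up monoD[OF mono, of x \<tau>] \<tau> by force
  show ?thesis
  proof
    show "0 \<le> \<tau>" "\<phi> \<tau> = y" using \<tau> eq by auto
    show "\<tau> < 1" using \<tau> eq y by (cases "\<tau> = 1") auto
    fix t show "y < \<phi> t \<longleftrightarrow> \<tau> < t"
    proof
      assume "y < \<phi> t" then show "\<tau> < t" using monoD[OF mono, of t \<tau>] \<tau> by force
    next
      assume t: "\<tau> < t"
      show "y < \<phi> t"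
      proof (cases "t \<le> 1")
        case True
        then have "t \<notin> S" using up t by force
        then show ?thesis using True t \<tau> by (auto simp: S_def)
      next
        case False
        then show ?thesis using monoD[OF mono, of 1 t] y by simp
      qed
    qed
  qed
qed

text \<open>Only those heights \<open>\<tau>\<close> matter at which \<open>\<phi>\<close> is neither at its lowest nor at its highest value, since
  on other heights the composition has no superlevel set with that threshold.  This makes the lemma
  applicable to functions that vary only on one side of a crossing height.\<close>

lemma nn_integral_compose_le:
  fixes g h :: "complex \<Rightarrow> real" and \<phi> :: "real \<Rightarrow> real"
  assumes mono: "mono \<phi>" and c: "continuous_on UNIV \<phi>" and \<phi>0: "\<phi> 0 = 0"
    and [measurable]: "g \<in> borel_measurable borel" "h \<in> borel_measurable borel"
    and g1: "\<And>z. g z \<le> 1"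
    and le: "\<And>\<tau>. 0 < \<tau> \<Longrightarrow> \<tau> < 1 \<Longrightarrow> 0 < \<phi> \<tau> \<Longrightarrow> \<phi> \<tau> < \<phi> 1 \<Longrightarrow>
        emeasure lborel {z. \<tau> < g z} \<le> emeasure lborel {z. \<tau> < h z}"
  shows "(\<integral>\<^sup>+z. ennreal (\<phi> (g z)) \<partial>lborel) \<le> (\<integral>\<^sup>+z. ennreal (\<phi> (h z)) \<partial>lborel)"
proof (rule nn_integral_le_of_superlevels)
  have [measurable]: "\<phi> \<in> borel_measurable borel" using c by (rule borel_measurable_continuous_onI)
  show "(\<lambda>z. \<phi> (g z)) \<in> borel_measurable borel" "(\<lambda>z. \<phi> (h z)) \<in> borel_measurable borel" by measurable
  fix y :: real assume y: "0 < y"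
  show "emeasure lborel {z. y < \<phi> (g z)} \<le> emeasure lborel {z. y < \<phi> (h z)}"
  proof (cases "y < \<phi> 1")
    case True
    obtain \<tau> where \<tau>: "0 \<le> \<tau>" "\<tau> < 1" "\<phi> \<tau> = y" "\<And>t. y < \<phi> t \<longleftrightarrow> \<tau> < t"
      using superlevel_threshold[OF mono c _ True] \<phi>0 y by auto
    moreover have "0 < \<tau>" using \<tau> \<phi>0 y by (cases "\<tau> = 0") auto
    ultimately show ?thesis using le[of \<tau>] True y by simp
  next
    case False
    then have "\<not> y < \<phi> (g z)" for z using monoD[OF mono g1[of z]] by linarith
    then show ?thesis by simp
  qed
qed

lemma nn_integral_compose_less:
  fixes g h :: "complex \<Rightarrow> real" and \<phi> :: "real \<Rightarrow> real"
  assumes mono: "mono \<phi>" and c: "continuous_on UNIV \<phi>" and \<phi>0: "\<phi> 0 = 0"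
    and [measurable]: "g \<in> borel_measurable borel" "h \<in> borel_measurable borel"
    and g1: "\<And>z. g z \<le> 1"
    and le: "\<And>\<tau>. 0 < \<tau> \<Longrightarrow> \<tau> < 1 \<Longrightarrow> 0 < \<phi> \<tau> \<Longrightarrow> \<phi> \<tau> < \<phi> 1 \<Longrightarrow>
        emeasure lborel {z. \<tau> < g z} \<le> emeasure lborel {z. \<tau> < h z}"
    and y: "0 \<le> y1" "y1 < \<phi> 1"
    and less: "\<And>\<tau>. 0 < \<tau> \<Longrightarrow> \<tau> < 1 \<Longrightarrow> y1 < \<phi> \<tau> \<Longrightarrow> \<phi> \<tau> < \<phi> 1 \<Longrightarrow>
        emeasure lborel {z. \<tau> < g z} < emeasure lborel {z. \<tau> < h z}"
    and fin: "(\<integral>\<^sup>+z. ennreal (\<phi> (g z)) \<partial>lborel) \<noteq> \<infinity>"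
  shows "(\<integral>\<^sup>+z. ennreal (\<phi> (g z)) \<partial>lborel) < (\<integral>\<^sup>+z. ennreal (\<phi> (h z)) \<partial>lborel)"
proof (rule nn_integral_less_of_superlevels[OF _ _ _ y])
  have [measurable]: "\<phi> \<in> borel_measurable borel" using c by (rule borel_measurable_continuous_onI)
  show "(\<lambda>z. \<phi> (g z)) \<in> borel_measurable borel" "(\<lambda>z. \<phi> (h z)) \<in> borel_measurable borel" by measurable
  have thr: "\<exists>\<tau>. 0 < \<tau> \<and> \<tau> < 1 \<and> \<phi> \<tau> = y \<and> (\<forall>t. y < \<phi> t \<longleftrightarrow> \<tau> < t)" if y01: "0 < y" "y < \<phi> 1" for y
  proof -
    obtain \<tau> where \<tau>: "0 \<le> \<tau>" "\<tau> < 1" "\<phi> \<tau> = y" "\<And>t. y < \<phi> t \<longleftrightarrow> \<tau> < t"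
      using superlevel_threshold[OF mono c _ y01(2)] \<phi>0 y01 by auto
    moreover have "0 < \<tau>" using \<tau> \<phi>0 y01 by (cases "\<tau> = 0") auto
    ultimately show ?thesis by blast
  qed
  show "emeasure lborel {z. y < \<phi> (g z)} \<le> emeasure lborel {z. y < \<phi> (h z)}" if y: "0 < y" for y
  proof (cases "y < \<phi> 1")
    case True
    then obtain \<tau> where \<tau>: "0 < \<tau>" "\<tau> < 1" "\<phi> \<tau> = y" "\<And>t. y < \<phi> t \<longleftrightarrow> \<tau> < t" using thr[OF y] by auto
    then show ?thesis using le[of \<tau>] True y by simp
  next
    case False
    then have "\<not> y < \<phi> (g z)" for z using monoD[OF mono g1[of z]] by linarith
    then show ?thesis by simp
  qed
  show "emeasure lborel {z. t < \<phi> (g z)} < emeasure lborel {z. t < \<phi> (h z)}" if t: "y1 < t" "t < \<phi> 1" for t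
  proof -
    obtain \<tau> where \<tau>: "0 < \<tau>" "\<tau> < 1" "\<phi> \<tau> = t" "\<And>x. t < \<phi> x \<longleftrightarrow> \<tau> < x" using thr[of t] t y by auto
    then show ?thesis using less[of \<tau>] t by simp
  qed
qed (rule fin)

section \<open>Comparison with the Gaussian and the case of maximal height\<close>

definition gauss :: "real \<Rightarrow> real \<Rightarrow> complex \<Rightarrow> real" where
  "gauss \<alpha> p z = exp (- (p * \<alpha> / 2) * (norm z)\<^sup>2)"

lemma gauss_continuous: "continuous_on A (gauss \<alpha> p)"
  unfolding gauss_def by (intro continuous_intros)

lemma gauss_measurable [measurable]: "gauss \<alpha> p \<in> borel_measurable borel"
  by (intro borel_measurable_continuous_onI gauss_continuous)

lemma gauss_pos: "0 < gauss \<alpha> p z" by (simp add: gauss_def)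

lemma gauss_le_1: "0 < \<alpha> \<Longrightarrow> 0 < p \<Longrightarrow> gauss \<alpha> p z \<le> 1"
  by (simp add: gauss_def)

lemma gauss_level:
  assumes \<alpha>: "0 < \<alpha>" and p: "0 < p" and t: "0 < t"
  shows "emeasure lborel {z. t < gauss \<alpha> p z} = ennreal (2 * pi / (p * \<alpha>) * (- ln t))"
proof (cases "t < 1")
  case True
  define r where "r = sqrt (2 / (p * \<alpha>) * (- ln t))"
  have neg: "0 < 2 / (p * \<alpha>) * (- ln t)" using True t \<alpha> p by (intro mult_pos_pos) auto
  then have r: "0 < r" "r\<^sup>2 = 2 / (p * \<alpha>) * (- ln t)" by (simp_all add: r_def)
  have "t < gauss \<alpha> p z \<longleftrightarrow> z \<in> ball 0 r" for z
  proof -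
    have "t < gauss \<alpha> p z \<longleftrightarrow> ln t < - (p * \<alpha> / 2) * (norm z)\<^sup>2"
      unfolding gauss_def using t by (metis exp_less_cancel_iff exp_ln)
    also have "\<dots> \<longleftrightarrow> (norm z)\<^sup>2 < r\<^sup>2" unfolding r(2) using \<alpha> p by (simp add: field_simps) linarith
    also have "\<dots> \<longleftrightarrow> norm z < r" using r(1) power2_less_imp_less[of "norm z" r] power_strict_mono[of "norm z" r 2] by auto
    finally show ?thesis by simp
  qed
  then have "{z. t < gauss \<alpha> p z} = ball 0 r" by blast
  then have "emeasure lborel {z. t < gauss \<alpha> p z} = ennreal (measure lborel (ball (0::complex) r))"
    using emeasure_lborel_ball_finite[of "0::complex" r] by (simp add: emeasure_eq_ennreal_measure)
  also have "measure lborel (ball (0::complex) r) = 2 * pi / (p * \<alpha>) * (- ln t)"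
    using r by (simp add: measure_ball_complex)
  finally show ?thesis .
next
  case False
  then have "{z. t < gauss \<alpha> p z} = {}"
    using gauss_le_1[OF \<alpha> p] by (auto simp: not_less intro: order_trans)
  moreover have "2 * pi / (p * \<alpha>) * (- ln t) \<le> 0" using False \<alpha> p by (intro mult_nonneg_nonpos) auto
  ultimately show ?thesis by (simp add: ennreal_neg)
qed

lemma has_integral_neg_ln: "((\<lambda>t. - ln t) has_integral (1::real)) {0..1}"
proof -
  have "((\<lambda>t. - ln t) has_integral ((1 - 1 * ln 1) - (0 - 0 * ln (0::real)))) {0..1}"
  proof (rule fundamental_theorem_of_calculus_interior[where f="\<lambda>t. t - t * ln t"])
    have "isCont (\<lambda>t::real. t * ln t) t" if "0 < t" for t
      using that by (intro continuous_intros) auto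
    moreover have "((\<lambda>t::real. t * ln t) \<longlongrightarrow> 0) (at 0 within {0..1})"
    proof (rule Lim_null_comparison)
      show "\<forall>\<^sub>F t::real in at 0 within {0..1}. norm (t * ln t) \<le> 2 * sqrt t"
        unfolding eventually_at_filter
      proof (rule always_eventually, intro allI impI)
        fix t :: real assume "t \<noteq> 0" "t \<in> {0..1}"
        then have t: "0 < t" "t \<le> 1" by auto
        define x where "x = sqrt t"
        have x: "0 < x" "t = x\<^sup>2" using t by (simp_all add: x_def)
        have "ln (1 / x) \<le> 1 / x - 1" using x by (intro ln_le_minus_one) simp
        then have "- ln x \<le> 1 / x" using x by (simp add: ln_div)
        then have "x\<^sup>2 * (- (2 * ln x)) \<le> x\<^sup>2 * (2 * (1 / x))" using x by (intro mult_left_mono) auto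
        moreover have "ln t = 2 * ln x" using x by (simp add: ln_realpow)
        ultimately have "t * (- ln t) \<le> 2 * x" using x by (simp add: power2_eq_square)
        moreover have "norm (t * ln t) = t * (- ln t)" using t by (simp add: abs_mult)
        ultimately show "norm (t * ln t) \<le> 2 * sqrt t" by (simp add: x_def)
      qed
      show "((\<lambda>t::real. 2 * sqrt t) \<longlongrightarrow> 0) (at 0 within {0..1})"
        by (rule tendsto_eq_intros refl | simp)+
    qed
    ultimately have "((\<lambda>t::real. t * ln t) \<longlongrightarrow> t * ln t) (at t within {0..1})" if "t \<in> {0..1}" for t
      using that by (cases "t = 0") (auto simp: isCont_def intro: tendsto_within_subset[OF _ subset_UNIV])
    then have "continuous_on {0..1} (\<lambda>t::real. t * ln t)"
      unfolding continuous_on_eq_continuous_within continuous_within by blast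
    then show "continuous_on {0..1} (\<lambda>t::real. t - t * ln t)"
      by (rule continuous_on_diff[OF continuous_on_id])
    fix t :: real assume "t \<in> {0<..<1}"
    then show "((\<lambda>t. t - t * ln t) has_vector_derivative - ln t) (at t)"
      unfolding has_real_derivative_iff_has_vector_derivative[symmetric]
      by (auto intro!: derivative_eq_intros)
  qed simp
  then show ?thesis by simp
qed

lemma nn_integral_gauss:
  assumes \<alpha>: "0 < \<alpha>" and p: "0 < p"
  shows "(\<integral>\<^sup>+z. ennreal (gauss \<alpha> p z) \<partial>lborel) = ennreal (2 * pi / (p * \<alpha>))"
proof -
  define c where "c = 2 * pi / (p * \<alpha>)"
  have c: "0 \<le> c" using \<alpha> p by (simp add: c_def)
  define k where "k = (\<lambda>y. if y \<in> {0..1} then c * (- ln y) else (0::real))"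
  have k: "0 \<le> k y" for y unfolding k_def using c
    by (cases "y = 0") (auto simp: mult_nonneg_nonpos)
  have "(\<integral>\<^sup>+z. ennreal (gauss \<alpha> p z) \<partial>lborel) = (\<integral>\<^sup>+y. ennreal (k y) \<partial>lborel)"
    unfolding layer_cake[OF gauss_measurable]
  proof (rule nn_integral_cong)
    fix y :: real
    consider "y \<le> 0" | "0 < y" "y \<le> 1" | "1 < y" by linarith
    then show "indicator {0<..} y * emeasure lborel {z. y < gauss \<alpha> p z} = ennreal (k y)"
    proof cases
      case 3
      then have "c * (- ln y) \<le> 0" using c by (intro mult_nonneg_nonpos) auto
      then show ?thesis using 3 gauss_level[OF \<alpha> p, of y] by (simp add: k_def c_def ennreal_neg)
    qed (auto simp: gauss_level[OF \<alpha> p] k_def c_def)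
  qed
  also have "\<dots> = ennreal c"
  proof (rule nn_integral_has_integral_lborel[OF _ k])
    show "k \<in> borel_measurable borel" unfolding k_def by measurable
    have "((\<lambda>y. c * (- ln y)) has_integral c * 1) {0..1}"
      by (rule has_integral_mult_right[OF has_integral_neg_ln])
    then show "(k has_integral c) UNIV"
      unfolding k_def by (subst has_integral_restrict_UNIV) simp
  qed
  finally show ?thesis by (simp add: c_def)
qed

lemma integrable_gauss:
  assumes \<alpha>: "0 < \<alpha>" and p: "0 < p"
  shows "integrable lborel (gauss \<alpha> p)" "(LINT z|lborel. gauss \<alpha> p z) = 2 * pi / (p * \<alpha>)"
proof -
  show "integrable lborel (gauss \<alpha> p)"
    using nn_integral_gauss[OF \<alpha> p] gauss_pos by (intro integrableI_nonneg) (auto simp: less_imp_le)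
  show "(LINT z|lborel. gauss \<alpha> p z) = 2 * pi / (p * \<alpha>)"
    using nn_integral_gauss[OF \<alpha> p] gauss_pos \<alpha> p by (subst integral_eq_nn_integral) (auto simp: less_imp_le)
qed

locale normalized_weight = entire_weight +
  assumes int: "integrable lborel u" and norm1: "(LINT z|lborel. u z) = 2 * pi / (p * \<alpha>)"
begin

lemma emeasure_level: "0 < t \<Longrightarrow> emeasure lborel {z. t < u z} = ennreal (\<mu> t)"
  unfolding \<mu>_def using fmeasurableD2[OF level_fmeasurable_integrable[OF int]]
  by (intro emeasure_eq_ennreal_measure) auto

lemma \<mu>_lower:
  assumes y: "0 < y" "y < u a"
  shows "2 * pi / (p * \<alpha>) * (ln (u a) - ln y) \<le> \<mu> y"
proof (rule tendsto_upperbound)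
  show "((\<lambda>t. 2 * pi / (p * \<alpha>) * (ln t - ln y)) \<longlongrightarrow> 2 * pi / (p * \<alpha>) * (ln (u a) - ln y)) (at_left (u a))"
    using y by (intro tendsto_intros) auto
  show "\<forall>\<^sub>F t in at_left (u a). 2 * pi / (p * \<alpha>) * (ln t - ln y) \<le> \<mu> y"
    unfolding eventually_at_left_field
  proof (intro exI conjI allI impI)
    show "y < u a" by (rule y)
    fix t assume "y < t" "t < u a"
    then have "2 * pi / (p * \<alpha>) * (ln t - ln y) \<le> \<mu> y - \<mu> t"
      using y by (intro level_measure_decay[OF int]) auto
    moreover have "0 \<le> \<mu> t" unfolding \<mu>_def by (rule measure_nonneg)
    ultimately show "2 * pi / (p * \<alpha>) * (ln t - ln y) \<le> \<mu> y" by linarith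
  qed
qed simp

text \<open>Let \<open>T = u a\<close>.  Letting \<open>t\<close> tend to \<open>T\<close> in the decay estimate gives \<open>\<mu>(y) \<ge> c (ln T - ln y)\<close>, which is
  the level measure of \<open>T\<close> times the Gaussian.  Hence \<open>T\<close> times the integral of the Gaussian is at
  most the integral of \<open>u\<close>, and the integrals of \<open>u\<close> and of the Gaussian agree by normalization.\<close>

lemma u_le_1: "u a \<le> 1"
proof (cases "u a = 0")
  case False
  then have ua: "0 < u a" using u_nonneg[of a] by simp
  define c where "c = 2 * pi / (p * \<alpha>)"
  have c: "0 < c" using p \<alpha> by (simp add: c_def)
  have "(\<integral>\<^sup>+z. ennreal (u a * gauss \<alpha> p z) \<partial>lborel) \<le> (\<integral>\<^sup>+z. ennreal (u z) \<partial>lborel)"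
  proof (rule nn_integral_le_of_superlevels)
    fix y :: real assume y: "0 < y"
    have "{z. y < u a * gauss \<alpha> p z} = {z. y / u a < gauss \<alpha> p z}"
      using ua by (simp add: field_simps)
    then have e: "emeasure lborel {z. y < u a * gauss \<alpha> p z} = ennreal (c * (ln (u a) - ln y))"
      using gauss_level[OF \<alpha> p, of "y / u a"] ua y by (simp add: ln_div c_def)
    show "emeasure lborel {z. y < u a * gauss \<alpha> p z} \<le> emeasure lborel {z. y < u z}"
    proof (cases "y < u a")
      case True
      then show ?thesis unfolding e emeasure_level[OF y] using \<mu>_lower[OF y True] by (simp add: c_def ennreal_leI)
    next
      case False
      then have "c * (ln (u a) - ln y) \<le> 0" using c ua y by (intro mult_nonneg_nonpos) auto
      then show ?thesis unfolding e by (simp add: ennreal_neg)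
    qed
  qed measurable
  moreover have "(\<integral>\<^sup>+z. ennreal (u a * gauss \<alpha> p z) \<partial>lborel) = ennreal (u a * c)"
  proof -
    have "(\<integral>\<^sup>+z. ennreal (u a * gauss \<alpha> p z) \<partial>lborel) = ennreal (u a) * ennreal c"
      unfolding c_def nn_integral_gauss[OF \<alpha> p, symmetric] using ua
      by (simp add: ennreal_mult' nn_integral_cmult)
    then show ?thesis using ua c by (simp add: ennreal_mult')
  qed
  moreover have "(\<integral>\<^sup>+z. ennreal (u z) \<partial>lborel) = ennreal c"
    using nn_integral_eq_integral[OF int] u_nonneg norm1 by (simp add: c_def)
  ultimately have "u a * c \<le> c" using c by (simp add: ennreal_le_iff)
  then show ?thesis using c by simp
qed simp

end

lemma norm_eq_of_open_ball_imp_constant: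
  assumes f: "f holomorphic_on UNIV" and r: "0 < r" and n: "\<And>z. z \<in> ball 0 r \<Longrightarrow> norm (f z) = k"
  shows "f z = f 0"
proof -
  have "f constant_on UNIV"
    by (rule maximum_modulus_principle[OF f open_UNIV connected_UNIV open_ball[of 0 r] _, of 0]) (use n r in auto)
  then show ?thesis by (auto simp: constant_on_def)
qed

text \<open>The mean value property of the holomorphic function \<open>z Q(z)\<close>, which vanishes at 0, with respect to a
  radial weight \<open>V\<close>: if the gradient of \<open>W\<close> is \<open>V\<close> times the position
  vector, then the Cauchy-Riemann equations make \<open>V Re(z Q)\<close> the divergence of the compactly
  supported field \<open>(W Re Q, - W Im Q)\<close>.\<close>

lemma integral_radial_weight_holomorphic_eq_0:
  fixes W V :: "complex \<Rightarrow> real"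
  assumes Q: "Q holomorphic_on ball 0 r" and r: "0 < r'" "r' < r"
    and cW: "continuous_on UNIV W" and cV: "continuous_on UNIV V"
    and W0: "\<And>z. r' \<le> norm z \<Longrightarrow> W z = 0" and V0: "\<And>z. r' \<le> norm z \<Longrightarrow> V z = 0"
    and dx: "\<And>x y. ((\<lambda>t. W (Complex t y)) has_real_derivative V (Complex x y) * x) (at x)"
    and dy: "\<And>x y. ((\<lambda>t. W (Complex x t)) has_real_derivative V (Complex x y) * y) (at y)"
  shows "integrable lborel (zero_ext (ball 0 r) (\<lambda>z. V z * Re (z * Q z)))"
    "(LINT z|lborel. zero_ext (ball 0 r) (\<lambda>z. V z * Re (z * Q z)) z) = 0"
proof -
  define U where "U = ball (0::complex) r"
  define N where "N = - cball (0::complex) r'"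
  have UN: "open U" "open N" "U \<union> N = UNIV" using r by (auto simp: U_def N_def)
  have N0: "W z = 0" "V z = 0" if "z \<in> N" for z using that W0 V0 by (auto simp: N_def)
  have dQ: "(Q has_field_derivative deriv Q z) (at z)" if "z \<in> U" for z
    using holomorphic_derivI[OF Q open_ball] that by (simp add: U_def)
  have cQ: "continuous_on U Q" "continuous_on U (deriv Q)"
    using Q holomorphic_deriv[OF Q open_ball] holomorphic_on_imp_continuous_on by (auto simp: U_def)
  have cWV: "continuous_on U W" "continuous_on U V" using cW cV continuous_on_subset by blast+
  define X where "X = zero_ext U (\<lambda>z. W z * Re (Q z))"
  define X' where "X' = zero_ext U (\<lambda>z. V z * Re z * Re (Q z) + W z * Re (deriv Q z))"
  define Y where "Y = zero_ext U (\<lambda>z. W z * Im (Q z))"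
  define Y' where "Y' = zero_ext U (\<lambda>z. V z * Im z * Im (Q z) + W z * Re (deriv Q z))"
  have c: "continuous_on UNIV X'" "continuous_on UNIV Y'"
    unfolding X'_def Y'_def
    by (rule continuous_on_zero_ext[OF UN], intro continuous_intros cQ cWV, simp add: N0)+
  have lines: "continuous_on UNIV (\<lambda>t. Complex t y)" "continuous_on UNIV (\<lambda>t. Complex y t)" for y
    by (auto intro!: continuous_intros)
  have dX: "((\<lambda>t. X (Complex t y)) has_real_derivative X' (Complex x y)) (at x)" for x y
    unfolding X_def X'_def
  proof (rule has_real_derivative_zero_ext[OF UN _ lines(1)])
    assume "Complex x y \<in> U"
    from DERIV_mult[OF dx has_real_derivative_Re_Im_lines(1)[OF dQ[OF this]]]
    show "((\<lambda>t. W (Complex t y) * Re (Q (Complex t y))) has_real_derivative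
       V (Complex x y) * Re (Complex x y) * Re (Q (Complex x y)) + W (Complex x y) * Re (deriv Q (Complex x y))) (at x)"
      by (rule DERIV_cong) simp
  qed (simp add: N0)
  have dY: "((\<lambda>t. Y (Complex x t)) has_real_derivative Y' (Complex x y)) (at y)" for x y
    unfolding Y_def Y'_def
  proof (rule has_real_derivative_zero_ext[OF UN _ lines(2)])
    assume "Complex x y \<in> U"
    from DERIV_mult[OF dy has_real_derivative_Re_Im_lines(4)[OF dQ[OF this]]]
    show "((\<lambda>t. W (Complex x t) * Im (Q (Complex x t))) has_real_derivative
       V (Complex x y) * Im (Complex x y) * Im (Q (Complex x y)) + W (Complex x y) * Re (deriv Q (Complex x y))) (at y)"
      by (rule DERIV_cong) simp
  qed (simp add: N0)
  have "X z = 0" "Y z = 0" if "r' \<le> norm z" for z using W0[OF that] by (auto simp: X_def Y_def zero_ext_def)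
  note I = integral_x_derivative_eq_0[OF c(1) r(1) this(1) dX] integral_y_derivative_eq_0[OF c(2) r(1) this(2) dY]
  have eq: "zero_ext (ball 0 r) (\<lambda>z. V z * Re (z * Q z)) = (\<lambda>z. X' z - Y' z)"
    by (auto simp: fun_eq_iff zero_ext_def X'_def Y'_def U_def algebra_simps)
  show "integrable lborel (zero_ext (ball 0 r) (\<lambda>z. V z * Re (z * Q z)))"
    "(LINT z|lborel. zero_ext (ball 0 r) (\<lambda>z. V z * Re (z * Q z)) z) = 0"
    unfolding eq using I by auto
qed

lemma continuous_nonneg_integral_le_0_imp_0:
  fixes g :: "complex \<Rightarrow> real"
  assumes c: "continuous_on UNIV g" and nn: "\<And>z. 0 \<le> g z" and int: "integrable lborel g"
    and le: "(LINT z|lborel. g z) \<le> 0"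
  shows "g z = 0"
proof -
  have "(LINT z|lborel. g z) = 0" using le Bochner_Integration.integral_nonneg[of lborel g, OF nn] by simp
  then have "AE z in lborel. g z = 0"
    using integral_nonneg_eq_0_iff_AE[OF int] nn by simp
  then have "AE z in lborel. z \<notin> {z. g z \<noteq> 0}" by simp
  moreover have "{z. g z \<noteq> 0} \<in> sets lborel"
    using borel_measurable_continuous_onI[OF c] by simp
  ultimately have "{z. g z \<noteq> 0} \<in> null_sets lborel" by (simp only: AE_iff_null_sets)
  then have "negligible {z. g z \<noteq> 0}"
    unfolding negligible_iff_null_sets by (rule null_sets_completionI)
  moreover have "open {z. g z \<noteq> 0}" by (intro open_Collect_neq c continuous_intros)
  ultimately show ?thesis using open_not_negligible by blast
qed

locale peaked_weight = normalized_weight +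
  assumes peak: "u 0 = 1"
begin

definition \<Phi> :: "real \<Rightarrow> real \<Rightarrow> real" where "\<Phi> s t = (max 0 (t - s))\<^sup>2"

text \<open>When \<open>u\<close> peaks with value 1, its superlevel sets are at least as large as those of the Gaussian, so any
  increasing function of \<open>u\<close> has the larger integral.  Applied to \<open>t - \<Phi>(t) / 2\<close>, which increases on
  \<open>[0, 1]\<close>, this reverses the inequality for \<open>\<Phi>\<close>, because the integrals of \<open>u\<close> and of the Gaussian agree.\<close>

lemma integral_\<Phi>_le:
  assumes s: "0 \<le> s" "s < 1"
  shows "integrable lborel (\<lambda>z. \<Phi> s (u z))" "integrable lborel (\<lambda>z. \<Phi> s (gauss \<alpha> p z))"
    "(LINT z|lborel. \<Phi> s (u z)) \<le> (LINT z|lborel. \<Phi> s (gauss \<alpha> p z))"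
proof -
  have \<Phi>_le: "0 \<le> \<Phi> s t" "\<Phi> s t \<le> t" if "0 \<le> t" "t \<le> 1" for t
  proof -
    have "(max 0 (t - s)) * (max 0 (t - s)) \<le> t * 1" using that s by (intro mult_mono) auto
    then show "0 \<le> \<Phi> s t" "\<Phi> s t \<le> t" by (simp_all add: \<Phi>_def power2_eq_square)
  qed
  have c\<Phi>: "continuous_on UNIV (\<Phi> s)" unfolding \<Phi>_def by (intro continuous_intros)
  then have [measurable]: "\<Phi> s \<in> borel_measurable borel" by (rule borel_measurable_continuous_onI)
  have 01: "0 \<le> u z" "u z \<le> 1" "0 \<le> gauss \<alpha> p z" "gauss \<alpha> p z \<le> 1" for z
    using u_nonneg u_le_1 gauss_pos gauss_le_1[OF \<alpha> p] by (auto simp: less_imp_le)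
  show I1: "integrable lborel (\<lambda>z. \<Phi> s (u z))"
    by (rule Bochner_Integration.integrable_bound[OF int]) (use \<Phi>_le 01 in auto)
  show I2: "integrable lborel (\<lambda>z. \<Phi> s (gauss \<alpha> p z))"
    by (rule Bochner_Integration.integrable_bound[OF integrable_gauss(1)[OF \<alpha> p]]) (use \<Phi>_le 01 in auto)
  define cl :: "real \<Rightarrow> real" where "cl = (\<lambda>t. max 0 (min 1 t))"
  define \<phi> where "\<phi> = (\<lambda>t. cl t - \<Phi> s (cl t) / 2)"
  have \<phi>_eq: "\<phi> (u z) = u z - \<Phi> s (u z) / 2" "\<phi> (gauss \<alpha> p z) = gauss \<alpha> p z - \<Phi> s (gauss \<alpha> p z) / 2" for z
    using 01[of z] by (simp_all add: \<phi>_def cl_def)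
  have "mono \<phi>"
  proof (rule monoI)
    fix x y :: real assume "x \<le> y"
    then have xy: "0 \<le> cl x" "cl x \<le> cl y" "cl y \<le> 1" by (auto simp: cl_def)
    define X Y where "X = max 0 (cl x - s)" and "Y = max 0 (cl y - s)"
    have XY: "0 \<le> X" "X \<le> Y" "Y \<le> 1" "Y - X \<le> cl y - cl x" using xy s by (auto simp: X_def Y_def)
    have "Y\<^sup>2 - X\<^sup>2 = (Y - X) * (Y + X)" by (simp add: power2_eq_square algebra_simps)
    also have "\<dots> \<le> (Y - X) * 2" using XY by (intro mult_left_mono) auto
    finally have "Y\<^sup>2 / 2 - X\<^sup>2 / 2 \<le> cl y - cl x" using XY(4) by simp
    then show "\<phi> x \<le> \<phi> y" unfolding \<phi>_def \<Phi>_def X_def[symmetric] Y_def[symmetric] by linarith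
  qed
  have "(\<integral>\<^sup>+z. ennreal (\<phi> (gauss \<alpha> p z)) \<partial>lborel) \<le> (\<integral>\<^sup>+z. ennreal (\<phi> (u z)) \<partial>lborel)"
  proof (rule nn_integral_compose_le[OF \<open>mono \<phi>\<close>])
    show "continuous_on UNIV \<phi>" unfolding \<phi>_def cl_def \<Phi>_def by (intro continuous_intros) auto
    show "\<phi> 0 = 0" using s by (simp add: \<phi>_def cl_def \<Phi>_def)
    fix \<tau> :: real assume \<tau>: "0 < \<tau>" "\<tau> < 1"
    show "emeasure lborel {z. \<tau> < gauss \<alpha> p z} \<le> emeasure lborel {z. \<tau> < u z}"
      unfolding gauss_level[OF \<alpha> p \<tau>(1)] emeasure_level[OF \<tau>(1)]
      using \<mu>_lower[of \<tau> 0] \<tau> by (simp add: peak ennreal_leI)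
  qed (use 01 in auto)
  moreover have nn: "0 \<le> \<phi> (u z)" "0 \<le> \<phi> (gauss \<alpha> p z)" for z
    unfolding \<phi>_eq using \<Phi>_le(2)[of "u z"] \<Phi>_le(2)[of "gauss \<alpha> p z"] \<Phi>_le(1)[of "u z"] \<Phi>_le(1)[of "gauss \<alpha> p z"] 01[of z] by linarith+
  moreover have J: "integrable lborel (\<lambda>z. \<phi> (u z))" "integrable lborel (\<lambda>z. \<phi> (gauss \<alpha> p z))"
    unfolding \<phi>_eq using int I1 I2 integrable_gauss(1)[OF \<alpha> p] by simp_all
  ultimately have "(LINT z|lborel. \<phi> (gauss \<alpha> p z)) \<le> (LINT z|lborel. \<phi> (u z))"
    by (simp add: nn_integral_eq_integral ennreal_le_iff Bochner_Integration.integral_nonneg)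
  then show "(LINT z|lborel. \<Phi> s (u z)) \<le> (LINT z|lborel. \<Phi> s (gauss \<alpha> p z))"
    unfolding \<phi>_eq using int I1 I2 integrable_gauss[OF \<alpha> p] norm1 by simp
qed

text \<open>Near 0 write \<open>|f|\<^sup>p = |g|\<^sup>2\<close> with \<open>g\<close> holomorphic, and choose \<open>s\<close> so close to 1 that the
  Gaussian exceeds \<open>s\<close> only there.  By convexity \<open>\<Phi>(u) - \<Phi>(gauss) \<ge> \<Phi>'(gauss) (u - gauss)\<close>, and
  \<open>u - gauss\<close> is the Gaussian times \<open>|g - g0|\<^sup>2 + 2 Re(cnj g0 (g - g0))\<close> because \<open>|g0| = 1\<close>.  The linear
  term integrates to 0 against the radial weight, so the integral of a nonnegative multiple of
  \<open>|g - g0|\<^sup>2\<close> is at most 0 and \<open>g\<close> is constant near 0.\<close>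

lemma peaked_constant: "f z = f 0" "norm (f 0) = 1"
proof -
  have f0: "norm (f 0) powr p = 1" using peak by (simp add: u_eq)
  then have "f 0 \<noteq> 0" by auto
  have nf0: "norm (f 0) = 1"
  proof -
    have "ln (norm (f 0) powr p) = 0" using f0 by simp
    then show ?thesis using \<open>f 0 \<noteq> 0\<close> p by (simp add: ln_powr)
  qed
  show "norm (f 0) = 1" by (rule nf0)
  have "0 \<in> {z. f z \<noteq> 0}" using \<open>f 0 \<noteq> 0\<close> by simp
  with open_nz obtain r where r: "0 < r" "ball 0 r \<subseteq> {z. f z \<noteq> 0}"
    by (meson open_contains_ball)
  define U where "U = ball (0::complex) r"
  have oU: "open U" by (simp add: U_def)
  have "f holomorphic_on U" using holomorphic_on_subset[OF holo] by blast
  moreover have "contractible U" unfolding U_def by (intro convex_imp_contractible convex_ball)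
  moreover have "f z \<noteq> 0" if "z \<in> U" for z using that r(2) by (auto simp: U_def)
  ultimately obtain L where L: "L holomorphic_on U" "\<And>z. z \<in> U \<Longrightarrow> f z = exp (L z)"
    by (rule contractible_imp_holomorphic_log) (assumption | rule that)+
  define g where "g = (\<lambda>z. exp (complex_of_real (p / 2) * L z))"
  have hg: "g holomorphic_on U" unfolding g_def by (intro holomorphic_intros L)
  have ng: "(norm (g z))\<^sup>2 = norm (f z) powr p" if "z \<in> U" for z
    using L(2)[OF that] by (simp add: g_def powr_def power2_eq_square exp_add[symmetric])
  have cg: "continuous_on U g" using hg by (rule holomorphic_on_imp_continuous_on)
  define g0 where "g0 = g 0"
  have g0: "(norm g0)\<^sup>2 = 1" using ng[of 0] f0 r(1) by (simp add: g0_def U_def)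
  \<comment> \<open>a multiple of the divided difference of \<open>g\<close> at 0, so that \<open>z Q(z)\<close> is the linear term of the expansion of \<open>|g|\<^sup>2\<close> about \<open>g0\<close>\<close>
  define Q where "Q = (\<lambda>z. cnj g0 * (if z = 0 then deriv g 0 else (g z - g 0) / (z - 0)))"
  have hQ: "Q holomorphic_on ball 0 r"
    unfolding Q_def using pole_lemma_open[OF hg oU, of 0] unfolding U_def by (intro holomorphic_intros)
  have zQ: "z * Q z = cnj g0 * (g z - g0)" for z by (simp add: Q_def g0_def)
  define s where "s = gauss \<alpha> p (complex_of_real (r / 2))"
  have gauss_s: "gauss \<alpha> p z \<le> s \<longleftrightarrow> r / 2 \<le> norm z" for z
  proof -
    have "gauss \<alpha> p z \<le> s \<longleftrightarrow> (r / 2)\<^sup>2 \<le> (norm z)\<^sup>2"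
      using \<alpha> p r(1) by (simp add: s_def gauss_def)
    also have "\<dots> \<longleftrightarrow> r / 2 \<le> norm z" using r(1) abs_le_square_iff[of "r / 2" "norm z"] by simp
    finally show ?thesis .
  qed
  have s: "0 \<le> s" "s < 1" using \<alpha> p r(1) gauss_pos by (auto simp: s_def gauss_def)
  define W where "W = (\<lambda>z. \<Phi> s (gauss \<alpha> p z))"
  define V where "V = (\<lambda>z. 2 * max 0 (gauss \<alpha> p z - s) * (- (p * \<alpha>) * gauss \<alpha> p z))"
  have cW: "continuous_on UNIV W" "continuous_on UNIV V"
    unfolding W_def V_def \<Phi>_def by (intro continuous_intros gauss_continuous)+
  have WV0: "W z = 0" "V z = 0" if "r / 2 \<le> norm z" for z
    using that unfolding gauss_s[symmetric] by (simp_all add: W_def V_def \<Phi>_def)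
  have d\<Phi>: "((\<lambda>t. \<Phi> s (h t)) has_real_derivative 2 * max 0 (h t - s) * h') (at t)"
    if "(h has_real_derivative h') (at t)" for h h' t
    unfolding \<Phi>_def
    by (rule DERIV_chain2[OF has_real_derivative_pos_part_square]) (rule DERIV_cong[OF DERIV_diff[OF that DERIV_const]], simp)
  have gauss_sq: "gauss \<alpha> p z = exp (- (p * \<alpha> / 2) * ((Re z)\<^sup>2 + (Im z)\<^sup>2))" for z by (simp add: gauss_def cmod_power2)
  have dWx: "((\<lambda>t. W (Complex t y)) has_real_derivative V (Complex x y) * x) (at x)" for x y
  proof -
    have "((\<lambda>t. gauss \<alpha> p (Complex t y)) has_real_derivative - (p * \<alpha>) * gauss \<alpha> p (Complex x y) * x) (at x)"
      unfolding gauss_sq complex.sel by (rule derivative_eq_intros refl | simp)+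
    from d\<Phi>[OF this] show ?thesis unfolding W_def V_def by (rule DERIV_cong) simp
  qed
  have dWy: "((\<lambda>t. W (Complex x t)) has_real_derivative V (Complex x y) * y) (at y)" for x y
  proof -
    have "((\<lambda>t. gauss \<alpha> p (Complex x t)) has_real_derivative - (p * \<alpha>) * gauss \<alpha> p (Complex x y) * y) (at y)"
      unfolding gauss_sq complex.sel by (rule derivative_eq_intros refl | simp)+
    from d\<Phi>[OF this] show ?thesis unfolding W_def V_def by (rule DERIV_cong) simp
  qed
  have r2: "0 < r / 2" "r / 2 < r" using r by auto
  note I0 = integral_radial_weight_holomorphic_eq_0[OF hQ r2 cW WV0 dWx dWy]
  define E where "E = zero_ext U (\<lambda>z. 2 * max 0 (gauss \<alpha> p z - s) * gauss \<alpha> p z * (norm (g z - g0))\<^sup>2)"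
  have cE: "continuous_on UNIV E"
    unfolding E_def
  proof (rule continuous_on_zero_ext[OF oU])
    show "open (- cball (0::complex) (r / 2))" "U \<union> - cball 0 (r / 2) = UNIV" using r2 by (auto simp: U_def)
    show "2 * max 0 (gauss \<alpha> p z - s) * gauss \<alpha> p z * (norm (g z - g0))\<^sup>2 = 0" if "z \<in> - cball 0 (r / 2)" for z
      using that gauss_s[of z] by simp
  qed (intro continuous_intros gauss_continuous cg)
  have E0: "E z = 0" if "r \<le> norm z" for z using that by (simp add: E_def zero_ext_def U_def)
  have intE: "integrable lborel E" by (rule plane_integral_eq_iterated(1)[OF cE r(1) E0])
  have E_nn: "0 \<le> E z" for z using gauss_pos[of \<alpha> p z] by (simp add: E_def zero_ext_def)
  have expand: "E z \<le> \<Phi> s (u z) - \<Phi> s (gauss \<alpha> p z) + 2 / (p * \<alpha>) * zero_ext (ball 0 r) (\<lambda>z. V z * Re (z * Q z)) z" for z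
  proof -
    define b where "b = max 0 (gauss \<alpha> p z - s)"
    \<comment> \<open>convexity of \<open>\<Phi>\<close>: the graph lies above its tangent at the value of the Gaussian\<close>
    have tangent: "2 * b * (u z - gauss \<alpha> p z) \<le> \<Phi> s (u z) - \<Phi> s (gauss \<alpha> p z)"
    proof -
      define a where "a = max 0 (u z - s)"
      have b: "0 \<le> b" "b * (gauss \<alpha> p z - s) = b\<^sup>2" by (auto simp: b_def max_def power2_eq_square)
      have "b * (u z - s) \<le> b * a" using b(1) by (intro mult_left_mono) (auto simp: a_def)
      then have "2 * b * (u z - gauss \<alpha> p z) \<le> 2 * (b * a) - 2 * b\<^sup>2" using b(2) by (simp add: algebra_simps)
      also have "\<dots> \<le> a\<^sup>2 - b\<^sup>2" using sum_squares_ge_zero[of "a - b" 0] by (simp add: power2_eq_square algebra_simps)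
      finally show ?thesis by (simp add: \<Phi>_def a_def b_def)
    qed
    show ?thesis
    proof (cases "z \<in> U")
      case True
      have uz: "u z = gauss \<alpha> p z * (norm (g z))\<^sup>2"
        unfolding u_eq ng[OF True] by (simp add: gauss_def)
      have factor: "k * (1 + 2 * R + Y) - k = k * (2 * R + Y)" for k R Y :: real by (simp add: algebra_simps)
      have eq: "(norm (g z))\<^sup>2 = 1 + 2 * Re (cnj g0 * (g z - g0)) + (norm (g z - g0))\<^sup>2"
        using g0 unfolding cmod_power2 by (simp add: power2_eq_square algebra_simps)
      have "u z - gauss \<alpha> p z = gauss \<alpha> p z * (2 * Re (z * Q z) + (norm (g z - g0))\<^sup>2)"
        unfolding uz zQ eq by (rule factor)
      moreover have "E z = 2 * b * gauss \<alpha> p z * (norm (g z - g0))\<^sup>2"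
        "V z = 2 * b * (- (p * \<alpha>) * gauss \<alpha> p z)"
        using True by (simp_all add: E_def zero_ext_def V_def b_def)
      moreover have "2 * b * (k * (2 * R + Y)) = 2 * b * k * Y - 2 / (p * \<alpha>) * (2 * b * (- (p * \<alpha>) * k) * R)"
        for k R Y using \<alpha> p by (simp add: algebra_simps)
      ultimately have "2 * b * (u z - gauss \<alpha> p z) = E z - 2 / (p * \<alpha>) * (V z * Re (z * Q z))"
        by (simp only:)
      then show ?thesis using tangent True by (simp add: zero_ext_def U_def)
    next
      case False
      then have "b = 0" using gauss_s[of z] r by (simp add: b_def U_def)
      then show ?thesis using tangent False by (simp add: E_def zero_ext_def U_def)
    qed
  qed
  have "(LINT z|lborel. E z) \<le> (LINT z|lborel. \<Phi> s (u z) - \<Phi> s (gauss \<alpha> p z)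
       + 2 / (p * \<alpha>) * zero_ext (ball 0 r) (\<lambda>z. V z * Re (z * Q z)) z)"
    using integral_\<Phi>_le[OF s] I0(1) intE expand by (intro integral_mono) auto
  also have "\<dots> = (LINT z|lborel. \<Phi> s (u z)) - (LINT z|lborel. \<Phi> s (gauss \<alpha> p z))"
    using integral_\<Phi>_le[OF s] I0 by simp
  also have "\<dots> \<le> 0" using integral_\<Phi>_le[OF s] by simp
  finally have Ez: "E z = 0" for z
    using continuous_nonneg_integral_le_0_imp_0[OF cE E_nn intE] by blast
  have "norm (f z) = norm (f 0)" if z: "z \<in> ball 0 (r / 2)" for z
  proof -
    have zU: "z \<in> U" and "s < gauss \<alpha> p z" using z r gauss_s[of z] by (auto simp: U_def)
    then have "g z = g0" using Ez[of z] gauss_pos[of \<alpha> p z] by (simp add: E_def zero_ext_def)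
    then have "norm (f z) powr p = 1" using ng[OF zU] g0 by simp
    moreover have "f z \<noteq> 0" using zU r(2) by (auto simp: U_def)
    ultimately have "ln (norm (f z)) = 0" using p ln_powr[of "norm (f z)" p] by simp
    then show ?thesis using \<open>f z \<noteq> 0\<close> nf0 by simp
  qed
  then show "f z = f 0" using norm_eq_of_open_ball_imp_constant[OF holo r2(1)] by blast
qed

end

section \<open>Convex functionals\<close>

text \<open>Let \<open>m\<close> be the slope of a supporting line of \<open>G\<close> at \<open>\<tau>\<close> and \<open>H t = G t - m t\<close>.  Then \<open>H\<close> has its minimum at
  \<open>\<tau>\<close>, so by convexity it decreases before \<open>\<tau>\<close> and increases afterwards; \<open>A\<close> collects the descent
  and \<open>B\<close> the ascent.  Clamping to \<open>[0, 1]\<close> makes both functions monotone and continuous on the whole line.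
  A convex ascent that is not zero is strict up to the right end point.\<close>

lemma convex_tangent_splitting:
  fixes G :: "real \<Rightarrow> real"
  assumes cG: "continuous_on {0..1} G" and conv: "convex_on {0..1} G" and G0: "G 0 = 0"
    and \<tau>: "0 < \<tau>" "\<tau> < 1"
  obtains m A B where "mono A" "continuous_on UNIV A" "A 0 = 0" "\<And>t. \<tau> \<le> t \<Longrightarrow> A t = A \<tau>"
    "mono B" "continuous_on UNIV B" "\<And>t. t \<le> \<tau> \<Longrightarrow> B t = 0"
    "\<And>t. 0 < B 1 \<Longrightarrow> t < 1 \<Longrightarrow> B t < B 1"
    "\<And>t. t \<in> {0..1} \<Longrightarrow> G t = m * t + B t - A t"
proof -
  define m where "m = Inf ((\<lambda>t. (G \<tau> - G t) / (\<tau> - t)) ` ({\<tau><..} \<inter> {0..1}))"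
  have "\<tau> \<in> interior {0..1}" using \<tau> by (simp add: interior_atLeastAtMost_real)
  then have sub: "G \<tau> + m * (y - \<tau>) \<le> G y" if "y \<in> {0..1}" for y
    unfolding m_def by (rule convex_le_Inf_differential[OF conv _ that])
  define H where "H = (\<lambda>t. G t - m * t)"
  have Hmin: "H \<tau> \<le> H t" if "t \<in> {0..1}" for t using sub[OF that] by (simp add: H_def algebra_simps)
  have Hcomb: "H ((1 - l) * x + l * y) \<le> (1 - l) * H x + l * H y"
    if "x \<in> {0..1}" "y \<in> {0..1}" "0 \<le> l" "l \<le> 1" for l x y
    using convex_onD[OF conv, of l x y] that by (simp add: H_def algebra_simps)
  have Htau: "H z \<le> (1 - l) * H x + l * H \<tau>" if "x \<in> {0..1}" "0 \<le> l" "l \<le> 1" "z = (1 - l) * x + l * \<tau>" for l x z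
    using Hcomb[of x \<tau> l] that \<tau> by simp
  have Hto: "H z \<le> H x" if x: "x \<in> {0..1}" and z: "x \<le> z \<and> z \<le> \<tau> \<or> \<tau> \<le> z \<and> z \<le> x" for x z
  proof (cases "x = \<tau>")
    case False
    \<comment> \<open>a point between \<open>x\<close> and \<open>\<tau>\<close> is their convex combination with weight \<open>l\<close>\<close>
    define l where "l = (z - x) / (\<tau> - x)"
    have l: "0 \<le> l" "l \<le> 1" using z False by (auto simp: l_def field_simps)
    have "z = (1 - l) * x + l * \<tau>"
    proof -
      have "l * (\<tau> - x) = z - x" using False by (simp add: l_def)
      then show ?thesis by (simp add: algebra_simps)
    qed
    from Htau[OF x l this] have "H z \<le> (1 - l) * H x + l * H \<tau>" .
    also have "\<dots> \<le> (1 - l) * H x + l * H x" using l Hmin[OF x] by (intro add_left_mono mult_left_mono) auto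
    finally show ?thesis by (simp add: algebra_simps)
  qed (use z in auto)
  define cl :: "real \<Rightarrow> real" where "cl = (\<lambda>t. max 0 (min 1 t))"
  define A where "A = (\<lambda>t. - H (min (cl t) \<tau>))"
  define B where "B = (\<lambda>t. H (max (cl t) \<tau>) - H \<tau>)"
  have cH: "continuous_on {0..1} H" unfolding H_def by (intro continuous_intros cG)
  have ccl: "continuous_on UNIV cl" unfolding cl_def by (intro continuous_intros)
  have rng: "min (cl t) \<tau> \<in> {0..1}" "max (cl t) \<tau> \<in> {0..1}" for t using \<tau> by (auto simp: cl_def)
  have cA: "continuous_on UNIV A"
    unfolding A_def using rng by (intro continuous_intros continuous_on_compose2[OF cH] ccl) auto
  have cB: "continuous_on UNIV B"
    unfolding B_def using rng by (intro continuous_intros continuous_on_compose2[OF cH] ccl) auto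
  have clm: "cl x \<le> cl y" if "x \<le> y" for x y using that by (auto simp: cl_def)
  have mA: "mono A"
  proof (rule monoI)
    fix x y :: real assume "x \<le> y"
    then show "A x \<le> A y" unfolding A_def using Hto[OF rng(1)[of x], of "min (cl y) \<tau>"] clm[of x y] by (simp add: min_def)
  qed
  have mB: "mono B"
  proof (rule monoI)
    fix x y :: real assume "x \<le> y"
    then show "B x \<le> B y" unfolding B_def using Hto[OF rng(2)[of y], of "max (cl x) \<tau>"] clm[of x y] by (simp add: max_def)
  qed
  show ?thesis
  proof (rule that[OF mA cA _ _ mB cB])
    show "A 0 = 0" using \<tau> by (simp add: A_def cl_def H_def G0)
    show "A t = A \<tau>" if "\<tau> \<le> t" for t using that \<tau> by (simp add: A_def cl_def min_def max_def)
    show "B t = 0" if "t \<le> \<tau>" for t using that \<tau> by (simp add: B_def cl_def min_def max_def)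
    show "G t = m * t + B t - A t" if "t \<in> {0..1}" for t
      using that by (cases "t \<le> \<tau>") (auto simp: A_def B_def cl_def H_def)
    show "B t < B 1" if "0 < B 1" "t < 1" for t
    proof (cases "t \<le> \<tau>")
      case True
      then have "B t = 0" using \<tau> by (simp add: B_def cl_def min_def max_def)
      then show ?thesis using that by simp
    next
      case False
      define l where "l = (1 - t) / (1 - \<tau>)"
      have l: "0 < l" "l \<le> 1" using False that \<tau> by (auto simp: l_def field_simps)
      have "t = (1 - l) * 1 + l * \<tau>"
      proof -
        have "l * (1 - \<tau>) = 1 - t" using \<tau> by (simp add: l_def)
        then show ?thesis by (simp add: algebra_simps)
      qed
      from Htau[OF _ _ l(2) this] l have "H t \<le> (1 - l) * H 1 + l * H \<tau>" by simp
      then have "H t - H \<tau> \<le> (1 - l) * (H 1 - H \<tau>)" by (simp add: algebra_simps)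
      also have "\<dots> < H 1 - H \<tau>" using l that(1) \<tau> by (simp add: B_def cl_def algebra_simps)
      finally show ?thesis using False that \<tau> by (simp add: B_def cl_def)
    qed
  qed
qed

text \<open>Since \<open>A\<close> is nonnegative, the positive part of \<open>g\<close> is dominated by that of the integrable function \<open>k\<close>,
  so the difference has a meaning even when the integral of \<open>A\<close> is infinite.\<close>

lemma extended_integral_diff:
  fixes k A g :: "'a \<Rightarrow> real"
  assumes k: "integrable M k" and [measurable]: "A \<in> borel_measurable M" and A: "\<And>x. 0 \<le> A x"
    and g: "\<And>x. g x = k x - A x"
  shows "enn2ereal (\<integral>\<^sup>+x. ennreal (max 0 (g x)) \<partial>M) - enn2ereal (\<integral>\<^sup>+x. ennreal (max 0 (- g x)) \<partial>M)
    = ereal (LINT x|M. k x) - enn2ereal (\<integral>\<^sup>+x. ennreal (A x) \<partial>M)"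
proof -
  have [measurable]: "k \<in> borel_measurable M" "g \<in> borel_measurable M"
    using k by (auto simp: g[abs_def])
  define P N a where "P = (\<integral>\<^sup>+x. ennreal (max 0 (g x)) \<partial>M)"
    and "N = (\<integral>\<^sup>+x. ennreal (max 0 (- g x)) \<partial>M)" and "a = (\<integral>\<^sup>+x. ennreal (A x) \<partial>M)"
  have ik: "integrable M (\<lambda>x. max 0 (k x))" "integrable M (\<lambda>x. max 0 (- k x))"
    using k by (auto intro!: integrable_max)
  define kp kn where "kp = (LINT x|M. max 0 (k x))" and "kn = (LINT x|M. max 0 (- k x))"
  have kpn: "0 \<le> kp" "0 \<le> kn" by (simp_all add: kp_def kn_def Bochner_Integration.integral_nonneg)
  have Kp: "(\<integral>\<^sup>+x. ennreal (max 0 (k x)) \<partial>M) = ennreal kp" "(\<integral>\<^sup>+x. ennreal (max 0 (- k x)) \<partial>M) = ennreal kn"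
    using ik by (auto simp: kp_def kn_def nn_integral_eq_integral)
  have k_eq: "(LINT x|M. k x) = kp - kn"
    unfolding kp_def kn_def Bochner_Integration.integral_diff[OF ik, symmetric]
    by (intro Bochner_Integration.integral_cong) (auto simp: max_def)
  have "(\<integral>\<^sup>+x. ennreal (max 0 (g x)) + ennreal (A x) + ennreal (max 0 (- k x)) \<partial>M)
     = (\<integral>\<^sup>+x. ennreal (max 0 (- g x)) + ennreal (max 0 (k x)) \<partial>M)"
  proof (rule nn_integral_cong)
    fix x
    have "max 0 (g x) + A x + max 0 (- k x) = max 0 (- g x) + max 0 (k x)" by (simp add: g max_def)
    then show "ennreal (max 0 (g x)) + ennreal (A x) + ennreal (max 0 (- k x))
        = ennreal (max 0 (- g x)) + ennreal (max 0 (k x))"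
      using A[of x] by (simp flip: ennreal_plus)
  qed
  then have eq: "P + a + ennreal kn = N + ennreal kp"
    by (simp add: nn_integral_add Kp P_def N_def a_def)
  have "P \<le> ennreal kp"
    unfolding P_def Kp(1)[symmetric] g
    by (intro nn_integral_mono ennreal_leI max.mono) (use A in auto)
  then obtain P' where P': "P = ennreal P'" "0 \<le> P'" by (cases P) (auto simp: top_unique)
  show ?thesis
  proof (cases a)
    case (real a')
    then have "N + ennreal kp = ennreal (P' + a' + kn)"
      using eq P' kpn by (simp add: ennreal_plus)
    then obtain N' where N': "N = ennreal N'" "0 \<le> N'" by (cases N) auto
    then have "P' + a' + kn = N' + kp"
      using eq real P' kpn by (simp flip: ennreal_plus)
    then show ?thesis unfolding P_def[symmetric] N_def[symmetric] a_def[symmetric] k_eq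
      using real P' N' by (simp add: enn2ereal_ennreal)
  next
    case top
    then have "N + ennreal kp = top" using eq by simp
    then have "N = top" by (simp add: ennreal_add_eq_top)
    then show ?thesis unfolding P_def[symmetric] N_def[symmetric] a_def[symmetric]
      using top P' by (simp add: enn2ereal_ennreal)
  qed
qed

definition gauss_functional :: "(real \<Rightarrow> real) \<Rightarrow> real \<Rightarrow> real \<Rightarrow> ereal" where
  "gauss_functional G \<alpha> p =
     enn2ereal (\<integral>\<^sup>+ z. ennreal (max 0 (G (gauss \<alpha> p z))) \<partial>lborel)
   - enn2ereal (\<integral>\<^sup>+ z. ennreal (max 0 (- G (gauss \<alpha> p z))) \<partial>lborel)"

context normalized_weight begin

lemma nn_integral_u: "(\<integral>\<^sup>+z. ennreal (u z) \<partial>lborel) = ennreal (2 * pi / (p * \<alpha>))"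
  using nn_integral_eq_integral[OF int] u_nonneg norm1 by simp

text \<open>The difference \<open>\<mu>(t) + c ln t\<close> of the two level measures is nonincreasing below the maximum of \<open>u\<close> and
  negative between the maximum and 1.  It must be positive somewhere, as otherwise the integral of \<open>u\<close>
  would be smaller than that of the Gaussian; \<open>\<tau>\<close> is the supremum of the heights where it is positive.\<close>

lemma level_crossing:
  assumes a: "\<And>z. u z \<le> u a" and lt: "u a < 1"
  obtains \<tau> where "0 < \<tau>" "\<tau> < 1"
    "\<And>t. 0 < t \<Longrightarrow> t < \<tau> \<Longrightarrow> emeasure lborel {z. t < gauss \<alpha> p z} < emeasure lborel {z. t < u z}"
    "\<And>t. \<tau> < t \<Longrightarrow> t < 1 \<Longrightarrow> emeasure lborel {z. t < u z} \<le> emeasure lborel {z. t < gauss \<alpha> p z}"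
    "\<And>t. u a \<le> t \<Longrightarrow> t < 1 \<Longrightarrow> emeasure lborel {z. t < u z} < emeasure lborel {z. t < gauss \<alpha> p z}"
proof -
  define c where "c = 2 * pi / (p * \<alpha>)"
  have c: "0 < c" using p \<alpha> by (simp add: c_def)
  have G: "emeasure lborel {z. t < gauss \<alpha> p z} = ennreal (c * (- ln t))" if "0 < t" for t
    unfolding c_def by (rule gauss_level[OF \<alpha> p that])
  have U: "emeasure lborel {z. t < u z} = ennreal (\<mu> t)" if "0 < t" for t by (rule emeasure_level[OF that])
  have ua: "0 < u a"
  proof (rule ccontr)
    assume "\<not> 0 < u a"
    then have "u = (\<lambda>z. 0)" using a u_nonneg by (intro ext) (metis order_antisym order_trans not_less)
    then show False using norm1 p \<alpha> by simp
  qed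
  have above: "emeasure lborel {z. t < u z} < emeasure lborel {z. t < gauss \<alpha> p z}" if t: "u a \<le> t" "t < 1" for t
  proof -
    have "\<not> t < u z" for z using a[of z] t by linarith
    then have "{z. t < u z} = {}" by simp
    moreover have "0 < c * (- ln t)" using c t ua by (intro mult_pos_pos) auto
    ultimately show ?thesis using G[of t] ua t by (simp add: ennreal_zero_less_mult_iff)
  qed
  define P where "P = {t. 0 < t \<and> t < u a \<and> c * (- ln t) < \<mu> t}"
  have down: "c * (- ln s) < \<mu> s" if "0 < s" "s \<le> t" "t \<in> P" for s t
  proof -
    have "c * (ln t - ln s) \<le> \<mu> s - \<mu> t"
      unfolding c_def using that by (intro level_measure_decay[OF int]) (auto simp: P_def)
    then show ?thesis using that by (simp add: P_def algebra_simps)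
  qed
  have "P \<noteq> {}"
  proof
    assume "P = {}"
    then have le: "\<mu> t \<le> c * (- ln t)" if "0 < t" "t < u a" for t using that by (force simp: P_def)
    have "(\<integral>\<^sup>+z. ennreal (u z) \<partial>lborel) < (\<integral>\<^sup>+z. ennreal (gauss \<alpha> p z) \<partial>lborel)"
    proof (rule nn_integral_less_of_superlevels)
      show "0 \<le> u a" "u a < 1" using ua lt by auto
      show "emeasure lborel {z. t < u z} < emeasure lborel {z. t < gauss \<alpha> p z}" if "u a < t" "t < 1" for t
        using above that by simp
      show "emeasure lborel {z. t < u z} \<le> emeasure lborel {z. t < gauss \<alpha> p z}" if t: "0 < t" for t
      proof (cases "t < u a")
        case True
        then show ?thesis using le[OF t True] G[OF t] U[OF t] by (simp add: ennreal_leI)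
      next
        case False
        then have "\<not> t < u z" for z using a[of z] by linarith
        then show ?thesis by simp
      qed
    qed (use nn_integral_u in auto)
    then show False unfolding nn_integral_u nn_integral_gauss[OF \<alpha> p] by simp
  qed
  define \<tau> where "\<tau> = Sup P"
  have bdd: "bdd_above P" by (auto simp: P_def intro!: bdd_aboveI[of _ "u a"])
  have \<tau>: "0 < \<tau>" "\<tau> \<le> u a"
  proof -
    obtain t where "t \<in> P" using \<open>P \<noteq> {}\<close> by blast
    then show "0 < \<tau>" unfolding \<tau>_def using cSup_upper[OF _ bdd, of t] by (force simp: P_def)
    show "\<tau> \<le> u a" unfolding \<tau>_def using \<open>P \<noteq> {}\<close> by (intro cSup_least) (auto simp: P_def)
  qed
  show ?thesis
  proof (rule that[of \<tau>])
    show "0 < \<tau>" "\<tau> < 1" using \<tau> lt by auto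
    show "emeasure lborel {z. t < gauss \<alpha> p z} < emeasure lborel {z. t < u z}" if t: "0 < t" "t < \<tau>" for t
    proof -
      obtain t' where "t' \<in> P" "t < t'" using t(2) less_cSupD[OF \<open>P \<noteq> {}\<close>] unfolding \<tau>_def by blast
      then have "c * (- ln t) < \<mu> t" using down[of t t'] t by simp
      moreover have "0 \<le> \<mu> t" unfolding \<mu>_def by (rule measure_nonneg)
      moreover have "0 \<le> c * (- ln t)" using c t \<tau> lt by (intro mult_nonneg_nonneg) auto
      ultimately show ?thesis unfolding G[OF t(1)] U[OF t(1)] by (simp add: ennreal_less_iff)
    qed
    show "emeasure lborel {z. t < u z} < emeasure lborel {z. t < gauss \<alpha> p z}" if "u a \<le> t" "t < 1" for t
      using above that by simp
    then show "emeasure lborel {z. t < u z} \<le> emeasure lborel {z. t < gauss \<alpha> p z}" if t: "\<tau> < t" "t < 1" for t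
    proof (cases "t < u a")
      case True
      have "t \<notin> P" using cSup_upper[OF _ bdd, of t] t by (auto simp: \<tau>_def)
      then have "\<mu> t \<le> c * (- ln t)" using True t \<tau> by (force simp: P_def)
      then show ?thesis using G[of t] U[of t] t \<tau> by (simp add: ennreal_leI)
    next
      case False
      then show ?thesis using above[of t] t by simp
    qed
  qed
qed

text \<open>With the splitting of \<open>G\<close> at the crossing height, the value of the functional is a constant plus the
  integral of \<open>B\<close> minus the integral of \<open>A\<close>.  The function \<open>A\<close> varies only below \<open>\<tau>\<close>, where \<open>u\<close> has the
  larger superlevel sets, and \<open>B\<close> only above \<open>\<tau>\<close>, where the Gaussian has them.  Equality with a finite
  value forces \<open>A\<close> to vanish up to \<open>\<tau>\<close>, since there the comparison is strict, and \<open>B\<close> to vanish at 1,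
  since a nonzero ascent is still increasing between the maximum of \<open>u\<close> and 1.\<close>

lemma functional_le_gauss:
  fixes G :: "real \<Rightarrow> real"
  assumes G: "continuous_on {0..1} G" "convex_on {0..1} G" "G 0 = 0"
    and a: "\<And>z. u z \<le> u a" and lt: "u a < 1"
  shows "fock_functional G \<alpha> p f \<le> gauss_functional G \<alpha> p"
    and "\<not> (\<exists>c. \<forall>t\<in>{0..1}. G t = c * t) \<Longrightarrow> gauss_functional G \<alpha> p > -\<infinity> \<Longrightarrow>
      fock_functional G \<alpha> p f \<noteq> gauss_functional G \<alpha> p"
proof -
  obtain \<tau> where \<tau>: "0 < \<tau>" "\<tau> < 1"
    and low: "\<And>t. 0 < t \<Longrightarrow> t < \<tau> \<Longrightarrow> emeasure lborel {z. t < gauss \<alpha> p z} < emeasure lborel {z. t < u z}"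
    and high: "\<And>t. \<tau> < t \<Longrightarrow> t < 1 \<Longrightarrow> emeasure lborel {z. t < u z} \<le> emeasure lborel {z. t < gauss \<alpha> p z}"
    and top: "\<And>t. u a \<le> t \<Longrightarrow> t < 1 \<Longrightarrow> emeasure lborel {z. t < u z} < emeasure lborel {z. t < gauss \<alpha> p z}"
    by (rule level_crossing[OF a lt]) (rule that)
  obtain m A B where mA: "mono A" and cA: "continuous_on UNIV A" and A0: "A 0 = 0" and A\<tau>: "\<And>t. \<tau> \<le> t \<Longrightarrow> A t = A \<tau>"
    and mB: "mono B" and cB: "continuous_on UNIV B" and B0: "\<And>t. t \<le> \<tau> \<Longrightarrow> B t = 0"
    and Bs: "\<And>t. 0 < B 1 \<Longrightarrow> t < 1 \<Longrightarrow> B t < B 1"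
    and split: "\<And>t. t \<in> {0..1} \<Longrightarrow> G t = m * t + B t - A t"
    by (rule convex_tangent_splitting[OF G \<tau>]) (rule that)
  have [measurable]: "A \<in> borel_measurable borel" "B \<in> borel_measurable borel"
    using cA cB by (auto intro: borel_measurable_continuous_onI)
  have u01: "0 \<le> u z" "u z \<le> 1" for z using u_nonneg u_le_1 by auto
  have g01: "0 \<le> gauss \<alpha> p z" "gauss \<alpha> p z \<le> 1" for z using gauss_pos[of \<alpha> p z] gauss_le_1[OF \<alpha> p] by auto
  have Ann: "0 \<le> A t" if "0 \<le> t" for t using monoD[OF mA that] A0 by simp
  have Bnn: "0 \<le> B t" for t using monoD[OF mB, of "min t \<tau>" t] B0[of "min t \<tau>"] by simp
  \<comment> \<open>\<open>B\<close> vanishes up to \<open>\<tau>\<close>, so it is dominated by a linear function and is integrable along \<open>u\<close>\<close>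
  have Ble: "B t \<le> B 1 / \<tau> * t" if "0 \<le> t" "t \<le> 1" for t
  proof (cases "t \<le> \<tau>")
    case True
    then show ?thesis using B0 Bnn[of 1] \<tau> that by simp
  next
    case False
    have "B t \<le> B 1" using monoD[OF mB that(2)] .
    also have "\<dots> \<le> B 1 / \<tau> * t" using False \<tau> mult_left_mono[OF _ Bnn[of 1], of \<tau> t] by (simp add: field_simps)
    finally show ?thesis .
  qed
  have iB: "integrable lborel (\<lambda>z. B (h z))"
    if [measurable]: "h \<in> borel_measurable borel" and h: "integrable lborel h" "\<And>z. 0 \<le> h z" "\<And>z. h z \<le> 1" for h :: "complex \<Rightarrow> real"
  proof (rule Bochner_Integration.integrable_bound)
    show "integrable lborel (\<lambda>z. B 1 / \<tau> * h z)" using h by simp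
    show "AE z in lborel. norm (B (h z)) \<le> norm (B 1 / \<tau> * h z)"
    proof (rule AE_I2)
      fix z
      show "norm (B (h z)) \<le> norm (B 1 / \<tau> * h z)"
        unfolding real_norm_def using Ble[OF h(2,3), of z] Bnn[of "h z"] by linarith
    qed
  qed measurable
  have iBu: "integrable lborel (\<lambda>z. B (u z))" using iB[OF u_measurable int u01] .
  have iBg: "integrable lborel (\<lambda>z. B (gauss \<alpha> p z))" using iB[OF gauss_measurable integrable_gauss(1)[OF \<alpha> p] g01] .
  define c where "c = 2 * pi / (p * \<alpha>)"
  define bu bg where "bu = (LINT z|lborel. B (u z))" and "bg = (LINT z|lborel. B (gauss \<alpha> p z))"
  define Au Ag where "Au = (\<integral>\<^sup>+z. ennreal (A (u z)) \<partial>lborel)" and "Ag = (\<integral>\<^sup>+z. ennreal (A (gauss \<alpha> p z)) \<partial>lborel)"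
  have Fu: "fock_functional G \<alpha> p f = ereal (m * c + bu) - enn2ereal Au"
  proof -
    have "fock_functional G \<alpha> p f = ereal (LINT z|lborel. m * u z + B (u z)) - enn2ereal (\<integral>\<^sup>+z. ennreal (A (u z)) \<partial>lborel)"
      unfolding fock_functional_def
      by (rule extended_integral_diff) (use int iBu u01 split Ann in auto)
    then show ?thesis using int iBu norm1 by (simp add: c_def bu_def Au_def)
  qed
  have Fg: "gauss_functional G \<alpha> p = ereal (m * c + bg) - enn2ereal Ag"
  proof -
    have "gauss_functional G \<alpha> p = ereal (LINT z|lborel. m * gauss \<alpha> p z + B (gauss \<alpha> p z))
        - enn2ereal (\<integral>\<^sup>+z. ennreal (A (gauss \<alpha> p z)) \<partial>lborel)"
      unfolding gauss_functional_def
      by (rule extended_integral_diff) (use integrable_gauss[OF \<alpha> p] iBg g01 split Ann in auto)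
    then show ?thesis using integrable_gauss[OF \<alpha> p] iBg by (simp add: c_def bg_def Ag_def)
  qed
  have A1: "A 1 = A \<tau>" using A\<tau>[of 1] \<tau> by simp
  have A_level: "t < \<tau>" if "A t < A 1" for t using A\<tau>[of t] A1 that by force
  have B_level: "\<tau> < t" if "0 < B t" for t using B0[of t] that by force
  have nnB: "(\<integral>\<^sup>+z. ennreal (B (u z)) \<partial>lborel) = ennreal bu" "(\<integral>\<^sup>+z. ennreal (B (gauss \<alpha> p z)) \<partial>lborel) = ennreal bg"
    "0 \<le> bu" "0 \<le> bg"
    using iBu iBg Bnn by (auto simp: bu_def bg_def nn_integral_eq_integral Bochner_Integration.integral_nonneg)
  have low_le: "emeasure lborel {z. t < gauss \<alpha> p z} \<le> emeasure lborel {z. t < u z}"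
    if "0 < t" "A t < A 1" for t
    using low[OF that(1) A_level[OF that(2)]] by (rule less_imp_le)
  have AA: "Ag \<le> Au"
    unfolding Ag_def Au_def
    by (rule nn_integral_compose_le[OF mA cA A0]) (use low_le g01 in auto)
  have "ennreal bu \<le> ennreal bg"
    unfolding nnB(1,2)[symmetric]
    by (rule nn_integral_compose_le[OF mB cB]) (use B_level high u01 B0[of 0] \<tau> in auto)
  then have BB: "bu \<le> bg" using nnB by simp
  show "fock_functional G \<alpha> p f \<le> gauss_functional G \<alpha> p"
    unfolding Fu Fg using AA BB by (intro ereal_minus_mono) (auto simp: less_eq_ennreal.rep_eq)
  show "fock_functional G \<alpha> p f \<noteq> gauss_functional G \<alpha> p"
    if nl: "\<not> (\<exists>c. \<forall>t\<in>{0..1}. G t = c * t)" and fin: "gauss_functional G \<alpha> p > -\<infinity>"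
  proof
    assume eq: "fock_functional G \<alpha> p f = gauss_functional G \<alpha> p"
    obtain ag where ag: "Ag = ennreal ag" "0 \<le> ag"
      using fin unfolding Fg by (cases Ag) auto
    obtain au where au: "Au = ennreal au" "0 \<le> au"
      using fin eq unfolding Fg[symmetric] Fu by (cases Au) auto
    have "m * c + bu - au = m * c + bg - ag"
      using eq unfolding Fu Fg ag au using ag(2) au(2) by (simp add: enn2ereal_ennreal)
    moreover have "ag \<le> au" using AA ag au by simp
    ultimately have eqs: "bu = bg" "ag = au" using BB by auto
    have "A \<tau> = 0"
    proof (rule ccontr)
      assume "A \<tau> \<noteq> 0"
      then have "0 < A 1" using Ann[of \<tau>] \<tau> A1 by simp
      have "Ag < Au"
        unfolding Ag_def Au_def
        by (rule nn_integral_compose_less[OF mA cA A0 _ _ _ _ order_refl \<open>0 < A 1\<close>])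
          (use A_level low low_le g01 ag in \<open>auto simp: Ag_def\<close>)
      then show False using eqs ag au by simp
    qed
    moreover have "B 1 = 0"
    proof (rule ccontr)
      assume "B 1 \<noteq> 0"
      then have B1: "0 < B 1" using Bnn[of 1] by simp
      have lev: "u a \<le> t" if "B (u a) < B t" for t
        using that monoD[OF mB, of t "u a"] by force
      have "ennreal bu < ennreal bg"
        unfolding nnB(1,2)[symmetric]
        by (rule nn_integral_compose_less[OF mB cB _ _ _ _ _ Bnn Bs[OF B1 lt]])
          (use B_level high u01 B0[of 0] \<tau> top lev nnB in auto)
      then show False using eqs by simp
    qed
    ultimately have "G t = m * t" if "t \<in> {0..1}" for t
    proof -
      have "A t = 0"
        using Ann[of t] monoD[OF mA, of t "max t \<tau>"] A\<tau>[of "max t \<tau>"] that \<open>A \<tau> = 0\<close> by simp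
      moreover have "B t = 0" using Bnn[of t] monoD[OF mB, of t 1] that \<open>B 1 = 0\<close> by simp
      ultimately show ?thesis using split[OF that] by simp
    qed
    then show False using nl by blast
  qed
qed

end

lemma fock_weighted_const: "norm c = 1 \<Longrightarrow> fock_weighted \<alpha> p (\<lambda>z. c) z = gauss \<alpha> p z"
  by (simp add: fock_weighted_def gauss_def norm_mult exp_powr_real algebra_simps)

lemma fock_translate_kernel: "fock_translate \<alpha> a (\<lambda>z. c * fock_kernel \<alpha> a z) = (\<lambda>z. c)"
proof
  fix z
  have sq: "complex_of_real (\<alpha> * (norm a)\<^sup>2 / 2) = complex_of_real \<alpha> * cnj a * a / 2"
    by (simp add: complex_norm_square mult_ac del: of_real_power)
  have "complex_of_real \<alpha> * cnj a * (a + z) - complex_of_real (\<alpha> * (norm a)\<^sup>2 / 2)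
      + (- complex_of_real \<alpha> * cnj a * z - complex_of_real (\<alpha> * (norm a)\<^sup>2 / 2)) = 0"
    unfolding sq by (simp add: algebra_simps)
  then show "fock_translate \<alpha> a (\<lambda>z. c * fock_kernel \<alpha> a z) z = c"
    unfolding fock_translate_def fock_kernel_def mult.assoc mult_exp_exp by simp
qed

lemma fock_translate_inj:
  assumes "fock_translate \<alpha> a f = fock_translate \<alpha> a g"
  shows "f = g"
proof
  fix z
  from fun_cong[OF assms, of "z - a"] show "f z = g z" by (simp add: fock_translate_def)
qed

lemma fock_weighted_kernel:
  assumes "norm c = 1"
  shows "fock_weighted \<alpha> p (\<lambda>z. c * fock_kernel \<alpha> a z) z = gauss \<alpha> p (- a + z)"
  using fock_translate_weighted[of \<alpha> p a "\<lambda>z. c * fock_kernel \<alpha> a z" "- a + z"]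
  by (simp add: fock_translate_kernel fock_weighted_const[OF assms])

lemma nn_integral_translate:
  fixes h :: "complex \<Rightarrow> ennreal"
  assumes "h \<in> borel_measurable borel"
  shows "(\<integral>\<^sup>+z. h (b + z) \<partial>lborel) = (\<integral>\<^sup>+z. h z \<partial>lborel)"
  using assms by (subst (2) lborel_distr_plus[of b, symmetric]) (simp add: nn_integral_distr)

lemma fock_functional_kernel:
  fixes G :: "real \<Rightarrow> real"
  assumes G: "continuous_on {0..1} G" and \<alpha>: "0 < \<alpha>" and p: "0 < p"
  shows "fock_functional G \<alpha> p (fock_kernel \<alpha> a) = gauss_functional G \<alpha> p"
proof -
  have "continuous_on UNIV (\<lambda>z. G (gauss \<alpha> p z))"
    using gauss_pos[of \<alpha> p] gauss_le_1[OF \<alpha> p]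
    by (intro continuous_on_compose2[OF G gauss_continuous]) (auto simp: less_imp_le)
  then have [measurable]: "(\<lambda>z. G (gauss \<alpha> p z)) \<in> borel_measurable borel"
    by (rule borel_measurable_continuous_onI)
  have "fock_weighted \<alpha> p (fock_kernel \<alpha> a) z = gauss \<alpha> p (- a + z)" for z
    using fock_weighted_kernel[of 1 \<alpha> p a z] by simp
  then show ?thesis
    unfolding fock_functional_def gauss_functional_def
    by (simp add: nn_integral_translate[of "\<lambda>z. ennreal (max 0 (G (gauss \<alpha> p z)))"]
        nn_integral_translate[of "\<lambda>z. ennreal (max 0 (- G (gauss \<alpha> p z)))"] del: add_uminus_conv_diff uminus_add_conv_diff)
qed

lemma fock_kernel_admissible:
  assumes \<alpha>: "0 < \<alpha>" and p: "0 < p"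
  shows "fock_kernel \<alpha> a \<in> fock_admissible \<alpha> p"
proof -
  have w: "fock_weighted \<alpha> p (fock_kernel \<alpha> a) z = gauss \<alpha> p (- a + z)" for z
    using fock_weighted_kernel[of 1 \<alpha> p a z] by simp
  have "(LINT z|lborel. gauss \<alpha> p (- a + z)) = (LINT z|distr lborel borel ((+) (- a)). gauss \<alpha> p z)"
    by (subst integral_distr) auto
  also have "\<dots> = 2 * pi / (p * \<alpha>)"
    unfolding lborel_distr_plus using integrable_gauss[OF \<alpha> p] by simp
  finally have "(LINT z|lborel. fock_weighted \<alpha> p (fock_kernel \<alpha> a) z) = 2 * pi / (p * \<alpha>)" unfolding w .
  moreover have "fock_kernel \<alpha> a holomorphic_on UNIV"
    unfolding fock_kernel_def by (intro holomorphic_intros)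
  ultimately show ?thesis using \<alpha> p by (simp add: fock_admissible_def)
qed

lemma admissible_imp_normalized_weight:
  assumes \<alpha>: "0 < \<alpha>" and p: "0 < p" and f: "f \<in> fock_admissible \<alpha> p"
  shows "normalized_weight f \<alpha> p"
proof -
  have holo: "f holomorphic_on UNIV" and eq: "p * \<alpha> / (2 * pi) * (LINT z|lborel. fock_weighted \<alpha> p f z) = 1"
    using f by (auto simp: fock_admissible_def)
  from eq have n: "(LINT z|lborel. fock_weighted \<alpha> p f z) = 2 * pi / (p * \<alpha>)"
    using \<alpha> p by (simp add: field_simps)
  then have "integrable lborel (fock_weighted \<alpha> p f)"
    using \<alpha> p not_integrable_integral_eq[of lborel "fock_weighted \<alpha> p f"] by force
  then show ?thesis using holo \<alpha> p n by unfold_locales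
qed

lemma normalized_peak_imp_kernel:
  assumes "normalized_weight f \<alpha> p" and peak: "fock_weighted \<alpha> p f a = 1"
  obtains c where "norm c = 1" "f = (\<lambda>z. c * fock_kernel \<alpha> a z)"
proof -
  interpret normalized_weight f \<alpha> p by fact
  define g where "g = fock_translate \<alpha> a f"
  have w: "fock_weighted \<alpha> p g z = u (a + z)" for z unfolding g_def by (rule fock_translate_weighted)
  interpret G: peaked_weight g \<alpha> p
  proof unfold_locales
    show "g holomorphic_on UNIV" unfolding g_def by (rule fock_translate_holomorphic[OF holo])
    have "integrable (distr lborel borel ((+) a)) u" unfolding lborel_distr_plus by (rule int)
    then show "integrable lborel (fock_weighted \<alpha> p g)"
      unfolding w[abs_def] by (subst (asm) integrable_distr_eq) auto
    have "(LINT z|distr lborel borel ((+) a). u z) = 2 * pi / (p * \<alpha>)" unfolding lborel_distr_plus by (rule norm1)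
    then show "(LINT z|lborel. fock_weighted \<alpha> p g z) = 2 * pi / (p * \<alpha>)"
      unfolding w by (subst (asm) integral_distr) auto
    show "fock_weighted \<alpha> p g 0 = 1" using peak w[of 0] by simp
  qed (use \<alpha> p in auto)
  have "g = (\<lambda>z. g 0)" using G.peaked_constant(1) by blast
  then have "fock_translate \<alpha> a f = fock_translate \<alpha> a (\<lambda>z. g 0 * fock_kernel \<alpha> a z)"
    unfolding fock_translate_kernel g_def[symmetric] .
  from fock_translate_inj[OF this] show ?thesis using that[of "g 0"] G.peaked_constant(2) by blast
qed

theorem theorem4p2:
  fixes G :: "real \<Rightarrow> real" and \<alpha> p :: real
  assumes "continuous_on {0..1} G" and "convex_on {0..1} G" and "G 0 = 0"
    and "\<alpha> > 0" and "p > 0"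
  defines "S \<equiv> (SUP f\<in>fock_admissible \<alpha> p. fock_functional G \<alpha> p f)"
  shows "(\<forall>a. fock_kernel \<alpha> a \<in> fock_admissible \<alpha> p \<and>
              fock_functional G \<alpha> p (fock_kernel \<alpha> a) = S) \<and>
         (\<not> (\<exists>c. \<forall>t\<in>{0..1}. G t = c * t) \<and> S > -\<infinity> \<longrightarrow>
           (\<forall>f\<in>fock_admissible \<alpha> p. fock_functional G \<alpha> p f = S \<longrightarrow>
              (\<exists>a c. norm c = 1 \<and> f = (\<lambda>z. c * fock_kernel \<alpha> a z))))"
proof -
  note G = assms(1-3) and \<alpha> = assms(4) and p = assms(5)
  have ker: "fock_kernel \<alpha> a \<in> fock_admissible \<alpha> p" "fock_functional G \<alpha> p (fock_kernel \<alpha> a) = gauss_functional G \<alpha> p" for a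
    using fock_kernel_admissible[OF \<alpha> p] fock_functional_kernel[OF G(1) \<alpha> p] by auto
  have dich: "(\<exists>a c. norm c = 1 \<and> f = (\<lambda>z. c * fock_kernel \<alpha> a z) \<and> fock_functional G \<alpha> p f = gauss_functional G \<alpha> p) \<or>
      (fock_functional G \<alpha> p f \<le> gauss_functional G \<alpha> p \<and>
        (\<not> (\<exists>c. \<forall>t\<in>{0..1}. G t = c * t) \<longrightarrow> gauss_functional G \<alpha> p > -\<infinity> \<longrightarrow>
          fock_functional G \<alpha> p f \<noteq> gauss_functional G \<alpha> p))" if f: "f \<in> fock_admissible \<alpha> p" for f
  proof -
    interpret normalized_weight f \<alpha> p by (rule admissible_imp_normalized_weight[OF \<alpha> p f])
    obtain a where a: "\<And>z. u z \<le> u a" by (rule u_attains_max[OF int]) (rule that)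
    show ?thesis
    proof (cases "u a < 1")
      case True
      then show ?thesis using functional_le_gauss[OF G a True] by blast
    next
      case False
      then have "u a = 1" using u_le_1[of a] by simp
      then obtain c where c: "norm c = 1" "f = (\<lambda>z. c * fock_kernel \<alpha> a z)"
        using normalized_peak_imp_kernel[OF normalized_weight_axioms] by blast
      have "fock_weighted \<alpha> p f = fock_weighted \<alpha> p (fock_kernel \<alpha> a)"
        using c by (simp add: fock_weighted_def[abs_def] norm_mult)
      then have "fock_functional G \<alpha> p f = fock_functional G \<alpha> p (fock_kernel \<alpha> a)"
        by (simp add: fock_functional_def)
      then have "fock_functional G \<alpha> p f = gauss_functional G \<alpha> p" using ker(2) by simp
      with c show ?thesis by (intro disjI1 exI[of _ a] exI[of _ c] conjI)
    qed
  qed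
  have S: "S = gauss_functional G \<alpha> p"
    unfolding S_def
  proof (rule antisym)
    show "(SUP f\<in>fock_admissible \<alpha> p. fock_functional G \<alpha> p f) \<le> gauss_functional G \<alpha> p"
      using dich by (intro SUP_least) force
    show "gauss_functional G \<alpha> p \<le> (SUP f\<in>fock_admissible \<alpha> p. fock_functional G \<alpha> p f)"
      using SUP_upper[OF ker(1), of "fock_functional G \<alpha> p"] ker(2) by metis
  qed
  show ?thesis unfolding S using ker dich by blast
qed

end
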